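(* Let $\Delta$ be a Hermitian polar space of rank $n\ge 3$ and let $\theta$ be a nontrivial point-domestic collineation of $\Delta$ with a fixed point. Then $\theta$ is an ideal Baer involution and has opposition diagram $\mathsf{B}_{n;m}^2$, with $2m\in\{n-1,n\}$.
   Context: A Hermitian polar space is the polar space of a nondegenerate $\sigma$-Hermitian form over a commutative field $\mathbb K$ with nontrivial field involution $\sigma$. Points are opposite iff non-collinear; singular subspaces $X,Y$ are opposite iff they have the same projective dimension and every point of $X$ is opposite some point of $Y$. Point-domestic means that no point is mapped to an opposite point. $\mathrm{Diag}(\theta)=\mathsf B_{n;m}^2$ means that for $k\in\{1,\dots,n\}$, $\theta$ maps some singular subspace of projective dimension $k-1$ to an opposite one iff $k\in\{2,4,\dots,2m\}$. A Baer subspace of $\mathrm{PG}(d,\mathbb K)$ is a naturally included $\mathrm{PG}(d,\mathbb F)$, where $\mathbb F$ is a subfield over which $\mathbb K$ is $2$-dimensional. An ideal Baer sub polar space of a polar space $\Delta$ of rank $n$ is a sub polar space $\Delta'$ of rank $n$ such that every maximal singular subspace of $\Delta'$ is a Baer subspace of some maximal singular subspace of $\Delta$, and every maximal singular subspace of $\Delta$ containing a submaximal (i.e. $(n-2)$-dimensional) singular subspace of $\Delta'$ belongs to $\Delta'$. An ideal Baer involution is an involution that fixes an ideal Baer sub polar space of $\Delta$ and nothing more. *)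

theory Defs
  imports Complex_Main
begin

section \<open>Point-line geometries\<close>

record 'p geometry =
  points :: "'p set"
  lines :: "'p set set"

definition coll :: "'p geometry \<Rightarrow> 'p \<Rightarrow> 'p \<Rightarrow> bool" where
  "coll \<Gamma> x y \<longleftrightarrow> x \<in> points \<Gamma> \<and> y \<in> points \<Gamma> \<and> (x = y \<or> (\<exists>l\<in>lines \<Gamma>. x \<in> l \<and> y \<in> l))"

definition geom_subspace :: "'p geometry \<Rightarrow> 'p set \<Rightarrow> bool" where
  "geom_subspace \<Gamma> X \<longleftrightarrow> X \<subseteq> points \<Gamma> \<and>
     (\<forall>l\<in>lines \<Gamma>. (\<exists>x\<in>l \<inter> X. \<exists>y\<in>l \<inter> X. x \<noteq> y) \<longrightarrow> l \<subseteq> X)"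

definition generated :: "'p geometry \<Rightarrow> 'p set \<Rightarrow> 'p set" where
  "generated \<Gamma> S = \<Inter>{X. geom_subspace \<Gamma> X \<and> S \<subseteq> X}"

definition singular :: "'p geometry \<Rightarrow> 'p set \<Rightarrow> bool" where
  "singular \<Gamma> X \<longleftrightarrow> geom_subspace \<Gamma> X \<and> (\<forall>x\<in>X. \<forall>y\<in>X. coll \<Gamma> x y)"

definition max_singular :: "'p geometry \<Rightarrow> 'p set \<Rightarrow> bool" where
  "max_singular \<Gamma> X \<longleftrightarrow> singular \<Gamma> X \<and> (\<forall>Y. singular \<Gamma> Y \<and> X \<subseteq> Y \<longrightarrow> Y = X)"

text \<open>Projective dimension is read off from longest chains of nonempty subspaces: dimension
  \<open>d\<close> means that there is a chain \<open>C 0 \<subset> \<dots> \<subset> C d\<close> below \<open>X\<close>, but none with one more term.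
  The empty subspace (of dimension \<open>-1\<close>) satisfies \<open>has_pdim\<close> for no natural number.\<close>

definition has_chain :: "'p geometry \<Rightarrow> 'p set \<Rightarrow> nat \<Rightarrow> bool" where
  "has_chain \<Gamma> X d \<longleftrightarrow> (\<exists>C :: nat \<Rightarrow> 'p set.
     (\<forall>i\<le>d. geom_subspace \<Gamma> (C i) \<and> C i \<noteq> {} \<and> C i \<subseteq> X) \<and> (\<forall>i<d. C i \<subset> C (Suc i)))"

definition has_pdim :: "'p geometry \<Rightarrow> 'p set \<Rightarrow> nat \<Rightarrow> bool" where
  "has_pdim \<Gamma> X d \<longleftrightarrow> has_chain \<Gamma> X d \<and> \<not> has_chain \<Gamma> X (Suc d)"

definition has_rank :: "'p geometry \<Rightarrow> nat \<Rightarrow> bool" where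
  "has_rank \<Gamma> n \<longleftrightarrow> 1 \<le> n \<and> (\<forall>M. max_singular \<Gamma> M \<longrightarrow> has_pdim \<Gamma> M (n - 1))"

text \<open>The Buekenhout-Shult axioms; the finiteness of chains of singular subspaces is contained
  in \<open>has_rank\<close>.\<close>

definition polar_space_of_rank :: "'p geometry \<Rightarrow> nat \<Rightarrow> bool" where
  "polar_space_of_rank \<Gamma> n \<longleftrightarrow>
     (\<forall>l\<in>lines \<Gamma>. l \<subseteq> points \<Gamma> \<and> (\<exists>x\<in>l. \<exists>y\<in>l. \<exists>z\<in>l. x \<noteq> y \<and> y \<noteq> z \<and> x \<noteq> z)) \<and>
     (\<forall>x\<in>points \<Gamma>. \<exists>y\<in>points \<Gamma>. \<not> coll \<Gamma> x y) \<and>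
     (\<forall>x\<in>points \<Gamma>. \<forall>l\<in>lines \<Gamma>. (\<forall>y\<in>l. coll \<Gamma> x y) \<or> (\<exists>!y. y \<in> l \<and> coll \<Gamma> x y)) \<and>
     has_rank \<Gamma> n"

section \<open>Collineations and opposition\<close>

definition collineation :: "'p geometry \<Rightarrow> ('p \<Rightarrow> 'p) \<Rightarrow> bool" where
  "collineation \<Gamma> \<theta> \<longleftrightarrow> bij_betw \<theta> (points \<Gamma>) (points \<Gamma>) \<and>
     (\<forall>l. l \<subseteq> points \<Gamma> \<longrightarrow> (\<theta> ` l \<in> lines \<Gamma> \<longleftrightarrow> l \<in> lines \<Gamma>))"

definition nontrivial :: "'p geometry \<Rightarrow> ('p \<Rightarrow> 'p) \<Rightarrow> bool" where
  "nontrivial \<Gamma> \<theta> \<longleftrightarrow> (\<exists>x\<in>points \<Gamma>. \<theta> x \<noteq> x)"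

definition opposite_points :: "'p geometry \<Rightarrow> 'p \<Rightarrow> 'p \<Rightarrow> bool" where
  "opposite_points \<Gamma> x y \<longleftrightarrow> x \<in> points \<Gamma> \<and> y \<in> points \<Gamma> \<and> \<not> coll \<Gamma> x y"

definition opposite_subspaces :: "'p geometry \<Rightarrow> 'p set \<Rightarrow> 'p set \<Rightarrow> bool" where
  "opposite_subspaces \<Gamma> X Y \<longleftrightarrow> singular \<Gamma> X \<and> singular \<Gamma> Y \<and>
     (\<exists>d. has_pdim \<Gamma> X d \<and> has_pdim \<Gamma> Y d) \<and>
     (\<forall>x\<in>X. \<exists>y\<in>Y. opposite_points \<Gamma> x y)"

definition point_domestic :: "'p geometry \<Rightarrow> ('p \<Rightarrow> 'p) \<Rightarrow> bool" where
  "point_domestic \<Gamma> \<theta> \<longleftrightarrow> (\<forall>x\<in>points \<Gamma>. \<not> opposite_points \<Gamma> x (\<theta> x))"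

definition diagram_B2 :: "'p geometry \<Rightarrow> nat \<Rightarrow> nat \<Rightarrow> ('p \<Rightarrow> 'p) \<Rightarrow> bool" where
  "diagram_B2 \<Gamma> n m \<theta> \<longleftrightarrow> (\<forall>k\<in>{1..n}.
     (\<exists>X. singular \<Gamma> X \<and> has_pdim \<Gamma> X (k - 1) \<and> opposite_subspaces \<Gamma> X (\<theta> ` X))
       \<longleftrightarrow> k \<in> {2 * j | j. 1 \<le> j \<and> j \<le> m})"

section \<open>Sub polar spaces\<close>

text \<open>A sub polar space is given by its point set \<open>Q\<close>; its lines are the traces on \<open>Q\<close> of
  the lines of the ambient geometry with at least two points in \<open>Q\<close>.\<close>

definition induced :: "'p geometry \<Rightarrow> 'p set \<Rightarrow> 'p geometry" where
  "induced \<Gamma> Q = \<lparr>points = Q,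
     lines = {l \<inter> Q | l. l \<in> lines \<Gamma> \<and> (\<exists>x\<in>l \<inter> Q. \<exists>y\<in>l \<inter> Q. x \<noteq> y)}\<rparr>"

definition sub_polar_space :: "'p geometry \<Rightarrow> nat \<Rightarrow> 'p set \<Rightarrow> bool" where
  "sub_polar_space \<Gamma> n Q \<longleftrightarrow> Q \<subseteq> points \<Gamma> \<and> polar_space_of_rank (induced \<Gamma> Q) n"

text \<open>A singular subspace \<open>X\<close> of the ambient space belongs to the sub polar space \<open>Q\<close> if it is
  the extension to the big field (the subspace generated in the ambient space) of a singular
  subspace of the sub polar space.\<close>

definition belongs_to :: "'p geometry \<Rightarrow> 'p set \<Rightarrow> 'p set \<Rightarrow> bool" where
  "belongs_to \<Gamma> Q X \<longleftrightarrow> (\<exists>Y. singular (induced \<Gamma> Q) Y \<and> X = generated \<Gamma> Y)"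

definition subfield_index_two :: "'k::field set \<Rightarrow> bool" where
  "subfield_index_two F \<longleftrightarrow>
     0 \<in> F \<and> 1 \<in> F \<and>
     (\<forall>a\<in>F. \<forall>b\<in>F. a + b \<in> F \<and> a * b \<in> F) \<and> (\<forall>a\<in>F. - a \<in> F \<and> inverse a \<in> F) \<and>
     (\<exists>e f. \<forall>x. \<exists>!p. p \<in> F \<times> F \<and> x = fst p * e + snd p * f)"

section \<open>Hermitian polar spaces and ideal Baer involutions\<close>

text \<open>The vector space may have infinite dimension; only the rank is assumed finite later.\<close>

locale hermitian_form = vector_space scale
  for scale :: "'k::field \<Rightarrow> 'v::ab_group_add \<Rightarrow> 'v" +
  fixes \<sigma> :: "'k \<Rightarrow> 'k" and h :: "'v \<Rightarrow> 'v \<Rightarrow> 'k"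
  assumes sigma_add: "\<sigma> (a + b) = \<sigma> a + \<sigma> b"
    and sigma_mult: "\<sigma> (a * b) = \<sigma> a * \<sigma> b"
    and sigma_invol: "\<sigma> (\<sigma> a) = a"
    and sigma_nontrivial: "\<exists>a. \<sigma> a \<noteq> a"
    and form_add: "h (x + y) z = h x z + h y z"
    and form_scale: "h (scale a x) y = a * h x y"
    and form_hermitian: "h y x = \<sigma> (h x y)"
    and form_nondegenerate: "(\<forall>y. h x y = 0) \<Longrightarrow> x = 0"
begin

definition proj_points :: "'v set \<Rightarrow> 'v set set" where
  "proj_points U = {p. subspace p \<and> dim p = 1 \<and> p \<subseteq> U}"

definition totally_isotropic :: "'v set \<Rightarrow> bool" where
  "totally_isotropic U \<longleftrightarrow> subspace U \<and> (\<forall>x\<in>U. \<forall>y\<in>U. h x y = 0)"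

definition hermitian_polar_space :: "'v set geometry" where
  "hermitian_polar_space = \<lparr>points = {p. totally_isotropic p \<and> dim p = 1},
     lines = {proj_points U | U. totally_isotropic U \<and> dim U = 2}\<rparr>"

text \<open>A naturally included projective space over \<open>F\<close>: the points with coordinates in \<open>F\<close>
  with respect to some basis \<open>B\<close> of the vector space underlying \<open>X\<close>.\<close>

definition baer_subspace :: "'v set set \<Rightarrow> 'v set set \<Rightarrow> bool" where
  "baer_subspace Y X \<longleftrightarrow> (\<exists>F B. subfield_index_two F \<and> finite B \<and> independent B \<and>
     X = proj_points (span B) \<and>
     Y = {span {v} | v. v \<noteq> 0 \<and> (\<exists>c. (\<forall>b\<in>B. c b \<in> F) \<and> v = (\<Sum>b\<in>B. scale (c b) b))})"

definition ideal_baer_sub_polar_space :: "'v set geometry \<Rightarrow> nat \<Rightarrow> 'v set set \<Rightarrow> bool" where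
  "ideal_baer_sub_polar_space \<Gamma> n Q \<longleftrightarrow> has_rank \<Gamma> n \<and> sub_polar_space \<Gamma> n Q \<and>
     (\<forall>Y. max_singular (induced \<Gamma> Q) Y \<longrightarrow> (\<exists>X. max_singular \<Gamma> X \<and> baer_subspace Y X)) \<and>
     (\<forall>S M. singular (induced \<Gamma> Q) S \<and> has_pdim (induced \<Gamma> Q) S (n - 2) \<and>
        max_singular \<Gamma> M \<and> S \<subseteq> M \<longrightarrow> belongs_to \<Gamma> Q M)"

text \<open>``Nothing more'' refers to all elements of the polar space: neither further points nor
  singular subspaces not coming from the sub polar space are fixed.\<close>

definition ideal_baer_involution :: "'v set geometry \<Rightarrow> nat \<Rightarrow> ('v set \<Rightarrow> 'v set) \<Rightarrow> bool" where
  "ideal_baer_involution \<Gamma> n \<theta> \<longleftrightarrow>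
     collineation \<Gamma> \<theta> \<and> nontrivial \<Gamma> \<theta> \<and> (\<forall>x\<in>points \<Gamma>. \<theta> (\<theta> x) = x) \<and>
     (\<exists>Q. ideal_baer_sub_polar_space \<Gamma> n Q \<and>
        {x \<in> points \<Gamma>. \<theta> x = x} = Q \<and>
        (\<forall>X. singular \<Gamma> X \<and> \<theta> ` X = X \<longrightarrow> belongs_to \<Gamma> Q X))"

end

end

theory Submission
  imports Defs
begin

text \<open>Represent \<open>\<theta>\<close> by a map on isotropic vectors. If a point \<open>p\<close> is not fixed, choose a point
  \<open>x\<close> collinear with \<open>p\<close> but not with \<open>\<theta> p\<close>. Domesticity forces \<open>\<theta>\<close> to act on the line \<open>L = x p\<close> as the
  projection onto the opposite line \<open>\<theta> L\<close>, which is semilinear with companion \<open>\<sigma>\<close>; since only \<open>L\<close>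
  and \<open>\<theta> L\<close> meet all the lines joining \<open>z \<in> L\<close> to \<open>\<theta> z\<close>, it also forces \<open>\<theta>\<^sup>2 = 1\<close>. A fixed point \<open>e\<close>
  normalises representatives \<open>T v\<close> of \<open>\<theta> \<langle>v\<rangle>\<close> for \<open>v\<close> not orthogonal to \<open>e\<close>, and
  \<open>h (T v) (T w) = - \<sigma> (h v w)\<close> propagates along lines opposite their images. Hence \<open>T\<close> extends to a
  \<open>\<sigma>\<close>-semilinear involution of the whole vector space without the fundamental theorem of projective
  geometry. The form \<open>(x, y) \<mapsto> h x (T y)\<close> is alternating, so all fixed vectors of \<open>T\<close> are isotropic:
  they form the symplectic Baer structure, and a singular subspace is opposite its image
  exactly if the alternating form is nondegenerate on it.\<close>

section \<open>Linear algebra of the Hermitian form\<close>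

text \<open>The sign in \<open>h (T v) (T w) = - \<sigma> (h v w)\<close> is forced: polarising
  \<open>h x (T x) = 0\<close> gives \<open>h x (T y) = - h y (T x)\<close>, and \<open>T\<close> is
  an involution. In characteristic 2 a skew form need not be alternating, so domesticity itself has
  to be carried over to \<open>T\<close>; for the same reason isotropic vectors are produced by
  solving trace equations and never by halving. Two things shape the choice of auxiliary points. The
  space may have infinite dimension, so double perpendiculars are taken of finite sets only. The
  field may have just four elements; a hyperbolic line then has only three isotropic points and can
  be covered by three hyperplanes. Points off three hyperplanes are therefore sought on totally
  isotropic lines, which takes a further hyperbolic pair and hence rank 3. \<open>T\<close> is
  pinned down by its form values on a spanning set of vectors. Its additivity comes from uniqueness
  of the vector with given values, and its further properties cut out subspaces, so they need
  checking on the spanning set alone.\<close>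

context hermitian_form
begin

lemma sigma_0 [simp]: "\<sigma> 0 = 0"
  by (metis add_cancel_right_left sigma_add)

lemma sigma_eq_0_iff [simp]: "\<sigma> a = 0 \<longleftrightarrow> a = 0"
  by (metis sigma_0 sigma_invol)

lemma sigma_eq_iff: "\<sigma> a = \<sigma> b \<longleftrightarrow> a = b"
  by (metis sigma_invol)

lemma sigma_1 [simp]: "\<sigma> 1 = 1"
  using sigma_mult[of 1 1] by (metis mult_cancel_left1 mult_1 sigma_eq_0_iff zero_neq_one)

lemma sigma_minus: "\<sigma> (- a) = - \<sigma> a"
  using sigma_add[of a "- a"] by (simp add: eq_neg_iff_add_eq_0 add.commute)

lemma sigma_diff: "\<sigma> (a - b) = \<sigma> a - \<sigma> b"
  using sigma_add[of a "- b"] by (simp add: sigma_minus)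

lemma sigma_inverse: "\<sigma> (inverse a) = inverse (\<sigma> a)"
proof (cases "a = 0")
  case False
  then have "\<sigma> a * \<sigma> (inverse a) = 1"
    by (simp flip: sigma_mult)
  then show ?thesis
    by (simp add: inverse_unique)
qed simp

lemma sigma_divide: "\<sigma> (a / b) = \<sigma> a / \<sigma> b"
  by (simp add: divide_inverse sigma_mult sigma_inverse)

lemmas sigma_simps = sigma_add sigma_minus sigma_diff sigma_mult sigma_inverse sigma_divide sigma_invol

lemma form_add_right: "h x (y + z) = h x y + h x z"
  by (metis form_add form_hermitian sigma_add)

lemma form_scale_right: "h x (scale a y) = \<sigma> a * h x y"
  by (metis form_hermitian form_scale sigma_mult)

lemma form_0_left [simp]: "h 0 y = 0"
  using form_scale[of 0 0 y] by simp

lemma form_0_right [simp]: "h x 0 = 0"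
  using form_hermitian[of x 0] by simp

lemma form_minus_left: "h (- x) y = - h x y"
  using form_scale[of "-1" x y] by simp

lemma form_minus_right: "h x (- y) = - h x y"
  using form_scale_right[of x "-1" y] by (simp add: sigma_minus)

lemma form_diff_left: "h (x - y) z = h x z - h y z"
  using form_add[of x "- y" z] by (simp add: form_minus_left)

lemma form_diff_right: "h x (y - z) = h x y - h x z"
  using form_add_right[of x y "- z"] by (simp add: form_minus_right)

lemmas form_simps = form_add form_add_right form_scale form_scale_right
  form_minus_left form_minus_right form_diff_left form_diff_right

lemma form_eq_0_sym: "h x y = 0 \<longleftrightarrow> h y x = 0"
  using form_hermitian[of x y] form_hermitian[of y x] by auto

text \<open>If all traces vanished, the trace of 1 would give characteristic 2, and then
  \<open>\<sigma>\<close> would be the identity.\<close>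

lemma trace_nonzero: obtains b where "b + \<sigma> b \<noteq> 0"
proof (rule ccontr)
  assume *: "\<not> thesis"
  then have eq: "b + \<sigma> b = 0" for b
    using that by blast
  have "b = \<sigma> b" for b
    using eq[of 1] eq[of b]
    by (metis add_eq_0_iff2 mult.left_neutral mult_minus1 sigma_1)
  then show False
    using sigma_nontrivial by metis
qed

text \<open>A scalar \<open>b\<close> of nonzero trace, multiplied by the fixed scalar
  \<open>a / (b + \<sigma> b)\<close>, has trace \<open>a\<close>. Characteristic 2 is covered
  because 2 is never inverted.\<close>

lemma trace_surj:
  assumes "\<sigma> a = a"
  obtains c where "c + \<sigma> c = a"
proof -
  obtain b where b: "b + \<sigma> b \<noteq> 0"
    by (rule trace_nonzero)
  let ?t = "b + \<sigma> b"
  have "\<sigma> ?t = ?t"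
    by (simp add: sigma_simps add.commute)
  then have "\<sigma> (a * b / ?t) = a * \<sigma> b / ?t"
    using assms by (simp add: sigma_divide sigma_mult)
  then have "a * b / ?t + \<sigma> (a * b / ?t) = a * ?t / ?t"
    by (simp only: add_divide_distrib distrib_left)
  also have "\<dots> = a"
    using b by simp
  finally show thesis
    by (rule that)
qed

lemma skew_scalar: obtains \<epsilon> where "\<epsilon> \<noteq> 0" "\<sigma> \<epsilon> = - \<epsilon>"
proof -
  obtain a where "\<sigma> a \<noteq> a"
    using sigma_nontrivial by blast
  then show thesis
    by (intro that[of "a - \<sigma> a"]) (auto simp: sigma_simps)
qed

text \<open>A scalar \<open>a\<close> moved by \<open>\<sigma>\<close> gives the three distinct
  nonzero scalars \<open>1\<close>, \<open>a\<close>, \<open>\<sigma> a\<close>. The field with four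
  elements has no others, so two forbidden values are the limit.\<close>

lemma scalar_avoid:
  fixes b c :: 'k
  obtains t where "t \<noteq> 0" "t \<noteq> b" "t \<noteq> c"
proof -
  obtain a where a: "\<sigma> a \<noteq> a"
    using sigma_nontrivial by blast
  then have "a \<noteq> 0" "a \<noteq> 1" "\<sigma> a \<noteq> 0" "\<sigma> a \<noteq> 1"
    using sigma_eq_iff[of a 1] by auto
  then show thesis
    using that[of 1] that[of a] that[of "\<sigma> a"] a by (metis zero_neq_one)
qed

lemma mem_span_single: "x \<in> span {v} \<longleftrightarrow> (\<exists>a. x = scale a v)"
  by (auto simp: span_singleton)

lemma span_single_sym:
  assumes "x \<in> span {y}" "x \<noteq> 0"
  shows "y \<in> span {x}"
proof -
  obtain c where c: "x = scale c y"
    using assms by (auto simp: mem_span_single)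
  then have "c \<noteq> 0"
    using assms by auto
  then have "y = scale (inverse c) x"
    using c by simp
  then show ?thesis
    by (auto simp: mem_span_single)
qed

lemma mem_span_pair: "x \<in> span {v, w} \<longleftrightarrow> (\<exists>a b. x = scale a v + scale b w)"
proof -
  have "x \<in> span {v, w} \<longleftrightarrow> (\<exists>a b. x - scale a v = scale b w)"
    by (simp add: span_insert[of v] mem_span_single)
  then show ?thesis
    by (simp add: diff_eq_eq add.commute)
qed

section \<open>Orthogonality and isotropic vectors off given hyperplanes\<close>

definition perp :: "'v set \<Rightarrow> 'v set" where
  "perp A = {x. \<forall>y\<in>A. h x y = 0}"

lemma subspace_perp: "subspace (perp A)"
  by (auto simp: perp_def subspace_def form_simps)

lemma mem_perp_insert: "x \<in> perp (insert a A) \<longleftrightarrow> h x a = 0 \<and> x \<in> perp A"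
  by (auto simp: perp_def)

lemma mem_perp_empty: "x \<in> perp {}"
  by (simp add: perp_def)

lemma perp_span:
  assumes "x \<in> perp A" "y \<in> span A"
  shows "h x y = 0"
  using assms(2)
proof (induction rule: span_induct_alt)
  case (step c y z)
  then show ?case
    using assms(1) by (simp add: perp_def form_simps)
qed simp

text \<open>Finiteness of \<open>A\<close> replaces finiteness of the dimension. If some
  \<open>y0\<close> in \<open>perp A\<close> is not orthogonal to \<open>a\<close>, every
  \<open>y\<close> in \<open>perp A\<close> is a multiple of \<open>y0\<close> plus a vector of
  \<open>perp (insert a A)\<close>, so subtracting the multiple of \<open>a\<close> fitted to
  \<open>y0\<close> from \<open>b\<close> leaves a vector killed by all of
  \<open>perp A\<close>.\<close>

lemma perp_perp:
  assumes "finite A" "\<And>y. y \<in> perp A \<Longrightarrow> h y b = 0"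
  shows "b \<in> span A"
  using assms
proof (induction A arbitrary: b rule: finite_induct)
  case empty
  then have "h y b = 0" for y
    by (simp add: mem_perp_empty)
  then have "b = 0"
    using form_nondegenerate[of b] form_eq_0_sym by blast
  then show ?case
    by simp
next
  case (insert a A)
  show ?case
  proof (cases "\<forall>y\<in>perp A. h y a = 0")
    case True
    then have "b \<in> span A"
      using insert by (simp add: mem_perp_insert)
    then show ?thesis
      using span_mono[of A "insert a A"] by blast
  next
    case False
    then obtain y0 where y0: "y0 \<in> perp A" "h y0 a \<noteq> 0"
      by blast
    let ?c = "\<sigma> (h y0 b / h y0 a)"
    have "h y (b - scale ?c a) = 0" if y: "y \<in> perp A" for y
    proof -
      let ?y = "y - scale (h y a / h y0 a) y0"
      have "?y \<in> perp (insert a A)"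
        using y y0 by (simp add: perp_def form_simps)
      then have "h ?y b = 0"
        by (rule insert.prems)
      then show ?thesis
        using y0 by (simp add: form_simps sigma_invol field_simps)
    qed
    then have "b - scale ?c a \<in> span A"
      by (rule insert.IH)
    then show ?thesis
      by (auto simp: span_insert)
  qed
qed

definition isotropic :: "'v \<Rightarrow> bool" where
  "isotropic v \<longleftrightarrow> v \<noteq> 0 \<and> h v v = 0"

text \<open>Moving \<open>y\<close> along the isotropic \<open>a\<close> changes
  \<open>h y y\<close> by the trace of an arbitrary scalar, and \<open>- h y y\<close> is fixed by
  \<open>\<sigma>\<close>, hence a trace.\<close>

lemma isotropic_adjust:
  assumes "h a a = 0" "h y a \<noteq> 0"
  obtains c where "h (y + scale c a) (y + scale c a) = 0"
proof -
  have "\<sigma> (- h y y) = - h y y"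
    by (metis form_hermitian sigma_minus)
  then obtain d where d: "d + \<sigma> d = - h y y"
    by (rule trace_surj)
  have "h (y + scale (\<sigma> (d / h y a)) a) (y + scale (\<sigma> (d / h y a)) a) = h y y + (d + \<sigma> d)"
    using assms by (simp add: form_simps sigma_simps form_hermitian[of y a])
  then show thesis
    using d that by simp
qed

text \<open>Refines the double perpendicular: the witness against \<open>z\<close> may be taken
  isotropic as soon as \<open>perp A\<close> has an isotropic vector \<open>a\<close> outside
  \<open>span A\<close>. Either \<open>a\<close> is that witness, or it is orthogonal to
  \<open>z\<close> and any witness can be made isotropic along \<open>a\<close> without changing its
  product with \<open>z\<close>.\<close>

lemma isotropic_detect:
  assumes A: "finite A" and z: "z \<notin> span A" and a: "h a a = 0" "a \<in> perp A" "a \<notin> span A"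
  obtains s where "isotropic s" "s \<in> perp A" "h s z \<noteq> 0"
proof -
  obtain y where y: "y \<in> perp A" "h y z \<noteq> 0"
    using perp_perp[OF A] z by blast
  obtain y1 where y1: "y1 \<in> perp A" "h y1 a \<noteq> 0"
    using perp_perp[OF A] a by blast
  \<comment> \<open>\<open>perp A\<close> is not the union of the two hyperplanes orthogonal to
    \<open>z\<close> and to \<open>a\<close>: one of \<open>y\<close>, \<open>y1\<close>,
    \<open>y + y1\<close> lies in neither.\<close>
  obtain w where w: "w \<in> perp A" "h w z \<noteq> 0" "h w a \<noteq> 0"
  proof -
    have "y + y1 \<in> perp A"
      using y y1 subspace_perp subspace_add by blast
    then show thesis
      using that[of y] that[of y1] that[of "y + y1"] y y1 by (force simp: form_simps)
  qed
  show thesis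
  proof (cases "h a z = 0")
    case False
    then have "a \<noteq> 0"
      by auto
    then show thesis
      using that[of a] a False by (simp add: isotropic_def)
  next
    case True
    obtain c where c: "h (w + scale c a) (w + scale c a) = 0"
      using isotropic_adjust a w by blast
    have "h (w + scale c a) z = h w z"
      using True by (simp add: form_simps)
    moreover from this have "w + scale c a \<noteq> 0"
      using w by (metis form_0_left)
    moreover have "w + scale c a \<in> perp A"
      using a w by (simp add: subspace_perp subspace_add subspace_scale)
    ultimately show thesis
      using c w that by (simp add: isotropic_def)
  qed
qed

text \<open>If each of \<open>s1\<close>, \<open>s2\<close> avoids one hyperplane and lies in the
  other, every \<open>s1 + t s2\<close> with \<open>t \<noteq> 0\<close> avoids both, and only
  isotropy remains to be arranged.\<close>

lemma avoid_two:
  assumes W: "subspace W"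
    and s1: "isotropic s1" "s1 \<in> W" "h s1 z1 \<noteq> 0"
    and s2: "isotropic s2" "s2 \<in> W" "h s2 z2 \<noteq> 0"
  obtains s where "isotropic s" "s \<in> W" "h s z1 \<noteq> 0" "h s z2 \<noteq> 0"
proof (cases "h s1 z2 = 0 \<and> h s2 z1 = 0")
  case True
  obtain t where t: "t \<noteq> 0" "h (s1 + scale t s2) (s1 + scale t s2) = 0"
  proof (cases "h s1 s2 = 0")
    case True
    then show thesis
      using s1 s2 form_eq_0_sym[of s1 s2]
      by (intro that[of 1]) (auto simp: form_simps isotropic_def)
  next
    case False
    \<comment> \<open>With the chosen \<open>t\<close> the two mixed terms become
      \<open>\<epsilon>\<close> and \<open>\<sigma> \<epsilon> = - \<epsilon>\<close>, which
      cancel.\<close>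
    obtain \<epsilon> where e: "\<epsilon> \<noteq> 0" "\<sigma> \<epsilon> = - \<epsilon>"
      by (rule skew_scalar)
    show thesis
      using s1 s2 e False
      by (intro that[of "\<sigma> (\<epsilon> / h s1 s2)"])
        (auto simp: form_simps isotropic_def sigma_simps form_hermitian[of s1 s2])
  qed
  have "h (s1 + scale t s2) z1 \<noteq> 0" "h (s1 + scale t s2) z2 \<noteq> 0"
    using True s1 s2 t by (simp_all add: form_simps)
  moreover from this have "s1 + scale t s2 \<noteq> 0"
    by (metis form_0_left)
  moreover have "s1 + scale t s2 \<in> W"
    using s1 s2 W by (simp add: subspace_add subspace_scale)
  ultimately show thesis
    using that t by (simp add: isotropic_def)
next
  case False
  then show thesis
    using that s1 s2 by blast
qed

text \<open>Each of the two hyperplanes excludes at most one \<open>t\<close>. The condition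
  \<open>t \<noteq> 0\<close> serves a third hyperplane that contains \<open>p\<close> but not
  \<open>q\<close>.\<close>

lemma avoid_on_line:
  assumes "h p z1 \<noteq> 0" "h p z2 \<noteq> 0"
  obtains t where "t \<noteq> 0" "h (p + scale t q) z1 \<noteq> 0" "h (p + scale t q) z2 \<noteq> 0"
proof -
  obtain t where t: "t \<noteq> 0" "t \<noteq> - h p z1 / h q z1" "t \<noteq> - h p z2 / h q z2"
    by (rule scalar_avoid)
  have "h (p + scale t q) z \<noteq> 0" if "h p z \<noteq> 0" "t \<noteq> - h p z / h q z" for z
    using that by (cases "h q z = 0") (auto simp: form_simps field_simps add_eq_0_iff)
  then show thesis
    using that t assms by blast
qed

text \<open>A totally isotropic line joining a point \<open>p\<close> off the first two hyperplanes
  to a point \<open>q\<close> off the third has a point off all three. If \<open>p\<close> and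
  \<open>s3\<close> are not orthogonal, \<open>hyp\<close> supplies a hyperbolic pair
  \<open>a\<close>, \<open>b\<close> orthogonal to both: either \<open>a\<close> can replace
  \<open>s3\<close>, or \<open>p\<close> and \<open>s3\<close> are shifted along \<open>b\<close>
  and \<open>a\<close> until they are orthogonal.\<close>

lemma avoid_three:
  assumes W: "subspace W"
    and hyp: "\<And>p q. \<lbrakk>isotropic p; isotropic q; p \<in> W; q \<in> W; h p q \<noteq> 0\<rbrakk> \<Longrightarrow>
      \<exists>a b. isotropic a \<and> isotropic b \<and> a \<in> W \<and> b \<in> W \<and> a \<in> perp {p, q} \<and> b \<in> perp {p, q} \<and> h a b \<noteq> 0"
    and s1: "isotropic s1" "s1 \<in> W" "h s1 z1 \<noteq> 0"
    and s2: "isotropic s2" "s2 \<in> W" "h s2 z2 \<noteq> 0"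
    and s3: "isotropic s3" "s3 \<in> W" "h s3 z3 \<noteq> 0"
  obtains s where "isotropic s" "s \<in> W" "h s z1 \<noteq> 0" "h s z2 \<noteq> 0" "h s z3 \<noteq> 0"
proof -
  note found = that
  have perp_case: thesis
    if p: "isotropic p" "p \<in> W" "h p z1 \<noteq> 0" "h p z2 \<noteq> 0"
      and q: "isotropic q" "q \<in> W" "h q z3 \<noteq> 0" and pq: "h p q = 0" for p q
  proof (cases "h p z3 = 0")
    case True
    obtain t where t: "t \<noteq> 0" "h (p + scale t q) z1 \<noteq> 0" "h (p + scale t q) z2 \<noteq> 0"
      using avoid_on_line p by blast
    have "p + scale t q \<noteq> 0"
      using t by (metis form_0_left)
    moreover have "h (p + scale t q) (p + scale t q) = 0"
      using p q pq form_eq_0_sym[of p q] by (simp add: form_simps isotropic_def)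
    moreover have "h (p + scale t q) z3 \<noteq> 0"
      using True q t by (simp add: form_simps)
    moreover have "p + scale t q \<in> W"
      using p q W by (simp add: subspace_add subspace_scale)
    ultimately show thesis
      using found t unfolding isotropic_def by blast
  next
    case False
    then show thesis
      using found p by blast
  qed
  obtain p where p: "isotropic p" "p \<in> W" "h p z1 \<noteq> 0" "h p z2 \<noteq> 0"
    using avoid_two[OF W s1 s2] by blast
  show thesis
  proof (cases "h p s3 = 0")
    case True
    then show thesis
      using perp_case p s3 by blast
  next
    case False
    then obtain a b where ab: "isotropic a" "isotropic b" "a \<in> W" "b \<in> W"
      "h a p = 0" "h a s3 = 0" "h b p = 0" "h b s3 = 0" "h a b \<noteq> 0"
      using hyp[of p s3] p s3 by (auto simp: perp_def)
    show thesis
    proof (cases "h a z3 = 0")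
      case False
      then show thesis
        using perp_case[OF p, of a] ab form_eq_0_sym by blast
    next
      case True
      obtain t where t: "t \<noteq> 0" "h (p + scale t b) z1 \<noteq> 0" "h (p + scale t b) z2 \<noteq> 0"
        using avoid_on_line p by blast
      let ?p = "p + scale t b"
      \<comment> \<open>\<open>?u\<close> solves \<open>h p s3 + t * ?u * h b a = 0\<close>. Since
        \<open>a\<close> is orthogonal to \<open>z3\<close>, the shifted \<open>?q\<close> keeps its
        product with \<open>z3\<close>.\<close>
      let ?u = "- h p s3 / (t * h b a)"
      let ?q = "s3 + scale (\<sigma> ?u) a"
      have sym: "h p a = 0" "h s3 a = 0" "h p b = 0" "h b a \<noteq> 0"
        using ab form_eq_0_sym by blast+
      have "?p \<noteq> 0"
        using t by (metis form_0_left)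
      then have 1: "isotropic ?p" "?p \<in> W"
        using p ab sym W by (auto simp: form_simps isotropic_def subspace_add subspace_scale)
      have qz: "h ?q z3 \<noteq> 0"
        using True s3 by (simp add: form_simps)
      then have "?q \<noteq> 0"
        by (metis form_0_left)
      then have 2: "isotropic ?q" "?q \<in> W"
        using s3 ab sym W by (auto simp: form_simps isotropic_def subspace_add subspace_scale)
      have "h ?p ?q = h p s3 + t * ?u * h b a"
        using ab sym by (simp add: form_simps sigma_simps)
      also have "\<dots> = 0"
        using sym t by (simp add: field_simps)
      finally show thesis
        using perp_case[OF 1 t(2,3) 2 qz] by blast
    qed
  qed
qed

end

section \<open>Singular subspaces and their dimensions\<close>

context hermitian_form
begin

text \<open>A finite basis is demanded because \<open>dim\<close> is 0 on infinite-dimensional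
  spaces too and would not tell them from the zero space.\<close>

definition fdim :: "'v set \<Rightarrow> nat \<Rightarrow> bool" where
  "fdim U k \<longleftrightarrow> (\<exists>B. finite B \<and> independent B \<and> span B = U \<and> card B = k)"

lemma fdim_subspace: "fdim U k \<Longrightarrow> subspace U"
  by (auto simp: fdim_def)

lemma fdim_bound:
  assumes "fdim U k" "independent B" "B \<subseteq> U"
  shows "finite B \<and> card B \<le> k"
  using assms independent_span_bound unfolding fdim_def by blast

lemma fdim_unique:
  assumes "fdim U k" "fdim U j"
  shows "k = j"
proof -
  obtain B C where "independent B" "span B = U" "card B = k" "independent C" "span C = U" "card C = j"
    using assms unfolding fdim_def by blast
  then show ?thesis
    using fdim_bound[OF assms(1), of C] fdim_bound[OF assms(2), of B] span_superset
    by (metis le_antisym)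
qed

lemma subspace_span_self: "subspace U \<Longrightarrow> span U = U"
  using span_eq_iff by blast

lemma fdim_subset:
  assumes U: "fdim U k" and W: "subspace W" "W \<subseteq> U"
  obtains j where "fdim W j" "j \<le> k"
proof -
  obtain B where B: "B \<subseteq> W" "independent B" "W \<subseteq> span B"
    using maximal_independent_subset[of W] by blast
  then have "finite B \<and> card B \<le> k"
    using fdim_bound[OF U] W by blast
  moreover have "span B = W"
    using B W span_minimal by blast
  ultimately show thesis
    using that B unfolding fdim_def by blast
qed

lemma mem_span_insert:
  assumes "subspace U"
  shows "x \<in> span (insert v U) \<longleftrightarrow> (\<exists>c. \<exists>u\<in>U. x = u + scale c v)"
proof -
  have "x \<in> span (insert v U) \<longleftrightarrow> (\<exists>c. x - scale c v \<in> U)"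
    by (simp add: span_insert subspace_span_self[OF assms])
  then show ?thesis
    by (metis add_diff_cancel diff_add_cancel)
qed

lemma span_insert_span: "span (insert v (span B)) = span (insert v B)"
  by (simp add: span_insert subspace_span_self)

lemma fdim_insert:
  assumes U: "fdim U k" and v: "v \<notin> U"
  shows "fdim (span (insert v U)) (Suc k)"
proof -
  obtain B where B: "finite B" "independent B" "span B = U" "card B = k"
    using U unfolding fdim_def by blast
  have "v \<notin> B"
    using v B span_base by blast
  moreover have "independent (insert v B)"
    using v B by (simp add: independent_insertI independent_empty)
  moreover have "span (insert v B) = span (insert v U)"
    using B span_insert_span by blast
  ultimately show ?thesis
    using B unfolding fdim_def by (intro exI[of _ "insert v B"]) simp
qed

lemma fdim_eq:
  assumes "fdim U k" "fdim W k" "W \<subseteq> U"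
  shows "W = U"
proof (rule ccontr)
  assume "W \<noteq> U"
  then obtain v where v: "v \<in> U" "v \<notin> W"
    using assms(3) by blast
  then have S: "fdim (span (insert v W)) (Suc k)"
    using fdim_insert assms(2) by blast
  moreover have "span (insert v W) \<subseteq> U"
    using assms v fdim_subspace by (intro span_minimal) auto
  ultimately obtain j where "fdim (span (insert v W)) j" "j \<le> k"
    using fdim_subset[OF assms(1)] fdim_subspace by metis
  then show False
    using fdim_unique[OF S] by fastforce
qed

lemma fdim_0: "fdim {0} 0"
  unfolding fdim_def by (intro exI[of _ "{}"]) (simp add: independent_empty)

lemma span_singleton_subset_iff: "subspace U \<Longrightarrow> span {v} \<subseteq> U \<longleftrightarrow> v \<in> U"
  using span_minimal[of "{v}" U] span_base[of v "{v}"] by blast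

lemma span_single_eq:
  assumes "x \<in> span {y}" "x \<noteq> 0"
  shows "span {x} = span {y}"
  using assms span_single_sym[OF assms]
  by (metis span_singleton_subset_iff subset_antisym subspace_span)

lemma span_pair_eq:
  assumes "x \<in> span {v, w}" "y \<in> span {v, w}" "x \<noteq> 0" "y \<notin> span {x}"
  shows "span {x, y} = span {v, w}"
proof -
  have "v \<noteq> 0 \<or> w \<noteq> 0"
    using assms(1,3) by (auto simp: mem_span_pair)
  have x: "fdim (span {x}) 1"
    unfolding fdim_def using assms by (intro exI[of _ "{x}"]) (simp add: independent_insertI independent_empty)
  have xy: "fdim (span {x, y}) 2"
    using fdim_insert[OF x assms(4)]
    by (simp add: span_insert_span insert_commute[of y] numeral_2_eq_2)
  have sub: "span {x, y} \<subseteq> span {v, w}"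
    using assms by (intro span_minimal) auto
  obtain B where B: "B \<subseteq> {v, w}" "independent B" "{v, w} \<subseteq> span B"
    using maximal_independent_subset[of "{v, w}"] by blast
  have "finite B" "card B \<le> 2"
    using B(1) finite_subset card_mono[of "{v, w}" B] card_insert_le_m1[of 2 "{w}" v]
    by (auto intro: order_trans)
  moreover have "span B = span {v, w}"
    using B by (intro subset_antisym span_mono span_minimal) auto
  ultimately have vw: "fdim (span {v, w}) (card B)"
    using B unfolding fdim_def by blast
  obtain j where "fdim (span {x, y}) j" "j \<le> card B"
    using fdim_subset[OF vw subspace_span sub] by blast
  then have "card B = 2"
    using fdim_unique[OF xy] \<open>card B \<le> 2\<close> by fastforce
  then show ?thesis
    using fdim_eq[of "span {v, w}" 2] vw xy sub by simp
qed

lemma independent_nonzero: "independent B \<Longrightarrow> v \<in> B \<Longrightarrow> v \<noteq> 0"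
  using dependent_zero[of B] by auto

section \<open>Points, lines and singular subspaces as linear subspaces\<close>

lemma point_iff: "subspace p \<and> dim p = 1 \<longleftrightarrow> (\<exists>v. v \<noteq> 0 \<and> p = span {v})"
proof
  assume p: "subspace p \<and> dim p = 1"
  obtain B where B: "B \<subseteq> p" "independent B" "p \<subseteq> span B" "card B = dim p"
    using basis_exists[of p] by blast
  then obtain v where v: "B = {v}"
    using p card_1_singletonE[of B] by auto
  then have "v \<noteq> 0"
    using B dependent_zero[of B] by auto
  moreover have "p = span {v}"
    using B p v span_minimal[of B p] by auto
  ultimately show "\<exists>v. v \<noteq> 0 \<and> p = span {v}"
    by blast
next
  assume "\<exists>v. v \<noteq> 0 \<and> p = span {v}"
  then obtain v where "v \<noteq> 0" "p = span {v}"
    by blast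
  then show "subspace p \<and> dim p = 1"
    using dim_span_eq_card_independent[of "{v}"] by (simp add: independent_insertI independent_empty)
qed

lemma proj_points_iff:
  assumes "subspace U"
  shows "p \<in> proj_points U \<longleftrightarrow> (\<exists>v. v \<in> U \<and> v \<noteq> 0 \<and> p = span {v})"
proof -
  have "p \<in> proj_points U \<longleftrightarrow> (\<exists>v. v \<noteq> 0 \<and> p = span {v}) \<and> p \<subseteq> U"
    using point_iff[of p] by (auto simp: proj_points_def)
  then show ?thesis
    using span_singleton_subset_iff[OF assms] by blast
qed

lemma span_in_proj_points:
  assumes "subspace U" "v \<noteq> 0"
  shows "span {v} \<in> proj_points U \<longleftrightarrow> v \<in> U"
  using proj_points_iff[OF assms(1)] span_singleton_subset_iff[OF assms(1)] assms(2) by metis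

lemma span_Union_proj_points:
  assumes "subspace U"
  shows "span (\<Union>(proj_points U)) = U"
proof
  show "span (\<Union>(proj_points U)) \<subseteq> U"
    using assms by (intro span_minimal) (auto simp: proj_points_def)
  show "U \<subseteq> span (\<Union>(proj_points U))"
  proof
    fix x assume x: "x \<in> U"
    show "x \<in> span (\<Union>(proj_points U))"
    proof (cases "x = 0")
      case False
      then have "span {x} \<in> proj_points U"
        using x assms span_in_proj_points by blast
      then show ?thesis
        using span_base[of x "{x}"] by (intro span_base) auto
    qed (simp add: span_zero)
  qed
qed

lemma totally_isotropic_span:
  assumes "\<And>x y. x \<in> A \<Longrightarrow> y \<in> A \<Longrightarrow> h x y = 0"
  shows "totally_isotropic (span A)"
proof -
  have "A \<subseteq> perp A"
    using assms by (auto simp: perp_def)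
  then have "span A \<subseteq> perp A"
    using span_minimal subspace_perp by blast
  then show ?thesis
    using perp_span by (auto simp: totally_isotropic_def)
qed

lemma totally_isotropic_isotropic: "totally_isotropic U \<Longrightarrow> v \<in> U \<Longrightarrow> v \<noteq> 0 \<Longrightarrow> isotropic v"
  by (simp add: totally_isotropic_def isotropic_def)

abbreviation \<Gamma> :: "'v set geometry" where
  "\<Gamma> \<equiv> hermitian_polar_space"

lemma mem_points: "p \<in> points \<Gamma> \<longleftrightarrow> (\<exists>v. isotropic v \<and> p = span {v})"
proof -
  have "totally_isotropic (span {v}) \<longleftrightarrow> h v v = 0" for v
    using totally_isotropic_span[of "{v}"] span_base[of v "{v}"]
    by (auto simp: totally_isotropic_def)
  moreover have "p \<in> points \<Gamma> \<longleftrightarrow> totally_isotropic p \<and> (subspace p \<and> dim p = 1)"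
    by (auto simp: hermitian_polar_space_def totally_isotropic_def)
  ultimately show ?thesis
    unfolding point_iff isotropic_def by blast
qed

lemma mem_lines:
  "l \<in> lines \<Gamma> \<longleftrightarrow>
    (\<exists>v w. isotropic v \<and> isotropic w \<and> h v w = 0 \<and> w \<notin> span {v} \<and> l = proj_points (span {v, w}))"
proof
  assume "l \<in> lines \<Gamma>"
  then obtain U where U: "totally_isotropic U" "dim U = 2" "l = proj_points U"
    by (auto simp: hermitian_polar_space_def)
  obtain B where B: "B \<subseteq> U" "independent B" "U \<subseteq> span B" "card B = 2"
    using basis_exists[of U] U by metis
  then obtain v w where vw: "B = {v, w}" "v \<noteq> w"
    by (auto simp: card_2_iff)
  have "subspace U"
    using U by (simp add: totally_isotropic_def)
  then have "U = span {v, w}"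
    using B vw span_minimal[of B U] by auto
  moreover have "v \<noteq> 0" "w \<noteq> 0"
    using B(2) vw independent_nonzero by auto
  moreover have "w \<notin> span {v}"
  proof -
    have "B - {w} = {v}"
      using vw by auto
    then show ?thesis
      using B(2) vw(1) unfolding dependent_def by auto
  qed
  moreover have "v \<in> U" "w \<in> U"
    using B vw by blast+
  then have "isotropic v" "isotropic w" "h v w = 0"
    using U(1) \<open>v \<noteq> 0\<close> \<open>w \<noteq> 0\<close> totally_isotropic_isotropic
    by (auto simp: totally_isotropic_def)
  ultimately show "\<exists>v w. isotropic v \<and> isotropic w \<and> h v w = 0 \<and> w \<notin> span {v} \<and>
      l = proj_points (span {v, w})"
    using U(3) by blast
next
  assume "\<exists>v w. isotropic v \<and> isotropic w \<and> h v w = 0 \<and> w \<notin> span {v} \<and>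
      l = proj_points (span {v, w})"
  then obtain v w where vw: "isotropic v" "isotropic w" "h v w = 0" "w \<notin> span {v}"
      "l = proj_points (span {v, w})"
    by blast
  have "totally_isotropic (span {v, w})"
    using vw form_eq_0_sym[of v w] by (intro totally_isotropic_span) (auto simp: isotropic_def)
  moreover have "independent {w, v}"
    using vw by (simp add: independent_insertI independent_empty isotropic_def)
  then have "dim (span {w, v}) = card {w, v}"
    by (rule dim_span_eq_card_independent)
  then have "dim (span {v, w}) = 2"
    using vw(4) span_base[of v "{v}"] by (cases "v = w") (auto simp: insert_commute)
  ultimately show "l \<in> lines \<Gamma>"
    using vw(5) by (auto simp: hermitian_polar_space_def)
qed

lemma coll_iff:
  assumes "isotropic v" "isotropic w"
  shows "coll \<Gamma> (span {v}) (span {w}) \<longleftrightarrow> h v w = 0"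
proof
  assume "coll \<Gamma> (span {v}) (span {w})"
  then consider "span {v} = span {w}" | l where "l \<in> lines \<Gamma>" "span {v} \<in> l" "span {w} \<in> l"
    unfolding coll_def by blast
  then show "h v w = 0"
  proof cases
    case 1
    then obtain c where "v = scale c w"
      using span_base[of v "{v}"] mem_span_single by blast
    then show ?thesis
      using assms by (simp add: form_simps isotropic_def)
  next
    case 2
    then obtain U where "totally_isotropic U" "l = proj_points U"
      by (auto simp: hermitian_polar_space_def)
    then show ?thesis
      using 2 assms span_in_proj_points unfolding totally_isotropic_def isotropic_def by blast
  qed
next
  assume vw: "h v w = 0"
  have p: "span {v} \<in> points \<Gamma>" "span {w} \<in> points \<Gamma>"
    using assms mem_points by blast+
  show "coll \<Gamma> (span {v}) (span {w})"
  proof (cases "w \<in> span {v}")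
    case True
    then show ?thesis
      using p span_single_eq[OF True] assms unfolding coll_def isotropic_def by blast
  next
    case False
    then have "proj_points (span {v, w}) \<in> lines \<Gamma>"
      using assms vw mem_lines by blast
    moreover have "span {v} \<in> proj_points (span {v, w})" "span {w} \<in> proj_points (span {v, w})"
      using assms by (simp_all add: span_in_proj_points isotropic_def span_base)
    ultimately show ?thesis
      using p unfolding coll_def by blast
  qed
qed

lemma line_eq:
  assumes "l \<in> lines \<Gamma>" "span {v} \<in> l" "span {w} \<in> l" "v \<noteq> 0" "w \<notin> span {v}"
  shows "l = proj_points (span {v, w})"
proof -
  obtain a b where ab: "l = proj_points (span {a, b})"
    using assms mem_lines by blast
  have "w \<noteq> 0"
    using assms(5) span_zero by metis
  then have "v \<in> span {a, b}" "w \<in> span {a, b}"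
    using assms ab span_in_proj_points by auto
  then show ?thesis
    using ab assms span_pair_eq by metis
qed

lemma geom_subspace_point:
  assumes "geom_subspace \<Gamma> X" "p \<in> X"
  shows "\<exists>v. isotropic v \<and> p = span {v}"
proof -
  have "p \<in> points \<Gamma>"
    using assms by (auto simp: geom_subspace_def)
  then show ?thesis
    by (simp add: mem_points)
qed

lemma geom_subspace_line:
  assumes X: "geom_subspace \<Gamma> X" and v: "isotropic v" "span {v} \<in> X"
    and w: "isotropic w" "span {w} \<in> X" and vw: "h v w = 0" and u: "u \<in> span {v, w}" "u \<noteq> 0"
  shows "span {u} \<in> X"
proof (cases "w \<in> span {v}")
  case True
  then have "span {v, w} = span {v}"
    using span_redundant[of w "{v}"] by (simp add: insert_commute)
  then show ?thesis
    using u v span_single_eq by metis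
next
  case False
  let ?l = "proj_points (span {v, w})"
  have l: "?l \<in> lines \<Gamma>"
    using False v w vw mem_lines by blast
  have mem: "span {x} \<in> ?l" if "x \<in> span {v, w}" "x \<noteq> 0" for x
    using that by (simp add: span_in_proj_points)
  have "span {v} \<in> ?l \<inter> X" "span {w} \<in> ?l \<inter> X" "span {v} \<noteq> span {w}"
    using v w False mem span_base[of w "{w}"] by (auto simp: isotropic_def span_base)
  then have "?l \<subseteq> X"
    using X l unfolding geom_subspace_def by blast
  then show ?thesis
    using mem u by blast
qed

text \<open>Each step \<open>c x + y\<close> of a linear combination stays on a line joining two
  points of \<open>X\<close>; orthogonality makes it a line of the polar space. The induction
  carries membership in the span along, so that this orthogonality remains available.\<close>

lemma geom_subspace_span:
  assumes X: "geom_subspace \<Gamma> X" and Y: "Y \<subseteq> X"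
    and perp: "\<And>x y. x \<in> \<Union>Y \<Longrightarrow> y \<in> \<Union>Y \<Longrightarrow> h x y = 0"
  shows "proj_points (span (\<Union>Y)) \<subseteq> X"
proof -
  have ti: "totally_isotropic (span (\<Union>Y))"
    using perp by (rule totally_isotropic_span)
  have "y \<in> span (\<Union>Y) \<and> (y = 0 \<or> span {y} \<in> X)" if "y \<in> span (\<Union>Y)" for y
    using that
  proof (induction rule: span_induct_alt)
    case (step c x y)
    show ?case
    proof (cases "x = 0 \<or> scale c x + y = 0")
      case True
      then show ?thesis
        using step by (auto simp: span_zero)
    next
      case False
      obtain p where p: "p \<in> Y" "x \<in> p"
        using step by blast
      then obtain v where "isotropic v" "p = span {v}"
        using geom_subspace_point[OF X, of p] Y by auto
      then have xX: "span {x} \<in> X"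
        using p Y span_single_eq False by auto
      have xs: "x \<in> span (\<Union>Y)"
        using step by (simp add: span_base)
      then have sum: "scale c x + y \<in> span (\<Union>Y)"
        using step by (simp add: span_add span_scale)
      have x: "isotropic x"
        using totally_isotropic_isotropic[OF ti xs] False by blast
      show ?thesis
      proof (cases "y = 0")
        case True
        then have "span {scale c x + y} = span {x}"
          using False by (intro span_single_eq) (auto simp: mem_span_single)
        then show ?thesis
          using xX sum by simp
      next
        case y0: False
        have ys: "y \<in> span (\<Union>Y)"
          using step by blast
        have "h x y = 0" "isotropic y"
          using ti xs ys y0 totally_isotropic_isotropic by (auto simp: totally_isotropic_def)
        moreover have "scale c x + y \<in> span {x, y}"
          by (simp add: span_add span_base span_scale)
        ultimately have "span {scale c x + y} \<in> X"
          using geom_subspace_line[OF X x xX] step.IH y0 False by auto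
        then show ?thesis
          using sum by simp
      qed
    qed
  qed (simp add: span_zero)
  then show ?thesis
    unfolding subset_iff proj_points_iff[OF subspace_span] by blast
qed

lemma geom_subspace_proj_points:
  assumes "totally_isotropic U"
  shows "geom_subspace \<Gamma> (proj_points U)"
  unfolding geom_subspace_def
proof (intro conjI ballI impI)
  have U: "subspace U"
    using assms by (simp add: totally_isotropic_def)
  show "proj_points U \<subseteq> points \<Gamma>"
    using totally_isotropic_isotropic[OF assms] unfolding proj_points_iff[OF U] mem_points subset_iff
    by blast
  fix l assume l: "l \<in> lines \<Gamma>" "\<exists>x\<in>l \<inter> proj_points U. \<exists>y\<in>l \<inter> proj_points U. x \<noteq> y"
  then obtain x y where "x \<in> l" "y \<in> l" "x \<in> proj_points U" "y \<in> proj_points U" "x \<noteq> y"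
    by blast
  moreover from this obtain v w where "v \<in> U" "v \<noteq> 0" "x = span {v}" "w \<in> U" "w \<noteq> 0" "y = span {w}"
    unfolding proj_points_iff[OF U] by blast
  ultimately have vw: "span {v} \<in> l" "span {w} \<in> l" "v \<in> U" "w \<in> U" "v \<noteq> 0" "w \<noteq> 0"
    "span {v} \<noteq> span {w}"
    by simp_all
  then have "w \<notin> span {v}"
    using span_single_eq by blast
  then have "l = proj_points (span {v, w})"
    using line_eq l vw by blast
  moreover have "span {v, w} \<subseteq> U"
    using vw U by (intro span_minimal) auto
  ultimately show "l \<subseteq> proj_points U"
    by (auto simp: proj_points_def)
qed

lemma singular_perp:
  assumes "singular \<Gamma> X" "x \<in> \<Union>X" "y \<in> \<Union>X"
  shows "h x y = 0"
proof (cases "x = 0 \<or> y = 0")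
  case False
  obtain p q where pq: "p \<in> X" "x \<in> p" "q \<in> X" "y \<in> q"
    using assms by blast
  have X: "geom_subspace \<Gamma> X"
    using assms(1) by (simp add: singular_def)
  obtain v w where vw: "isotropic v" "p = span {v}" "isotropic w" "q = span {w}"
    using geom_subspace_point[OF X pq(1)] geom_subspace_point[OF X pq(3)] by blast
  then have "h v w = 0"
    using assms(1) pq coll_iff unfolding singular_def by blast
  then show ?thesis
    using pq vw by (auto simp: mem_span_single form_simps)
qed auto

text \<open>Together with \<open>singular_proj_points\<close> this is a bijection between singular
  subspaces and totally isotropic linear subspaces, the empty subspace corresponding to
  \<open>{0}\<close>.\<close>

lemma singular_imp:
  assumes X: "singular \<Gamma> X"
  shows "totally_isotropic (span (\<Union>X))" "X = proj_points (span (\<Union>X))"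
proof -
  show "totally_isotropic (span (\<Union>X))"
    using singular_perp[OF X] by (rule totally_isotropic_span)
  have "proj_points (span (\<Union>X)) \<subseteq> X"
    using X singular_perp[OF X] by (intro geom_subspace_span) (auto simp: singular_def)
  moreover have "X \<subseteq> proj_points (span (\<Union>X))"
  proof
    fix p assume p: "p \<in> X"
    then obtain v where v: "isotropic v" "p = span {v}"
      using X geom_subspace_point[of X p] by (auto simp: singular_def)
    then have "v \<in> span (\<Union>X)"
      using p span_base[of v "{v}"] by (intro span_base) auto
    then show "p \<in> proj_points (span (\<Union>X))"
      using v by (simp add: span_in_proj_points isotropic_def)
  qed
  ultimately show "X = proj_points (span (\<Union>X))"
    by blast
qed

lemma singular_proj_points:
  assumes "totally_isotropic U"
  shows "singular \<Gamma> (proj_points U)"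
  unfolding singular_def
proof (intro conjI ballI)
  show "geom_subspace \<Gamma> (proj_points U)"
    by (rule geom_subspace_proj_points) fact
  fix x y assume "x \<in> proj_points U" "y \<in> proj_points U"
  moreover have "subspace U"
    using assms by (simp add: totally_isotropic_def)
  ultimately obtain v w where "v \<in> U" "v \<noteq> 0" "x = span {v}" "w \<in> U" "w \<noteq> 0" "y = span {w}"
    using proj_points_iff by metis
  then show "coll \<Gamma> x y"
    using coll_iff totally_isotropic_isotropic assms unfolding totally_isotropic_def by blast
qed

lemma generated_eq:
  assumes "Y \<subseteq> points \<Gamma>" "\<And>x y. x \<in> \<Union>Y \<Longrightarrow> y \<in> \<Union>Y \<Longrightarrow> h x y = 0"
  shows "generated \<Gamma> Y = proj_points (span (\<Union>Y))"
proof
  have ti: "totally_isotropic (span (\<Union>Y))"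
    using assms(2) by (rule totally_isotropic_span)
  have "Y \<subseteq> proj_points (span (\<Union>Y))"
  proof
    fix p assume p: "p \<in> Y"
    then obtain v where v: "isotropic v" "p = span {v}"
      using assms(1) mem_points by blast
    then have "v \<in> span (\<Union>Y)"
      using p span_base[of v "{v}"] by (intro span_base) auto
    then show "p \<in> proj_points (span (\<Union>Y))"
      using v by (simp add: span_in_proj_points isotropic_def)
  qed
  then show "generated \<Gamma> Y \<subseteq> proj_points (span (\<Union>Y))"
    using geom_subspace_proj_points[OF ti] unfolding generated_def by blast
  show "proj_points (span (\<Union>Y)) \<subseteq> generated \<Gamma> Y"
    using geom_subspace_span[OF _ _ assms(2)] unfolding generated_def by blast
qed

text \<open>Stated for an abstract \<open>G\<close> so that it serves both the polar space and the
  geometry of fixed points: \<open>closed\<close> recovers a subspace from its linear span, and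
  \<open>trace\<close> turns linear subspaces into subspaces of \<open>G\<close>. Each strict
  inclusion in a chain then contributes one new independent vector, and the initial segments of a
  basis give a chain.\<close>

lemma has_chain_iff:
  assumes closed: "\<And>C. geom_subspace G C \<Longrightarrow> C \<subseteq> X \<Longrightarrow> {x \<in> X. x \<subseteq> span (\<Union>C)} \<subseteq> C"
    and trace: "\<And>U. subspace U \<Longrightarrow> geom_subspace G {x \<in> X. x \<subseteq> U}"
    and pts: "\<And>x. x \<in> X \<Longrightarrow> \<exists>v. v \<noteq> 0 \<and> x = span {v}"
  shows "has_chain G X d \<longleftrightarrow>
    (\<exists>B. finite B \<and> independent B \<and> B \<subseteq> span (\<Union>X) \<and> card B = Suc d)"
proof
  assume "has_chain G X d"
  then obtain C where C: "\<And>i. i \<le> d \<Longrightarrow> geom_subspace G (C i) \<and> C i \<noteq> {} \<and> C i \<subseteq> X"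
    "\<And>i. i < d \<Longrightarrow> C i \<subset> C (Suc i)"
    unfolding has_chain_def by blast
  have "\<exists>B. finite B \<and> independent B \<and> B \<subseteq> span (\<Union>(C i)) \<and> card B = Suc i" if "i \<le> d" for i
    using that
  proof (induction i)
    case 0
    obtain x where x: "x \<in> C 0" "x \<in> X"
      using C(1)[of 0] by blast
    then obtain v where "v \<noteq> 0" "x = span {v}"
      using pts by blast
    then have "independent {v}" "v \<in> span (\<Union>(C 0))"
      using x span_base[of v "{v}"] by (auto simp: independent_insertI independent_empty intro!: span_base)
    then show ?case
      by (intro exI[of _ "{v}"]) simp
  next
    case (Suc i)
    then obtain B where B: "finite B" "independent B" "B \<subseteq> span (\<Union>(C i))" "card B = Suc i"
      by auto
    obtain x where x: "x \<in> C (Suc i)" "x \<notin> C i" "x \<in> X"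
      using C(1)[of "Suc i"] C(2)[of i] Suc.prems by auto
    obtain v where v: "v \<noteq> 0" "x = span {v}"
      using pts x by blast
    have "\<not> x \<subseteq> span (\<Union>(C i))"
      using closed[of "C i"] C(1)[of i] x Suc.prems by auto
    then have "v \<notin> span (\<Union>(C i))"
      using v span_singleton_subset_iff by blast
    moreover have "span B \<subseteq> span (\<Union>(C i))"
      using B by (simp add: span_minimal)
    ultimately have vB: "v \<notin> span B"
      by blast
    have "v \<in> span (\<Union>(C (Suc i)))"
      using x v span_base[of v "{v}"] by (auto intro!: span_base)
    moreover have "span (\<Union>(C i)) \<subseteq> span (\<Union>(C (Suc i)))"
      using C(2)[of i] Suc.prems by (intro span_mono) auto
    ultimately show ?case
      using B vB span_base[of v B]
      by (intro exI[of _ "insert v B"]) (auto simp: independent_insertI card_insert_if)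
  qed
  from this[of d] obtain B
    where B: "finite B \<and> independent B \<and> B \<subseteq> span (\<Union>(C d)) \<and> card B = Suc d"
    by blast
  moreover have "span (\<Union>(C d)) \<subseteq> span (\<Union>X)"
    using C(1)[of d] by (intro span_mono) auto
  ultimately show "\<exists>B. finite B \<and> independent B \<and> B \<subseteq> span (\<Union>X) \<and> card B = Suc d"
    by blast
next
  assume "\<exists>B. finite B \<and> independent B \<and> B \<subseteq> span (\<Union>X) \<and> card B = Suc d"
  then obtain B where B: "finite B" "independent B" "B \<subseteq> span (\<Union>X)" "card B = Suc d"
    by blast
  \<comment> \<open>\<open>B\<close> lies only in the span of \<open>\<Union>X\<close>, while the
    chain needs vectors that span points of \<open>X\<close>; hence a basis is picked inside
    \<open>\<Union>X\<close>.\<close>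
  obtain B0 where B0: "B0 \<subseteq> \<Union>X" "independent B0" "\<Union>X \<subseteq> span B0"
    using maximal_independent_subset[of "\<Union>X"] by blast
  have "span (\<Union>X) \<subseteq> span B0"
    using B0 by (simp add: span_minimal)
  then have "finite B0 \<Longrightarrow> Suc d \<le> card B0"
    using independent_span_bound[of B0 B] B by auto
  then obtain B1 where B1: "B1 \<subseteq> B0" "finite B1" "card B1 = Suc d"
    using obtain_subset_with_card_n[of "Suc d" B0] infinite_arbitrarily_large[of B0 "Suc d"]
    by metis
  obtain f where f: "bij_betw f {0..<Suc d} B1"
    using ex_bij_betw_nat_finite[OF B1(2)] B1(3) by auto
  define C where "C i = {x \<in> X. x \<subseteq> span (f ` {..i})}" for i
  have f_mem: "f i \<in> B1" if "i \<le> d" for i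
    using f that by (auto simp: bij_betw_def)
  have pt: "span {f i} \<in> X" if i: "i \<le> d" for i
  proof -
    have "f i \<in> B0"
      using f_mem[OF i] B1 by blast
    then have "f i \<in> \<Union>X" "f i \<noteq> 0"
      using B0 independent_nonzero by blast+
    then show ?thesis
      using pts span_single_eq by fastforce
  qed
  have in_C: "span {f i} \<in> C j" if "i \<le> j" "i \<le> d" for i j
    using that pt by (auto simp: C_def span_singleton_subset_iff[OF subspace_span] intro!: span_base)
  have "C i \<subset> C (Suc i)" if i: "i < d" for i
  proof
    have "span (f ` {..i}) \<subseteq> span (f ` {..Suc i})"
      by (intro span_mono) auto
    then show "C i \<subseteq> C (Suc i)"
      by (auto simp: C_def)
    have "f (Suc i) \<notin> span (f ` {..i})"
    proof
      assume *: "f (Suc i) \<in> span (f ` {..i})"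
      have "f ` {..i} \<subseteq> B1 - {f (Suc i)}"
        using f i inj_onD[of f "{0..<Suc d}" _ "Suc i"] by (fastforce simp: bij_betw_def)
      then have "f (Suc i) \<in> span (B1 - {f (Suc i)})"
        using * span_mono by blast
      moreover have "independent B1"
        using B1 B0 independent_mono by blast
      ultimately show False
        using f_mem[of "Suc i"] i by (auto simp: dependent_def)
    qed
    then have "span {f (Suc i)} \<notin> C i"
      by (auto simp: C_def span_singleton_subset_iff[OF subspace_span])
    then show "C i \<noteq> C (Suc i)"
      using in_C[of "Suc i" "Suc i"] i by auto
  qed
  moreover have "geom_subspace G (C i) \<and> C i \<noteq> {} \<and> C i \<subseteq> X" if "i \<le> d" for i
    using trace[OF subspace_span] in_C[of i i] that unfolding C_def by auto
  ultimately show "has_chain G X d"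
    unfolding has_chain_def by blast
qed

lemma has_pdim_iff:
  assumes "\<And>C. geom_subspace G C \<Longrightarrow> C \<subseteq> X \<Longrightarrow> {x \<in> X. x \<subseteq> span (\<Union>C)} \<subseteq> C"
    and "\<And>U. subspace U \<Longrightarrow> geom_subspace G {x \<in> X. x \<subseteq> U}"
    and "\<And>x. x \<in> X \<Longrightarrow> \<exists>v. v \<noteq> 0 \<and> x = span {v}"
  shows "has_pdim G X d \<longleftrightarrow> fdim (span (\<Union>X)) (Suc d)"
proof -
  note chain = has_chain_iff[of G X, OF assms]
  show ?thesis
  proof
    assume dim: "has_pdim G X d"
    then have "has_chain G X d"
      by (simp add: has_pdim_def)
    then obtain B where B: "finite B" "independent B" "B \<subseteq> span (\<Union>X)" "card B = Suc d"
      using chain by auto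
    have "span (\<Union>X) \<subseteq> span B"
    proof (rule ccontr)
      assume "\<not> span (\<Union>X) \<subseteq> span B"
      then obtain v where v: "v \<in> span (\<Union>X)" "v \<notin> span B"
        by blast
      then have "finite (insert v B) \<and> independent (insert v B) \<and> insert v B \<subseteq> span (\<Union>X) \<and>
          card (insert v B) = Suc (Suc d)"
        using B span_base[of v B] by (auto simp: independent_insertI card_insert_if)
      then have "has_chain G X (Suc d)"
        using chain by blast
      then show False
        using dim by (simp add: has_pdim_def)
    qed
    then have "span B = span (\<Union>X)"
      using B span_minimal[of B] by auto
    then show "fdim (span (\<Union>X)) (Suc d)"
      using B unfolding fdim_def by blast
  next
    assume dim: "fdim (span (\<Union>X)) (Suc d)"
    then obtain B where "finite B" "independent B" "span B = span (\<Union>X)" "card B = Suc d"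
      unfolding fdim_def by blast
    moreover from this have "B \<subseteq> span (\<Union>X)"
      by (metis span_superset)
    ultimately have "has_chain G X d"
      using chain[of d] by blast
    moreover have "\<not> has_chain G X (Suc d)"
    proof
      assume "has_chain G X (Suc d)"
      then obtain B where "independent B" "B \<subseteq> span (\<Union>X)" "card B = Suc (Suc d)"
        using chain[of "Suc d"] by blast
      then show False
        using fdim_bound[OF dim, of B] by simp
    qed
    ultimately show "has_pdim G X d"
      by (simp add: has_pdim_def)
  qed
qed

lemma has_pdim_proj_points:
  assumes U: "totally_isotropic U"
  shows "has_pdim \<Gamma> (proj_points U) d \<longleftrightarrow> fdim U (Suc d)"
proof -
  have sub: "subspace U"
    using U by (simp add: totally_isotropic_def)
  have "has_pdim \<Gamma> (proj_points U) d \<longleftrightarrow> fdim (span (\<Union>(proj_points U))) (Suc d)"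
  proof (rule has_pdim_iff)
    fix C assume C: "geom_subspace \<Gamma> C" "C \<subseteq> proj_points U"
    have "h x y = 0" if "x \<in> \<Union>C" "y \<in> \<Union>C" for x y
      using that C(2) U unfolding totally_isotropic_def proj_points_def by blast
    then have "proj_points (span (\<Union>C)) \<subseteq> C"
      using geom_subspace_span[OF C(1), of C] by blast
    then show "{x \<in> proj_points U. x \<subseteq> span (\<Union>C)} \<subseteq> C"
      by (auto simp: proj_points_def)
  next
    fix W :: "'v set" assume W: "subspace W"
    have "{x \<in> proj_points U. x \<subseteq> W} = proj_points (U \<inter> W)"
      by (auto simp: proj_points_def)
    moreover have "totally_isotropic (U \<inter> W)"
      using U W by (auto simp: totally_isotropic_def subspace_inter)
    ultimately show "geom_subspace \<Gamma> {x \<in> proj_points U. x \<subseteq> W}"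
      using geom_subspace_proj_points by simp
  next
    fix x assume "x \<in> proj_points U"
    then show "\<exists>v. v \<noteq> 0 \<and> x = span {v}"
      using proj_points_iff[OF sub] by blast
  qed
  then show ?thesis
    by (simp add: span_Union_proj_points sub)
qed

text \<open>\<open>has_rank\<close> speaks of maximal singular subspaces only, so each singular
  subspace has to be placed in one. Zorn's lemma applies because any two points of the union of a
  chain already lie in one member.\<close>

lemma singular_extend:
  assumes "singular \<Gamma> X"
  obtains M where "max_singular \<Gamma> M" "X \<subseteq> M"
proof -
  let ?A = "{Y. singular \<Gamma> Y \<and> X \<subseteq> Y}"
  have "\<exists>M\<in>?A. \<forall>Y\<in>?A. M \<subseteq> Y \<longrightarrow> Y = M"
  proof (rule subset_Zorn)
    fix C assume C: "subset.chain ?A C"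
    show "\<exists>U\<in>?A. \<forall>Y\<in>C. Y \<subseteq> U"
    proof (cases "C = {}")
      case True
      then show ?thesis
        using assms by blast
    next
      case False
      have both: "\<exists>Y\<in>C. x \<in> Y \<and> y \<in> Y" if "x \<in> \<Union>C" "y \<in> \<Union>C" for x y
        using that C unfolding subset.chain_def by blast
      have sing: "singular \<Gamma> Y" if "Y \<in> C" for Y
        using that C unfolding subset.chain_def by blast
      have "singular \<Gamma> (\<Union>C)"
        unfolding singular_def geom_subspace_def
      proof (intro conjI ballI impI)
        show "\<Union>C \<subseteq> points \<Gamma>"
          using sing unfolding singular_def geom_subspace_def by blast
        show "coll \<Gamma> x y" if "x \<in> \<Union>C" "y \<in> \<Union>C" for x y
          using both[OF that] sing unfolding singular_def by blast
        fix l assume l: "l \<in> lines \<Gamma>" "\<exists>x\<in>l \<inter> \<Union>C. \<exists>y\<in>l \<inter> \<Union>C. x \<noteq> y"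
        then obtain x y where xy: "x \<in> l" "y \<in> l" "x \<in> \<Union>C" "y \<in> \<Union>C" "x \<noteq> y"
          by blast
        then obtain Y where "Y \<in> C" "x \<in> Y" "y \<in> Y"
          using both by blast
        then show "l \<subseteq> \<Union>C"
          using l xy sing unfolding singular_def geom_subspace_def by blast
      qed
      moreover have "X \<subseteq> \<Union>C"
        using False C unfolding subset.chain_def by blast
      ultimately show ?thesis
        by blast
    qed
  qed
  then obtain M where M: "M \<in> ?A" "\<forall>Y\<in>?A. M \<subseteq> Y \<longrightarrow> Y = M"
    by (rule bexE)
  then have "max_singular \<Gamma> M"
    by (auto simp: max_singular_def)
  then show thesis
    using that M by blast
qed

context
  fixes n
  assumes rank: "has_rank \<Gamma> n"
begin

lemma max_singular_fdim:
  assumes "max_singular \<Gamma> M"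
  obtains U where "totally_isotropic U" "M = proj_points U" "fdim U n"
proof -
  have M: "totally_isotropic (span (\<Union>M))" "M = proj_points (span (\<Union>M))"
    using assms singular_imp unfolding max_singular_def by blast+
  have "has_pdim \<Gamma> M (n - 1)" "1 \<le> n"
    using rank assms unfolding has_rank_def by blast+
  then have "fdim (span (\<Union>M)) n"
    using has_pdim_proj_points[OF M(1), of "n - 1"] M(2) by simp
  then show thesis
    using that M by blast
qed

lemma proj_points_mono_iff:
  assumes "subspace U" "subspace W"
  shows "proj_points U \<subseteq> proj_points W \<longleftrightarrow> U \<subseteq> W"
proof
  assume "proj_points U \<subseteq> proj_points W"
  then have "span (\<Union>(proj_points U)) \<subseteq> span (\<Union>(proj_points W))"
    by (intro span_mono Union_mono)
  then show "U \<subseteq> W"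
    by (simp add: span_Union_proj_points assms)
qed (auto simp: proj_points_def)

lemma totally_isotropic_extend:
  assumes "totally_isotropic U"
  obtains W where "totally_isotropic W" "U \<subseteq> W" "fdim W n"
proof -
  obtain M where M: "max_singular \<Gamma> M" "proj_points U \<subseteq> M"
    using singular_extend singular_proj_points[OF assms] by blast
  obtain W where W: "totally_isotropic W" "M = proj_points W" "fdim W n"
    using max_singular_fdim[OF M(1)] by blast
  then show thesis
    using that M(2) assms proj_points_mono_iff unfolding totally_isotropic_def by blast
qed

lemma totally_isotropic_fdim:
  assumes "totally_isotropic U"
  obtains k where "fdim U k" "k \<le> n"
proof -
  obtain W where W: "totally_isotropic W" "U \<subseteq> W" "fdim W n"
    using totally_isotropic_extend assms by blast
  show thesis
    using fdim_subset[OF W(3) _ W(2)] assms that unfolding totally_isotropic_def by blast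
qed

end

end

section \<open>Point-domestic maps on isotropic vectors\<close>

text \<open>\<open>r\<close> picks an arbitrary representative of each image point, so it is not
  assumed linear and is meaningful only up to scalars. In \<open>rank_three\<close> the vector
  \<open>w\<close> may lie in \<open>span {v}\<close>; the assumption then says that each point lies
  on a line.\<close>

locale domestic_map = hermitian_form scale \<sigma> h
  for scale :: "'k::field \<Rightarrow> 'v::ab_group_add \<Rightarrow> 'v" and \<sigma> h +
  fixes r :: "'v \<Rightarrow> 'v"
  assumes r_isotropic: "isotropic v \<Longrightarrow> isotropic (r v)"
    and r_perp: "\<lbrakk>isotropic v; isotropic w\<rbrakk> \<Longrightarrow> h (r v) (r w) = 0 \<longleftrightarrow> h v w = 0"
    and r_span: "\<lbrakk>isotropic v; isotropic w\<rbrakk> \<Longrightarrow> r w \<in> span {r v} \<longleftrightarrow> w \<in> span {v}"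
    and r_line: "\<lbrakk>isotropic v; isotropic w; isotropic u; h v w = 0; u \<in> span {v, w}\<rbrakk>
      \<Longrightarrow> r u \<in> span {r v, r w}"
    and r_domestic: "isotropic v \<Longrightarrow> h v (r v) = 0"
    and rank_three: "\<lbrakk>isotropic v; isotropic w; h v w = 0\<rbrakk>
      \<Longrightarrow> \<exists>m. isotropic m \<and> m \<in> perp {v, w} \<and> m \<notin> span {v, w}"
begin

section \<open>Consequences of domesticity on single lines\<close>

definition fixed :: "'v \<Rightarrow> bool" where
  "fixed v \<longleftrightarrow> r v \<in> span {v}"

lemma isotropic_nonzero: "isotropic v \<Longrightarrow> v \<noteq> 0"
  and isotropic_form: "isotropic v \<Longrightarrow> h v v = 0"
  by (auto simp: isotropic_def)

lemma span_single_trans: "x \<in> span {y} \<Longrightarrow> y \<in> span {z} \<Longrightarrow> x \<in> span {z}"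
  by (metis empty_subsetI insert_subset span_minimal subsetD subspace_span)

text \<open>Expanding domesticity of \<open>x + p\<close> leaves only the term containing
  \<open>h p (r x)\<close>. Were this product nonzero, \<open>r (x + p)\<close> would be a multiple
  of \<open>r p\<close>, against injectivity on points.\<close>

lemma r_sym:
  assumes "isotropic x" "isotropic p" "h x p = 0" "h x (r p) = 0"
  shows "h p (r x) = 0"
proof (rule ccontr)
  assume *: "h p (r x) \<noteq> 0"
  have x: "x \<notin> span {p}"
  proof
    assume "x \<in> span {p}"
    then have "r x \<in> span {r p}"
      using r_span assms by blast
    then show False
      using * r_domestic[OF assms(2)] by (auto simp: mem_span_single form_simps)
  qed
  have "x + p \<noteq> 0"
  proof
    assume "x + p = 0"
    then have "x = scale (- 1) p"
      by (simp add: eq_neg_iff_add_eq_0)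
    then show False
      using x unfolding mem_span_single by blast
  qed
  then have z: "isotropic (x + p)"
    using assms form_eq_0_sym[of x p] by (simp add: isotropic_def form_simps)
  have "x + p \<in> span {x, p}"
    by (simp add: span_add span_base)
  then obtain a b where ab: "r (x + p) = scale a (r x) + scale b (r p)"
    using r_line[OF assms(1,2) z assms(3)] by (auto simp: mem_span_pair)
  have "h (x + p) (r (x + p)) = 0"
    using r_domestic z by blast
  then have "a = 0"
    using * assms r_domestic[OF assms(1)] r_domestic[OF assms(2)] by (simp add: ab form_simps)
  then have "r (x + p) \<in> span {r p}"
    using ab by (auto simp: mem_span_single)
  then have "x + p \<in> span {p}"
    using r_span z assms by blast
  then have "x + p - p \<in> span {p}"
    by (rule span_diff) (simp add: span_base)
  then show False
    using x by simp
qed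

lemma isotropic_on_line:
  assumes "isotropic x" "isotropic p" "h x p = 0" "h x (r p) \<noteq> 0"
  shows "isotropic (x + scale t p)"
proof -
  have "h (x + scale t p) (r p) \<noteq> 0"
    using assms r_domestic by (simp add: form_simps)
  then have "x + scale t p \<noteq> 0"
    by (metis form_0_left)
  then show ?thesis
    using assms form_eq_0_sym[of x p] by (simp add: isotropic_def form_simps)
qed

text \<open>The main source of nonfixed points: for a fixed \<open>s\<close>, orthogonality to
  \<open>z\<close> gives \<open>h z (r s) = 0\<close>, which \<open>r_sym\<close> turns into
  \<open>h s (r z) = 0\<close>.\<close>

lemma nonfixedI:
  assumes "isotropic s" "isotropic z" "h s z = 0" "h s (r z) \<noteq> 0"
  shows "\<not> fixed s"
proof
  assume "fixed s"
  then obtain c where "r s = scale c s"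
    by (auto simp: fixed_def mem_span_single)
  then have "h z (r s) = 0"
    using assms form_eq_0_sym[of s z] by (simp add: form_simps)
  then show False
    using r_sym[of z s] assms form_eq_0_sym[of s z] by blast
qed

text \<open>On a line opposite its image, \<open>\<theta>\<close> is the projection onto the image line, hence
  semilinear with companion \<open>\<sigma>\<close>.\<close>

lemma opposite_line:
  assumes v: "isotropic v" and w: "isotropic w" and vw: "h v w = 0"
    and v': "v' \<in> span {r v}" "v' \<noteq> 0" and w': "w' \<in> span {r w}" "h v w' \<noteq> 0"
  shows "r (v + scale t w) \<in> span {v' + scale (- \<sigma> (t * h w v' / h v w')) w'}"
proof -
  have w'0: "w' \<noteq> 0"
    using w' by auto
  have vw': "h v (r w) \<noteq> 0"
    using w' by (auto simp: mem_span_single form_simps)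
  let ?z = "v + scale t w"
  have z: "isotropic ?z"
    using isotropic_on_line v w vw vw' by blast
  have "?z \<in> span {v, w}"
    by (simp add: span_add span_base span_scale)
  then have "r ?z \<in> span {r v, r w}"
    using r_line v w z vw by blast
  moreover have "r v \<in> span {v'}" "r w \<in> span {w'}"
    using span_single_sym v' w' w'0 by blast+
  then have "r v \<in> span {v', w'}" "r w \<in> span {v', w'}"
    using span_mono[of "{v'}" "{v', w'}"] span_mono[of "{w'}" "{v', w'}"] by auto
  then have "span {r v, r w} \<subseteq> span {v', w'}"
    by (intro span_minimal) auto
  ultimately obtain a b where ab: "r ?z = scale a v' + scale b w'"
    using mem_span_pair by blast
  \<comment> \<open>Domesticity of \<open>?z\<close> reduces to its two mixed terms, and these fix
    the ratio of \<open>b\<close> to \<open>a\<close>. The conjugation enters because both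
    coefficients sit in the second argument of \<open>h\<close>.\<close>
  have "h v v' = 0" "h w w' = 0"
    using v' w' r_domestic[OF v] r_domestic[OF w] by (auto simp: mem_span_single form_simps)
  then have "\<sigma> b * h v w' + t * (\<sigma> a * h w v') = 0"
    using r_domestic[OF z] by (simp add: ab form_simps ac_simps)
  then have "\<sigma> b = - t * (\<sigma> a * h w v') / h v w'"
    using w' by (simp add: field_simps add_eq_0_iff)
  then have "b = \<sigma> (- t * (\<sigma> a * h w v') / h v w')"
    by (metis sigma_invol)
  then have "b = a * - \<sigma> (t * h w v' / h v w')"
    by (simp add: sigma_simps)
  then have "r ?z = scale a (v' + scale (- \<sigma> (t * h w v' / h v w')) w')"
    by (simp add: ab scale_right_distrib scale_right_diff_distrib)
  then show ?thesis
    unfolding mem_span_single by blast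
qed

text \<open>By two uses of \<open>r_sym\<close>, an isotropic vector orthogonal to \<open>p\<close>
  and \<open>r p\<close> is orthogonal to \<open>r (r p)\<close>. By
  \<open>isotropic_detect\<close>, such vectors would reveal \<open>r (r p)\<close> if it were
  outside the span.\<close>

lemma r_r_span:
  assumes p: "isotropic p"
  shows "r (r p) \<in> span {p, r p}"
proof (rule ccontr)
  assume notin: "r (r p) \<notin> span {p, r p}"
  have *: "h x (r (r p)) = 0" if x: "isotropic x" "h x p = 0" "h x (r p) = 0" for x
  proof -
    have "h p (r x) = 0"
      using r_sym x p by blast
    have "h (r p) (r x) = 0"
      using r_perp p x form_eq_0_sym by blast
    then show ?thesis
      using r_sym[of "r p" x] r_isotropic p x form_eq_0_sym by blast
  qed
  have iso: "isotropic (r (r p))"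
    using r_isotropic p by blast
  have "h p (r (r p)) = 0"
    using * p r_domestic isotropic_form by blast
  then have "r (r p) \<in> perp {p, r p}"
    using r_domestic[OF r_isotropic[OF p]] form_eq_0_sym by (simp add: perp_def)
  then obtain s where "isotropic s" "s \<in> perp {p, r p}" "h s (r (r p)) \<noteq> 0"
    using isotropic_detect[of "{p, r p}" "r (r p)" "r (r p)"] notin iso isotropic_form by auto
  then show False
    using * by (simp add: perp_def)
qed

lemma r_involution:
  assumes p: "isotropic p"
  shows "r (r p) \<in> span {p}"
proof (cases "fixed p")
  case True
  then show ?thesis
    using r_span[OF p r_isotropic[OF p]] span_single_trans unfolding fixed_def by blast
next
  case False
  then have rp: "r p \<notin> span {p}"
    by (simp add: fixed_def)
  note iso_rp = r_isotropic[OF p]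
  have "r p \<in> perp {p}"
    using r_domestic[OF p] form_eq_0_sym by (simp add: perp_def)
  then obtain x where x: "isotropic x" "h x p = 0" "h x (r p) \<noteq> 0"
    using isotropic_detect[of "{p}" "r p" "r p"] rp iso_rp isotropic_form
    by (auto simp: perp_def)
  have px: "h p x = 0" "h p (r x) \<noteq> 0"
    using r_sym[of p x] x p form_eq_0_sym by blast+
  have sym: "h (r p) x \<noteq> 0" "h (r x) p \<noteq> 0"
    using x px form_eq_0_sym by blast+
  have zeros: "h p p = 0" "h x x = 0" "h (r p) (r p) = 0" "h (r x) (r x) = 0"
    "h p (r p) = 0" "h x (r x) = 0" "h (r p) p = 0" "h (r x) x = 0"
    "h (r p) (r x) = 0" "h (r x) (r p) = 0"
    using isotropic_form[OF p] isotropic_form[OF x(1)]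
      isotropic_form[OF iso_rp] isotropic_form[OF r_isotropic[OF x(1)]]
      r_domestic[OF p] r_domestic[OF x(1)] r_perp[OF p x(1)] px(1) form_eq_0_sym by blast+
  \<comment> \<open>Among these four vectors only \<open>x\<close> with \<open>r p\<close>, and
    \<open>p\<close> with \<open>r x\<close>, have nonzero products, so the vectors are independent
    and coefficients may be compared.\<close>
  have indep: "a = 0 \<and> b = 0 \<and> c = 0 \<and> d = 0"
    if eq: "scale a x + scale b (r x) + (scale c p + scale d (r p)) = 0" for a b c d
  proof -
    have "h (scale a x + scale b (r x) + (scale c p + scale d (r p))) y = 0" for y
      using eq by simp
    from this[of "r p"] this[of p] this[of "r x"] this[of x] show ?thesis
      using x px sym zeros by (simp add: form_simps)
  qed
  obtain a b where ab: "r (r p) = scale a p + scale b (r p)"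
    using r_r_span[OF p] by (auto simp: mem_span_pair)
  obtain c d where cd: "r (r x) = scale c x + scale d (r x)"
    using r_r_span[OF x(1)] by (auto simp: mem_span_pair)
  have a0: "a \<noteq> 0"
  proof
    assume "a = 0"
    then have "r (r p) \<in> span {r p}"
      using ab by (auto simp: mem_span_single)
    then show False
      using r_span[OF p iso_rp] rp by blast
  qed
  \<comment> \<open>With this factor \<open>r (x + t p)\<close> is spanned by
    \<open>r x + k \<sigma>(t) r p\<close>.\<close>
  define k where "k = - \<sigma> (h p (r x) / h x (r p))"
  have k0: "k \<noteq> 0"
    using x px by (simp add: k_def)
  have "b = 0"
  proof (rule ccontr)
    assume b0: "b \<noteq> 0"
    \<comment> \<open>\<open>r (r ?z)\<close> is expressed once through \<open>?z\<close> and
      \<open>r ?z\<close>, once through \<open>r (r x)\<close> and \<open>r (r p)\<close>.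
      Eliminating the coefficients leaves \<open>t\<close> on one side and \<open>\<sigma> t\<close>
      on the other; testing with \<open>t = 1\<close> and with a \<open>t\<close> moved by
      \<open>\<sigma>\<close> then refutes \<open>b \<noteq> 0\<close>.\<close>
    have key: "c * b * t = a * d * k * \<sigma> t" if t0: "t \<noteq> 0" for t
    proof -
      let ?z = "x + scale t p" and ?z' = "r x + scale (k * \<sigma> t) (r p)"
      have z: "isotropic ?z"
        using isotropic_on_line x p by blast
      have "r ?z \<in> span {r x + scale (- \<sigma> (t * h p (r x) / h x (r p))) (r p)}"
        using x p r_isotropic isotropic_nonzero
        by (intro opposite_line) (auto simp: span_base)
      moreover have "- \<sigma> (t * h p (r x) / h x (r p)) = k * \<sigma> t"
        by (simp add: k_def sigma_simps)
      ultimately obtain u where u: "r ?z = scale u ?z'"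
        by (auto simp: mem_span_single)
      obtain g f where gf: "r (r ?z) = scale g ?z + scale f ?z'"
        using r_r_span[OF z] u by (auto simp: mem_span_pair)
      have "r ?z \<in> span {r x, r p}"
        by (simp add: u span_add span_base span_scale)
      then have "r (r ?z) \<in> span {r (r x), r (r p)}"
        using r_line r_isotropic x(1) p z zeros(10) by (metis zeros(9) form_eq_0_sym)
      then obtain m l where ml: "r (r ?z) = scale m (r (r x)) + scale l (r (r p))"
        by (auto simp: mem_span_pair)
      have "scale (m * c - g) x + scale (m * d - f) (r x) +
          (scale (l * a - g * t) p + scale (l * b - f * k * \<sigma> t) (r p)) = r (r ?z) - r (r ?z)"
        by (subst (2) gf, subst ml) (simp add: ab cd algebra_simps)
      then have eqs: "m * c = g" "m * d = f" "l * a = g * t" "l * b = f * k * \<sigma> t"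
        using indep[of "m * c - g" "m * d - f" "l * a - g * t" "l * b - f * k * \<sigma> t"] by simp_all
      have "m \<noteq> 0"
      proof
        assume "m = 0"
        then have "r (r ?z) = 0"
          using gf eqs by auto
        then show False
          using r_isotropic[OF r_isotropic[OF z]] isotropic_nonzero by blast
      qed
      have "m * (c * b * t) = l * a * b"
        using eqs(3) by (simp flip: eqs(1))
      also have "\<dots> = a * (f * k * \<sigma> t)"
        using eqs(4) by (simp add: mult_ac)
      also have "\<dots> = m * (a * d * k * \<sigma> t)"
        by (simp flip: eqs(2))
      finally show ?thesis
        using \<open>m \<noteq> 0\<close> by simp
    qed
    obtain t where t: "\<sigma> t \<noteq> t"
      using sigma_nontrivial by blast
    then have "t \<noteq> 0"
      by auto
    have eq1: "c * b = a * d * k"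
      using key[of 1] by simp
    then have "c * b * t = c * b * \<sigma> t"
      using key[OF \<open>t \<noteq> 0\<close>] by simp
    then have "c = 0"
      using t b0 by auto
    then have "d = 0"
      using eq1 a0 k0 by simp
    then have "r (r x) = 0"
      using \<open>c = 0\<close> cd by simp
    then show False
      using r_isotropic[OF r_isotropic[OF x(1)]] isotropic_nonzero by blast
  qed
  then show ?thesis
    using ab by (auto simp: mem_span_single)
qed

lemma fixed_span:
  assumes "isotropic v" "isotropic w" "w \<in> span {v}" "fixed v"
  shows "fixed w"
proof -
  have "r w \<in> span {r v}"
    using assms r_span by blast
  then show ?thesis
    using assms span_single_sym[OF assms(3)] isotropic_nonzero span_single_trans
    unfolding fixed_def by blast
qed

lemma fixed_span_iff:
  assumes "isotropic v" "isotropic w" "w \<in> span {v}"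
  shows "fixed w \<longleftrightarrow> fixed v"
  using fixed_span[OF assms] fixed_span[OF assms(2,1)] span_single_sym[OF assms(3)]
    isotropic_nonzero[OF assms(2)] by blast

lemma fixed_r:
  assumes "isotropic v"
  shows "fixed (r v) \<longleftrightarrow> fixed v"
  using assms r_span r_isotropic unfolding fixed_def by blast

section \<open>General position inside \<open>perp {v}\<close> and
  \<open>perp {v, c}\<close>\<close>

lemma hyperbolic_plane_perp:
  assumes v: "isotropic v" and c: "isotropic c" and vc: "h v c \<noteq> 0"
  obtains a where "isotropic a" "a \<in> perp {v, c}" "a \<notin> span {v, c}"
proof -
  obtain m where m: "isotropic m" "h m v = 0" "m \<notin> span {v}"
    using rank_three[OF v v] v isotropic_form by (auto simp: perp_def)
  let ?a = "m - scale (h m c / h v c) v"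
  have "?a \<noteq> 0"
    using m by (auto simp: mem_span_single)
  then have a: "isotropic ?a"
    using m v isotropic_form form_eq_0_sym[of m v] by (simp add: isotropic_def form_simps)
  have perp: "?a \<in> perp {v, c}"
    using m v vc isotropic_form by (simp add: perp_def form_simps)
  have "?a \<notin> span {v, c}"
  proof
    assume "?a \<in> span {v, c}"
    then obtain x y where xy: "?a = scale x v + scale y c"
      by (auto simp: mem_span_pair)
    have "h ?a v = 0" "h ?a c = 0" "h c v \<noteq> 0"
      using perp vc form_eq_0_sym[of v c] by (auto simp: perp_def)
    then have "x = 0" "y = 0"
      using vc v c isotropic_form unfolding xy by (auto simp: form_simps)
    then show False
      using xy \<open>?a \<noteq> 0\<close> by simp
  qed
  then show thesis
    using that a perp by blast
qed

text \<open>Verifies the assumption of \<open>avoid_three\<close> for \<open>perp {v, c}\<close>.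
  Rank 3 enters through \<open>m\<close>, orthogonal to \<open>v\<close> and \<open>p\<close> but
  off their span: stripped of its products with both hyperbolic pairs it becomes \<open>a\<close>,
  and a vector not orthogonal to \<open>a\<close>, projected in the same way and made isotropic, is
  its partner.\<close>

lemma hyperbolic_pair_perp:
  assumes v: "isotropic v" and c: "isotropic c" and vc: "h v c \<noteq> 0"
    and p: "isotropic p" "p \<in> perp {v, c}" and q: "isotropic q" "q \<in> perp {v, c}"
    and pq: "h p q \<noteq> 0"
  shows "\<exists>a b. isotropic a \<and> isotropic b \<and> a \<in> perp {v, c} \<and> b \<in> perp {v, c} \<and>
    a \<in> perp {p, q} \<and> b \<in> perp {p, q} \<and> h a b \<noteq> 0"
proof -
  have zeros: "h v v = 0" "h c c = 0" "h p p = 0" "h q q = 0" "h p v = 0" "h v p = 0"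
    "h p c = 0" "h c p = 0" "h q v = 0" "h v q = 0" "h q c = 0" "h c q = 0"
    and nz: "h c v \<noteq> 0" "h q p \<noteq> 0"
    using assms isotropic_form form_eq_0_sym unfolding perp_def by blast+
  obtain m where m: "isotropic m" "h m v = 0" "h m p = 0" "m \<notin> span {v, p}"
    using rank_three[OF v p(1)] zeros by (auto simp: perp_def)
  have m': "h v m = 0" "h p m = 0" "h m m = 0"
    using m form_eq_0_sym isotropic_form by blast+
  define a where "a = m - scale (h m c / h v c) v - scale (h m q / h p q) p"
  have "a \<noteq> 0"
  proof
    assume "a = 0"
    then have "m = scale (h m c / h v c) v + scale (h m q / h p q) p"
      by (simp add: a_def algebra_simps)
    then show False
      using m mem_span_pair by blast
  qed
  then have a: "isotropic a" "a \<in> perp {v, c}" "a \<in> perp {p, q}"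
    using m m' zeros vc pq by (simp_all add: a_def isotropic_def perp_def form_simps)
  obtain y where y: "h y a \<noteq> 0"
    using form_nondegenerate[of a] form_eq_0_sym \<open>a \<noteq> 0\<close> by blast
  define b where "b = y - scale (h y c / h v c) v - scale (h y v / h c v) c
    - scale (h y q / h p q) p - scale (h y p / h q p) q"
  have b: "b \<in> perp {v, c}" "b \<in> perp {p, q}"
    using zeros vc pq nz by (simp_all add: b_def perp_def form_simps)
  have "h v a = 0" "h c a = 0" "h p a = 0" "h q a = 0"
    using a form_eq_0_sym unfolding perp_def by blast+
  then have ba: "h b a \<noteq> 0"
    using y by (simp add: b_def form_simps)
  obtain k where k: "h (b + scale k a) (b + scale k a) = 0"
    using isotropic_adjust[of a b] a ba isotropic_form by blast
  have "h (b + scale k a) a \<noteq> 0"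
    using ba a isotropic_form by (simp add: form_simps)
  moreover from this have "b + scale k a \<noteq> 0"
    by (metis form_0_left)
  moreover have "b + scale k a \<in> perp {v, c}" "b + scale k a \<in> perp {p, q}"
    using a b subspace_perp subspace_add subspace_scale by blast+
  ultimately show ?thesis
    using a k form_eq_0_sym unfolding isotropic_def by metis
qed

text \<open>The form on \<open>perp {v}\<close> is degenerate. An isotropic \<open>c\<close>
  orthogonal to \<open>p\<close> and \<open>q\<close> but not to \<open>v\<close> completes
  \<open>v\<close> to a hyperbolic pair and reduces the claim to
  \<open>hyperbolic_pair_perp\<close>.\<close>

lemma point_pair_perp:
  assumes v: "isotropic v"
    and p: "isotropic p" "p \<in> perp {v}" and q: "isotropic q" "q \<in> perp {v}"
    and pq: "h p q \<noteq> 0"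
  shows "\<exists>a b. isotropic a \<and> isotropic b \<and> a \<in> perp {v} \<and> b \<in> perp {v} \<and>
    a \<in> perp {p, q} \<and> b \<in> perp {p, q} \<and> h a b \<noteq> 0"
proof -
  have zeros: "h v v = 0" "h p p = 0" "h q q = 0" "h p v = 0" "h v p = 0" "h q v = 0" "h v q = 0"
    and nz: "h q p \<noteq> 0"
    using assms isotropic_form form_eq_0_sym unfolding perp_def by blast+
  have "v \<notin> span {p, q}"
  proof
    assume "v \<in> span {p, q}"
    then obtain x y where xy: "v = scale x p + scale y q"
      by (auto simp: mem_span_pair)
    have "x = 0" "y = 0"
      using zeros(5,7) zeros(2,3) pq nz unfolding xy by (auto simp: form_simps)
    then show False
      using xy v isotropic_nonzero by simp
  qed
  then obtain c where c: "isotropic c" "c \<in> perp {p, q}" "h c v \<noteq> 0"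
    using isotropic_detect[of "{p, q}" v v] zeros by (auto simp: perp_def)
  have "p \<in> perp {v, c}" "q \<in> perp {v, c}" "h v c \<noteq> 0"
    using c zeros form_eq_0_sym[of c p] form_eq_0_sym[of c q] form_eq_0_sym[of c v]
    by (auto simp: perp_def)
  then show ?thesis
    using hyperbolic_pair_perp[OF v c(1) _ p(1) _ q(1) _ pq] by (simp add: perp_def) blast
qed

text \<open>Supplies auxiliary points: typically one of the three conditions makes \<open>s\<close>
  nonfixed, one keeps it non-orthogonal to \<open>e\<close>, and one is what the argument at hand
  needs.\<close>

lemma point_perp_avoid:
  assumes v: "isotropic v"
    and z: "z1 \<notin> span {v}" "z2 \<notin> span {v}" "z3 \<notin> span {v}"
  obtains s where "isotropic s" "h s v = 0" "h s z1 \<noteq> 0" "h s z2 \<noteq> 0" "h s z3 \<noteq> 0"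
proof -
  obtain a where "isotropic a" "a \<in> perp {v}" "a \<notin> span {v}"
    using rank_three[OF v v] v isotropic_form by (auto simp: perp_def)
  then have detect: "\<exists>s. isotropic s \<and> s \<in> perp {v} \<and> h s z \<noteq> 0" if "z \<notin> span {v}" for z
    using isotropic_detect[of "{v}" z a] that isotropic_form by blast
  obtain s1 s2 s3 where s: "isotropic s1" "s1 \<in> perp {v}" "h s1 z1 \<noteq> 0"
    "isotropic s2" "s2 \<in> perp {v}" "h s2 z2 \<noteq> 0" "isotropic s3" "s3 \<in> perp {v}" "h s3 z3 \<noteq> 0"
    using detect[OF z(1)] detect[OF z(2)] detect[OF z(3)] by metis
  obtain s where "isotropic s" "s \<in> perp {v}" "h s z1 \<noteq> 0" "h s z2 \<noteq> 0" "h s z3 \<noteq> 0"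
    by (rule avoid_three[OF subspace_perp point_pair_perp[OF v] s])
  then show thesis
    using that by (simp add: perp_def)
qed

lemma hyperbolic_perp_avoid:
  assumes v: "isotropic v" and c: "isotropic c" and vc: "h v c \<noteq> 0"
    and z: "z1 \<notin> span {v, c}" "z2 \<notin> span {v, c}" "z3 \<notin> span {v, c}"
  obtains s where "isotropic s" "h s v = 0" "h s c = 0"
    "h s z1 \<noteq> 0" "h s z2 \<noteq> 0" "h s z3 \<noteq> 0"
proof -
  obtain a where "isotropic a" "a \<in> perp {v, c}" "a \<notin> span {v, c}"
    by (rule hyperbolic_plane_perp[OF v c vc])
  then have detect: "\<exists>s. isotropic s \<and> s \<in> perp {v, c} \<and> h s z \<noteq> 0" if "z \<notin> span {v, c}" for z
    using isotropic_detect[of "{v, c}" z a] that isotropic_form by blast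
  obtain s1 s2 s3 where s: "isotropic s1" "s1 \<in> perp {v, c}" "h s1 z1 \<noteq> 0"
    "isotropic s2" "s2 \<in> perp {v, c}" "h s2 z2 \<noteq> 0"
    "isotropic s3" "s3 \<in> perp {v, c}" "h s3 z3 \<noteq> 0"
    using detect[OF z(1)] detect[OF z(2)] detect[OF z(3)] by metis
  obtain s where "isotropic s" "s \<in> perp {v, c}" "h s z1 \<noteq> 0" "h s z2 \<noteq> 0" "h s z3 \<noteq> 0"
    by (rule avoid_three[OF subspace_perp hyperbolic_pair_perp[OF v c vc] s])
  then show thesis
    using that by (simp add: perp_def)
qed

end

section \<open>Semilinear extension\<close>

locale domestic_map_fixed = domestic_map scale \<sigma> h r
  for scale :: "'k::field \<Rightarrow> 'v::ab_group_add \<Rightarrow> 'v" and \<sigma> h r +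
  fixes e :: 'v
  assumes e_isotropic: "isotropic e" and e_fixed: "fixed e"
    and nontrivial: "\<exists>z. isotropic z \<and> \<not> fixed z"
begin

text \<open>The complement of the hyperplane \<open>perp {e}\<close>, on which representatives can
  be normalised by their product with \<open>e\<close>; unrelated to affine sets in a vector
  space.\<close>

definition affine :: "'v \<Rightarrow> bool" where
  "affine v \<longleftrightarrow> isotropic v \<and> h v e \<noteq> 0"

text \<open>The normalisation with respect to the fixed vector \<open>e\<close> is the one forced by a
  \<open>\<sigma>\<close>-semilinear map \<open>T\<close> with \<open>T e = e\<close> and \<open>h (T x) (T y) = - \<sigma> (h x y)\<close>.\<close>

definition lift :: "'v \<Rightarrow> 'v" where
  "lift v = scale (- \<sigma> (h v e) / h (r v) e) (r v)"

lemma affine_isotropic: "affine v \<Longrightarrow> isotropic v"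
  by (simp add: affine_def)

lemma r_e:
  assumes "isotropic v"
  shows "h (r v) e = 0 \<longleftrightarrow> h v e = 0"
proof -
  obtain c where c: "r e = scale c e"
    using e_fixed by (auto simp: fixed_def mem_span_single)
  then have "c \<noteq> 0"
    using r_isotropic[OF e_isotropic] isotropic_nonzero by fastforce
  then show ?thesis
    using r_perp[OF assms e_isotropic] c by (simp add: form_simps)
qed

lemma lift_span:
  assumes "affine v"
  shows "lift v \<in> span {r v}" "r v \<in> span {lift v}" "lift v \<noteq> 0"
proof -
  show 1: "lift v \<in> span {r v}"
    unfolding lift_def mem_span_single by blast
  show 2: "lift v \<noteq> 0"
    using assms r_e[of v] r_isotropic[of v] isotropic_nonzero[of "r v"]
    by (simp add: lift_def affine_def)
  show "r v \<in> span {lift v}"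
    using span_single_sym 1 2 by blast
qed

lemma lift_e: "affine v \<Longrightarrow> h (lift v) e = - \<sigma> (h v e)"
  using r_e[of v] by (simp add: lift_def affine_def form_simps)

lemma lift_affine:
  assumes "affine v"
  shows "affine (lift v)"
proof -
  have "h (lift v) (lift v) = 0"
    using r_isotropic[of v] assms by (simp add: lift_def affine_def isotropic_def form_simps)
  then show ?thesis
    using assms lift_e lift_span(3) by (simp add: affine_def isotropic_def)
qed

lemma lift_eqI:
  assumes "affine v" "w \<in> span {r v}" "h w e = - \<sigma> (h v e)"
  shows "lift v = w"
proof -
  obtain c where c: "w = scale c (r v)"
    using assms by (auto simp: mem_span_single)
  have "h (r v) e \<noteq> 0"
    using r_e assms by (simp add: affine_def)
  then have "c = - \<sigma> (h v e) / h (r v) e"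
    using assms(3) by (simp add: c form_simps field_simps)
  then show ?thesis
    by (simp add: c lift_def)
qed

lemma lift_lift:
  assumes "affine v"
  shows "lift (lift v) = v"
proof (rule lift_eqI)
  have "r (lift v) \<in> span {r (r v)}"
    using r_span[of "r v" "lift v"] lift_span(1)[OF assms] assms r_isotropic lift_affine
      affine_isotropic by simp
  then have "r (lift v) \<in> span {v}"
    using r_involution[OF affine_isotropic[OF assms]] by (rule span_single_trans)
  then show "v \<in> span {r (lift v)}"
    using span_single_sym r_isotropic lift_affine affine_isotropic isotropic_nonzero assms by blast
qed (simp_all add: assms lift_affine lift_e sigma_simps)

lemma lift_perp:
  assumes "affine v" "isotropic w"
  shows "h (r w) (lift v) = 0 \<longleftrightarrow> h w v = 0"
proof -
  have "h (r w) (r v) = 0 \<longleftrightarrow> h (r w) (lift v) = 0"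
    using lift_span(1,2)[OF assms(1)] by (auto simp: mem_span_single form_simps)
  then show ?thesis
    using r_perp assms affine_isotropic by blast
qed

lemma lift_perp_lift:
  assumes "affine v" "affine w"
  shows "h (lift w) (lift v) = 0 \<longleftrightarrow> h w v = 0"
proof -
  have "h (lift w) (lift v) = 0 \<longleftrightarrow> h (r w) (lift v) = 0"
    using lift_span(1,2)[OF assms(2)] by (auto simp: mem_span_single form_simps)
  then show ?thesis
    using lift_perp assms affine_isotropic by blast
qed

lemma lift_perp_swap:
  assumes "affine v" "affine w"
  shows "h (lift w) v = 0 \<longleftrightarrow> h w (lift v) = 0"
  using lift_perp_lift[of "lift v" w] lift_lift lift_affine assms by simp

lemma lift_domestic:
  assumes "affine v"
  shows "h v (lift v) = 0" "h (lift v) v = 0"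
proof -
  show "h v (lift v) = 0"
    using r_domestic[of v] assms by (simp add: lift_def affine_def form_simps)
  then show "h (lift v) v = 0"
    using form_eq_0_sym by blast
qed

lemma lift_fixed:
  assumes "affine v"
  shows "fixed (lift v) \<longleftrightarrow> fixed v"
proof -
  have "fixed (r v) \<longleftrightarrow> fixed (lift v)"
    using fixed_span[of "r v" "lift v"] fixed_span[of "lift v" "r v"] lift_span[OF assms]
      r_isotropic lift_affine affine_isotropic assms by blast
  then show ?thesis
    using fixed_r affine_isotropic assms by blast
qed

text \<open>The point of the line orthogonal to \<open>e\<close> must go to a point orthogonal to
  \<open>e\<close>. This one condition forces the factor \<open>k\<close> of the semilinear
  description to be 1, and by its definition \<open>k = 1\<close> is also the first claim.\<close>

lemma lift_opposite_line:
  assumes v: "affine v" and w: "affine w" and vw: "h v w = 0" "h v (lift w) \<noteq> 0"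
  shows "h w (lift v) = - h v (lift w)"
    and "r (v + scale t w) \<in> span {lift v + scale (\<sigma> t) (lift w)}"
proof -
  define k where "k = - \<sigma> (h w (lift v) / h v (lift w))"
  have line: "r (v + scale t w) \<in> span {lift v + scale (k * \<sigma> t) (lift w)}" for t
  proof -
    have "r (v + scale t w) \<in>
        span {lift v + scale (- \<sigma> (t * h w (lift v) / h v (lift w))) (lift w)}"
      using v w vw lift_span affine_isotropic by (intro opposite_line) auto
    also have "- \<sigma> (t * h w (lift v) / h v (lift w)) = k * \<sigma> t"
      by (simp add: k_def sigma_simps)
    finally show ?thesis .
  qed
  have vw': "h v (r w) \<noteq> 0"
    using vw lift_span(1)[OF w] by (auto simp: mem_span_single form_simps)
  have we: "h w e \<noteq> 0" and ve: "h v e \<noteq> 0"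
    using v w by (simp_all add: affine_def)
  let ?t = "- h v e / h w e"
  let ?z = "v + scale ?t w"
  have z: "isotropic ?z"
    using isotropic_on_line v w vw vw' affine_isotropic by blast
  have "h ?z e = 0"
    using we by (simp add: form_simps)
  then have 0: "h (r ?z) e = 0"
    using r_e z by blast
  obtain c where c: "r ?z = scale c (lift v + scale (k * \<sigma> ?t) (lift w))"
    using line[of ?t] unfolding mem_span_single by blast
  have "c \<noteq> 0"
    using c r_isotropic[OF z] isotropic_nonzero by fastforce
  then have "h (lift v) e + k * \<sigma> ?t * h (lift w) e = 0"
    using 0 unfolding c by (simp add: form_simps)
  then have "k * \<sigma> (h v e) = \<sigma> (h v e)"
    using we by (simp add: lift_e v w sigma_simps)
  then have k: "k = 1"
    using ve by simp
  then show "r (v + scale t w) \<in> span {lift v + scale (\<sigma> t) (lift w)}"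
    using line[of t] by simp
  have "\<sigma> k = - (h w (lift v) / h v (lift w))"
    by (simp add: k_def sigma_minus sigma_invol)
  then show "h w (lift v) = - h v (lift w)"
    using k vw by (simp add: field_simps)
qed

text \<open>The relation that a semilinear extension of \<open>lift\<close> has to satisfy;
  conversely, the extension will exist once it holds for all nonfixed pairs.\<close>

definition compatible :: "'v \<Rightarrow> 'v \<Rightarrow> bool" where
  "compatible v w \<longleftrightarrow> h (lift v) (lift w) = - \<sigma> (h v w)"

text \<open>If \<open>h v w \<noteq> 0\<close>, the line of \<open>v\<close> and
  \<open>lift w\<close> is opposite its image, and \<open>lift_opposite_line\<close> for these two
  vectors is the claim.\<close>

lemma compatible_perp:
  assumes v: "affine v" and w: "affine w" and vw: "h v (lift w) = 0"
  shows "compatible v w"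
proof (cases "h v w = 0")
  case True
  then show ?thesis
    using lift_perp_lift[of w v] v w by (simp add: compatible_def)
next
  case False
  have "h (lift w) (lift v) = - h v (lift (lift w))"
    using lift_opposite_line(1)[of v "lift w"] v w vw False lift_lift lift_affine by simp
  then have "\<sigma> (h (lift v) (lift w)) = - h v w"
    by (metis lift_lift w form_hermitian)
  then have "\<sigma> (\<sigma> (h (lift v) (lift w))) = \<sigma> (- h v w)"
    by simp
  then show ?thesis
    by (simp add: compatible_def sigma_simps)
qed

text \<open>The point of the line \<open>v u\<close> orthogonal to \<open>w\<close> goes to a point
  orthogonal to \<open>lift w\<close>. As its image on the line of \<open>lift v\<close> and
  \<open>lift u\<close> is known explicitly, the relation passes from \<open>u\<close> to
  \<open>v\<close>.\<close>

lemma compatible_propagate: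
  assumes v: "affine v" and u: "affine u" and w: "affine w"
    and vu: "h v u = 0" "h v (lift u) \<noteq> 0"
    and uw: "compatible u w" "h u w \<noteq> 0"
  shows "compatible v w"
proof -
  let ?t = "- h v w / h u w"
  let ?z = "v + scale ?t u"
  have "h v (r u) \<noteq> 0"
    using vu lift_span(1)[OF u] by (auto simp: mem_span_single form_simps)
  then have z: "isotropic ?z"
    using isotropic_on_line v u vu affine_isotropic by blast
  have "h ?z w = 0"
    using uw by (simp add: form_simps)
  then have 0: "h (r ?z) (lift w) = 0"
    using lift_perp w z by blast
  obtain c where c: "r ?z = scale c (lift v + scale (\<sigma> ?t) (lift u))"
    using lift_opposite_line(2)[OF v u vu, of ?t] unfolding mem_span_single by blast
  have "c \<noteq> 0"
    using c r_isotropic[OF z] isotropic_nonzero by fastforce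
  then have "h (lift v) (lift w) + \<sigma> ?t * h (lift u) (lift w) = 0"
    using 0 unfolding c by (simp add: form_simps)
  then have "h (lift v) (lift w) = \<sigma> ?t * \<sigma> (h u w)"
    using uw by (simp add: compatible_def add_eq_0_iff)
  then show ?thesis
    using uw by (simp add: compatible_def sigma_simps)
qed

lemma fixed_lift_span:
  assumes "affine v"
  shows "lift v \<in> span {v} \<longleftrightarrow> fixed v"
  using lift_span[OF assms] span_single_trans unfolding fixed_def by blast

text \<open>An intermediate \<open>u\<close> orthogonal to \<open>v\<close> and
  \<open>lift w\<close> is compatible with \<open>w\<close> by \<open>compatible_perp\<close> and
  joined to \<open>v\<close> by a line opposite its image. It must not be orthogonal to
  \<open>lift v\<close>, \<open>w\<close> or \<open>e\<close>, so these three vectors have to lie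
  outside \<open>span {v, lift w}\<close>.\<close>

lemma compatible_generic:
  assumes v: "affine v" "\<not> fixed v" and w: "affine w" "\<not> fixed w"
    and vw: "h v w \<noteq> 0" "h v (lift w) \<noteq> 0" and e: "e \<notin> span {v, lift w}"
  shows "compatible v w"
proof -
  note zeros = lift_domestic[OF v(1)] lift_domestic[OF w(1)]
    isotropic_form[OF affine_isotropic[OF v(1)]]
    isotropic_form[OF affine_isotropic[OF lift_affine[OF w(1)]]]
  have vw': "h (lift w) v \<noteq> 0"
    using vw form_eq_0_sym by blast
  have lv: "lift v \<notin> span {v, lift w}"
  proof
    assume "lift v \<in> span {v, lift w}"
    then obtain a b where ab: "lift v = scale a v + scale b (lift w)"
      by (auto simp: mem_span_pair)
    have "b = 0"
      using zeros(2) vw' zeros unfolding ab by (auto simp: form_simps)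
    then show False
      using ab fixed_lift_span[OF v(1)] v(2) by (auto simp: mem_span_single)
  qed
  have lw: "w \<notin> span {v, lift w}"
  proof
    assume "w \<in> span {v, lift w}"
    then obtain a b where ab: "w = scale a v + scale b (lift w)"
      by (auto simp: mem_span_pair)
    have "h w (lift w) = a * h v (lift w)"
      using zeros(6) by (subst (1) ab) (simp only: form_simps mult_zero_right add_0_right)
    then have "a = 0"
      using zeros vw by simp
    then have "w \<in> span {lift w}"
      using ab by (auto simp: mem_span_single)
    then have "lift (lift w) \<in> span {lift w}"
      by (simp add: lift_lift w)
    then show False
      using fixed_lift_span[OF lift_affine] lift_fixed w by blast
  qed
  obtain u where u: "isotropic u" "h u v = 0" "h u (lift w) = 0"
    "h u (lift v) \<noteq> 0" "h u w \<noteq> 0" "h u e \<noteq> 0"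
    by (rule hyperbolic_perp_avoid[OF affine_isotropic[OF v(1)]
          affine_isotropic[OF lift_affine[OF w(1)]] vw(2) lv lw e])
  have au: "affine u"
    using u by (simp add: affine_def)
  have "h u (lift w) = 0" "h v u = 0"
    using u form_eq_0_sym by blast+
  moreover have "h v (lift u) \<noteq> 0"
    using lift_perp_swap[OF v(1) au] u(4) form_eq_0_sym by blast
  ultimately show ?thesis
    using compatible_propagate[OF v(1) au w(1)] compatible_perp[OF au w(1)] u by blast
qed

text \<open>The only case left open is \<open>e\<close> in \<open>span {v, lift w}\<close>. Passing
  from \<open>v\<close> to a suitable \<open>y\<close> collinear with it destroys this coincidence,
  and the relation is then propagated back from \<open>y\<close> to \<open>v\<close>.\<close>

lemma compatible_nonfixed:
  assumes v: "affine v" "\<not> fixed v" and w: "affine w" "\<not> fixed w"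
  shows "compatible v w"
proof -
  note zeros = lift_domestic[OF v(1)] isotropic_form[OF affine_isotropic[OF v(1)]]
    isotropic_form[OF affine_isotropic[OF lift_affine[OF w(1)]]] isotropic_form[OF e_isotropic]
  consider "h v w = 0" | "h v (lift w) = 0" | "h v w \<noteq> 0" "h v (lift w) \<noteq> 0"
    by blast
  then show ?thesis
  proof cases
    case 1
    then show ?thesis
      using lift_perp_lift v w by (simp add: compatible_def)
  next
    case 2
    then show ?thesis
      using compatible_perp v w by blast
  next
    case 3
    show ?thesis
    proof (cases "e \<in> span {v, lift w}")
      case False
      then show ?thesis
        using compatible_generic v w 3 by blast
    next
      case True
      then obtain c d where e: "e = scale c v + scale d (lift w)"
        by (auto simp: mem_span_pair)
      have iv: "isotropic v"
        using v affine_isotropic by blast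
      have ni: "h x v \<noteq> 0 \<Longrightarrow> x \<notin> span {v}" for x
        using zeros by (auto simp: mem_span_single form_simps)
      have lv: "lift v \<notin> span {v}"
        using fixed_lift_span v by blast
      have nz: "h e v \<noteq> 0" "h w v \<noteq> 0"
        using v 3 form_eq_0_sym unfolding affine_def by blast+
      obtain y where y: "isotropic y" "h y v = 0" "h y (lift v) \<noteq> 0" "h y e \<noteq> 0" "h y w \<noteq> 0"
        by (rule point_perp_avoid[OF iv lv ni[OF nz(1)] ni[OF nz(2)]])
      have ay: "affine y"
        using y by (simp add: affine_def)
      have yv: "h y v = 0" "h v y = 0"
        using y form_eq_0_sym by blast+
      have "h y (r v) \<noteq> 0"
        using y(3) by (auto simp: lift_def form_simps)
      then have fy: "\<not> fixed y"
        using nonfixedI[of y v] y iv yv by blast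
      have vy: "h v (lift y) \<noteq> 0"
        using lift_perp_swap[OF v(1) ay] y(3) form_eq_0_sym by blast
      have "compatible y w"
      proof (cases "h y (lift w) = 0")
        case True
        then show ?thesis
          using compatible_perp ay w by blast
      next
        case False
        \<comment> \<open>Products with \<open>v\<close> show that two expressions for
          \<open>e\<close> would have the same component along \<open>lift w\<close>; then
          \<open>y\<close> and \<open>v\<close> would be proportional, against
          \<open>h y (lift v) \<noteq> 0\<close>.\<close>
        have "e \<notin> span {y, lift w}"
        proof
          assume "e \<in> span {y, lift w}"
          then obtain a b where e': "e = scale a y + scale b (lift w)"
            by (auto simp: mem_span_pair)
          have "h (lift w) e \<noteq> 0"
            using lift_affine[OF w(1)] by (simp add: affine_def)
          moreover have "h (lift w) e = \<sigma> c * h (lift w) v"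
            using zeros by (subst e) (simp add: form_simps)
          moreover have "h (lift w) e = \<sigma> a * h (lift w) y"
            using zeros by (subst e') (simp add: form_simps)
          ultimately have "c \<noteq> 0" "a \<noteq> 0"
            by auto
          have "h (scale c v + scale d (lift w)) v = h (scale a y + scale b (lift w)) v"
            using e e' by simp
          then have "d * h (lift w) v = b * h (lift w) v"
            using zeros yv by (simp add: form_simps)
          then have "d = b"
            using 3 form_eq_0_sym[of v "lift w"] by simp
          then have "scale c v = scale a y"
            using e e' by (metis add_right_cancel)
          then have "c * h v (lift v) = a * h y (lift v)"
            by (metis form_scale)
          then show False
            using \<open>a \<noteq> 0\<close> y(3) zeros by simp
        qed
        then show ?thesis
          using compatible_generic ay fy w y False by blast
      qed
      then show ?thesis
        using compatible_propagate[OF v(1) ay w(1) yv(2) vy] y by blast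
    qed
  qed
qed

section \<open>Nonfixed vectors off the hyperplane of \<open>e\<close> span the space\<close>

definition nonfixed :: "'v set" where
  "nonfixed = {v. affine v \<and> \<not> fixed v}"

text \<open>A vector not orthogonal to \<open>e\<close> becomes isotropic when moved along
  \<open>e\<close>; an orthogonal one is first shifted by an isotropic \<open>b\<close> not
  orthogonal to \<open>e\<close>.\<close>

lemma span_isotropic: "x \<in> span {v. isotropic v}"
proof -
  have nonperp: "x \<in> span {v. isotropic v}" if x: "h x e \<noteq> 0" for x
  proof -
    obtain c where c: "h (x + scale c e) (x + scale c e) = 0"
      using isotropic_adjust[of e x] x e_isotropic isotropic_form by blast
    have "h (x + scale c e) e \<noteq> 0"
      using x e_isotropic isotropic_form by (simp add: form_simps)
    then have "x + scale c e \<noteq> 0"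
      by (metis form_0_left)
    then have "x + scale c e - scale c e \<in> span {v. isotropic v}"
      using c e_isotropic by (intro span_diff span_scale span_base) (auto simp: isotropic_def)
    then show ?thesis
      by simp
  qed
  show ?thesis
  proof (cases "h x e = 0")
    case True
    obtain b where b: "isotropic b" "h b e \<noteq> 0"
      using isotropic_detect[of "{}" e e] e_isotropic isotropic_form isotropic_nonzero
      by (auto simp: perp_def)
    then have "x + b \<in> span {v. isotropic v}"
      using True by (intro nonperp) (simp add: form_simps)
    then have "x + b - b \<in> span {v. isotropic v}"
      using b by (intro span_diff) (auto intro: span_base)
    then show ?thesis
      by simp
  qed (rule nonperp)
qed

lemma exists_nonfixed_nonperp:
  assumes p: "isotropic p" "fixed p"
  obtains z where "isotropic z" "\<not> fixed z" "h z p \<noteq> 0"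
proof -
  obtain z where z: "isotropic z" "\<not> fixed z"
    using nontrivial by blast
  show thesis
  proof (cases "h z p = 0")
    case True
    have rz: "r z \<notin> span {z}"
      using z by (simp add: fixed_def)
    have pz: "p \<notin> span {z}"
      using fixed_span_iff[OF z(1) p(1)] p z by blast
    obtain s where "isotropic s" "h s z = 0" "h s (r z) \<noteq> 0" "h s p \<noteq> 0"
      by (rule point_perp_avoid[OF z(1) rz pz pz])
    then show thesis
      using that nonfixedI[of s z] z by blast
  qed (use that z in blast)
qed

text \<open>In the hyperbolic plane of \<open>p\<close> and \<open>z\<close> only multiples of
  \<open>z\<close> are orthogonal to \<open>z\<close>, and \<open>r z\<close> is orthogonal to
  \<open>z\<close> by domesticity.\<close>

lemma nonfixed_notin_hyperbolic:
  assumes p: "isotropic p" and z: "isotropic z" "\<not> fixed z" and zp: "h z p \<noteq> 0"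
  shows "r z \<notin> span {p, z}"
proof
  assume "r z \<in> span {p, z}"
  then obtain a b where ab: "r z = scale a p + scale b z"
    by (auto simp: mem_span_pair)
  have "h (r z) z = 0" "h p z \<noteq> 0"
    using r_domestic[OF z(1)] zp form_eq_0_sym by blast+
  then have "a = 0"
    using z isotropic_form unfolding ab by (simp add: form_simps)
  then show False
    using ab z by (auto simp: fixed_def mem_span_single)
qed

text \<open>Even if orthogonal to \<open>e\<close>, a nonfixed \<open>p\<close> is a multiple of the
  difference of two members \<open>s\<close> and \<open>s + t p\<close> of
  \<open>nonfixed\<close>.\<close>

lemma span_nonfixed_isotropic:
  assumes p: "isotropic p" "\<not> fixed p"
  shows "p \<in> span nonfixed"
proof -
  have rp: "r p \<notin> span {p}"
    using p by (simp add: fixed_def)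
  have ep: "e \<notin> span {p}"
    using fixed_span_iff[OF p(1) e_isotropic] p e_fixed by blast
  obtain s where s: "isotropic s" "h s p = 0" "h s (r p) \<noteq> 0" "h s e \<noteq> 0"
    by (rule point_perp_avoid[OF p(1) rp ep ep])
  obtain t where t: "t \<noteq> 0" "h (s + scale t p) e \<noteq> 0"
    using avoid_on_line[of s e e] s by blast
  have iso: "isotropic (s + scale t p)"
    using isotropic_on_line s p by blast
  have "h (s + scale t p) p = 0" "h (s + scale t p) (r p) \<noteq> 0"
    using s p r_domestic isotropic_form by (simp_all add: form_simps)
  then have "s \<in> nonfixed" "s + scale t p \<in> nonfixed"
    using nonfixedI[of _ p] s p t iso by (simp_all add: nonfixed_def affine_def)
  then have "scale (inverse t) ((s + scale t p) - s) \<in> span nonfixed"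
    by (intro span_scale span_diff span_base)
  then show ?thesis
    using t by simp
qed

lemma span_nonfixed: "x \<in> span nonfixed"
proof -
  have "p \<in> span nonfixed" if p: "isotropic p" for p
  proof (cases "fixed p")
    case False
    then show ?thesis
      using span_nonfixed_isotropic p by blast
  next
    case True
    \<comment> \<open>A fixed \<open>p\<close> is reached along the hyperbolic line of
      \<open>p\<close> and a nonfixed \<open>z\<close>: its isotropic vector \<open>?w\<close> is
      nonfixed, as witnessed by an \<open>s\<close> orthogonal to \<open>p\<close> and
      \<open>z\<close> but not to \<open>r z\<close>.\<close>
    obtain z where z: "isotropic z" "\<not> fixed z" "h z p \<noteq> 0"
      using exists_nonfixed_nonperp p True by blast
    then have pz: "h p z \<noteq> 0"
      using form_eq_0_sym by blast
    have rz: "r z \<notin> span {p, z}"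
      by (rule nonfixed_notin_hyperbolic[OF p z])
    obtain s where s: "isotropic s" "h s p = 0" "h s z = 0" "h s (r z) \<noteq> 0"
      by (rule hyperbolic_perp_avoid[OF p z(1) pz rz rz rz])
    obtain \<epsilon> where eps: "\<epsilon> \<noteq> 0" "\<sigma> \<epsilon> = - \<epsilon>"
      by (rule skew_scalar)
    \<comment> \<open>Chosen so that the mixed terms of \<open>h ?w ?w\<close> are
      \<open>\<epsilon>\<close> and \<open>\<sigma> \<epsilon> = - \<epsilon>\<close>.\<close>
    define t where "t = \<sigma> (\<epsilon> / h p z)"
    have t: "t \<noteq> 0"
      using eps pz by (simp add: t_def)
    let ?w = "p + scale t z"
    have "h ?w p \<noteq> 0"
      using t z p isotropic_form by (simp add: form_simps)
    then have "?w \<noteq> 0"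
      by (metis form_0_left)
    moreover have "h ?w ?w = 0"
      using p z eps pz isotropic_form
      by (simp add: t_def form_simps sigma_simps form_hermitian[of p z])
    ultimately have w: "isotropic ?w"
      by (simp add: isotropic_def)
    have "\<not> fixed ?w"
    proof
      assume "fixed ?w"
      then obtain c where c: "r ?w = scale c ?w"
        by (auto simp: fixed_def mem_span_single)
      obtain d where d: "r p = scale d p"
        using True by (auto simp: fixed_def mem_span_single)
      have "c \<noteq> 0" "d \<noteq> 0"
        using c d r_isotropic[OF w] r_isotropic[OF p] isotropic_nonzero by fastforce+
      moreover have "h (r s) (r ?w) = 0" "h (r s) (r p) = 0"
        using r_perp s w p by (simp_all add: form_simps)
      ultimately have "h (r s) ?w = 0" "h (r s) p = 0"
        by (simp_all add: c d form_scale_right)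
      then have "h (r s) z = 0"
        using t by (simp add: form_simps)
      then show False
        using r_sym[of z s] s z form_eq_0_sym by blast
    qed
    then have "?w \<in> span nonfixed" "z \<in> span nonfixed"
      using span_nonfixed_isotropic w z by blast+
    then have "?w - scale t z \<in> span nonfixed"
      by (intro span_diff span_scale)
    then show ?thesis
      by simp
  qed
  then have "{v. isotropic v} \<subseteq> span nonfixed"
    by blast
  then have "span {v. isotropic v} \<subseteq> span nonfixed"
    by (simp add: span_minimal)
  then show ?thesis
    using span_isotropic by blast
qed

lemma nonfixed_lift: "w \<in> nonfixed \<Longrightarrow> lift w \<in> nonfixed"
  using lift_affine lift_fixed by (simp add: nonfixed_def)

lemma eq_0_if_perp_nonfixed:
  assumes "\<And>w. w \<in> nonfixed \<Longrightarrow> h d w = 0"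
  shows "d = 0"
proof -
  have "h d y = 0" for y
    using perp_span[of d nonfixed y] assms span_nonfixed by (simp add: perp_def)
  then show ?thesis
    using form_nondegenerate by blast
qed

text \<open>\<open>lift\<close> permutes the spanning set \<open>nonfixed\<close>, so products with
  lifts separate vectors; this is the uniqueness on which \<open>T\<close> rests.\<close>

lemma eq_if_lift_form_eq:
  assumes "\<And>w. w \<in> nonfixed \<Longrightarrow> h x (lift w) = h y (lift w)"
  shows "x = y"
proof -
  have "h (x - y) w = 0" if "w \<in> nonfixed" for w
    using assms[OF nonfixed_lift[OF that]] that
    by (simp add: nonfixed_def lift_lift form_simps)
  then have "x - y = 0"
    by (rule eq_0_if_perp_nonfixed)
  then show ?thesis
    by simp
qed

text \<open>An implicit description by products with all lifts at once: no basis is chosen, and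
  additivity reduces to uniqueness of the solution.\<close>

definition T :: "'v \<Rightarrow> 'v" where
  "T x = (SOME x'. \<forall>w\<in>nonfixed. h x' (lift w) = - \<sigma> (h x w))"

text \<open>The vectors \<open>x\<close> for which the system is solvable form a subspace, because
  the prescribed values are additive and \<open>\<sigma>\<close>-semilinear in \<open>x\<close>. For
  \<open>x\<close> in \<open>nonfixed\<close>, compatibility says that \<open>lift x\<close> is a
  solution.\<close>

lemma T_form_lift:
  assumes w: "w \<in> nonfixed"
  shows "h (T x) (lift w) = - \<sigma> (h x w)"
proof -
  let ?W = "{x. \<exists>x'. \<forall>w\<in>nonfixed. h x' (lift w) = - \<sigma> (h x w)}"
  have "subspace ?W"
    unfolding subspace_def
  proof (intro conjI ballI allI)
    show "0 \<in> ?W"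
      by (auto intro: exI[of _ 0])
    fix x y c
    assume "x \<in> ?W"
    then obtain x' where x': "\<forall>w\<in>nonfixed. h x' (lift w) = - \<sigma> (h x w)"
      by blast
    then have "\<forall>w\<in>nonfixed. h (scale (\<sigma> c) x') (lift w) = - \<sigma> (h (scale c x) w)"
      by (simp add: form_simps sigma_simps)
    then show "scale c x \<in> ?W"
      by blast
    assume "y \<in> ?W"
    then obtain y' where y': "\<forall>w\<in>nonfixed. h y' (lift w) = - \<sigma> (h y w)"
      by blast
    then have "\<forall>w\<in>nonfixed. h (x' + y') (lift w) = - \<sigma> (h (x + y) w)"
      using x' by (simp add: form_simps sigma_simps)
    then show "x + y \<in> ?W"
      by blast
  qed
  moreover have "nonfixed \<subseteq> ?W"
    using compatible_nonfixed unfolding nonfixed_def compatible_def by blast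
  ultimately have "span nonfixed \<subseteq> ?W"
    by (rule span_minimal[rotated])
  then have "\<exists>x'. \<forall>w\<in>nonfixed. h x' (lift w) = - \<sigma> (h x w)"
    using span_nonfixed by blast
  then have "\<forall>w\<in>nonfixed. h (T x) (lift w) = - \<sigma> (h x w)"
    unfolding T_def by (rule someI_ex)
  then show ?thesis
    using w by blast
qed

lemma T_eqI:
  assumes "\<And>w. w \<in> nonfixed \<Longrightarrow> h x' (lift w) = - \<sigma> (h x w)"
  shows "T x = x'"
  by (rule eq_if_lift_form_eq) (simp add: T_form_lift assms)

lemma T_add: "T (x + y) = T x + T y"
  by (rule T_eqI) (simp add: T_form_lift form_simps sigma_simps)

lemma T_scale: "T (scale a x) = scale (\<sigma> a) (T x)"
  by (rule T_eqI) (simp add: T_form_lift form_simps sigma_simps)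

lemma T_lift: "w \<in> nonfixed \<Longrightarrow> T w = lift w"
  by (rule T_eqI) (use compatible_nonfixed in \<open>auto simp: nonfixed_def compatible_def\<close>)

lemma T_form: "h (T x) (T y) = - \<sigma> (h x y)"
proof -
  let ?W = "{y. h (T x) (T y) = - \<sigma> (h x y)}"
  have "T 0 = 0"
    using T_scale[of 0 0] by simp
  then have "subspace ?W"
    by (auto simp: subspace_def T_add T_scale form_simps sigma_simps)
  moreover have "nonfixed \<subseteq> ?W"
    by (auto simp: T_lift T_form_lift)
  ultimately have "span nonfixed \<subseteq> ?W"
    by (rule span_minimal[rotated])
  then show ?thesis
    using span_nonfixed by blast
qed

lemma T_T: "T (T x) = x"
proof (rule T_eqI)
  fix w assume w: "w \<in> nonfixed"
  have "h (T x) (lift (lift w)) = - \<sigma> (h x (lift w))"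
    using T_form_lift nonfixed_lift w by blast
  then have "\<sigma> (h (T x) w) = - h x (lift w)"
    using w by (simp add: lift_lift nonfixed_def sigma_simps)
  then show "h x (lift w) = - \<sigma> (h (T x) w)"
    by simp
qed

text \<open>Skewness, which follows from \<open>T_form\<close> and \<open>T_T\<close>, makes
  \<open>h x (T x)\<close> additive in \<open>x\<close>, so its zeros form a subspace; domesticity
  puts the spanning set into it. In characteristic 2 skewness alone would not suffice.\<close>

lemma T_alternating: "h x (T x) = 0"
proof -
  have skew: "h y (T x) = - h x (T y)" for x y
  proof -
    have "h y (T x) = \<sigma> (h (T x) (T (T y)))"
      by (metis T_T form_hermitian)
    then show ?thesis
      by (simp add: T_form sigma_simps)
  qed
  let ?W = "{x. h x (T x) = 0}"
  have "h (x + y) (T (x + y)) = h x (T x) + h y (T y)" for x y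
    using skew[of y x] by (simp add: T_add form_simps)
  moreover have "T 0 = 0"
    using T_scale[of 0 0] by simp
  ultimately have "subspace ?W"
    by (auto simp: subspace_def T_scale form_simps)
  moreover have "nonfixed \<subseteq> ?W"
    by (auto simp: T_lift nonfixed_def lift_domestic)
  ultimately have "span nonfixed \<subseteq> ?W"
    by (rule span_minimal[rotated])
  then show ?thesis
    using span_nonfixed by blast
qed

section \<open>\<open>T\<close> induces the given point map\<close>

lemma T_isotropic:
  assumes "isotropic x"
  shows "isotropic (T x)"
proof -
  have "T x \<noteq> 0"
    using assms T_T[of x] T_scale[of 0 0] by (auto simp: isotropic_def)
  then show ?thesis
    using assms T_form[of x x] by (simp add: isotropic_def)
qed

lemma r_T_perp:
  assumes "isotropic p" "s \<in> nonfixed" "h s p = 0"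
  shows "h s (T (r p)) = 0"
proof -
  have "h (r p) (lift s) = 0"
    using lift_perp[of s p] assms form_eq_0_sym by (simp add: nonfixed_def)
  then have "h (T (T (r p))) (T s) = 0"
    using assms by (simp add: T_T T_lift)
  then have "h (T (r p)) s = 0"
    by (simp add: T_form)
  then show ?thesis
    using form_eq_0_sym by blast
qed

text \<open>\<open>T\<close> agrees with \<open>r\<close> by construction only off the hyperplane of
  \<open>e\<close>. For any nonfixed \<open>p\<close>, a member \<open>s\<close> of
  \<open>nonfixed\<close> orthogonal to \<open>p\<close> but not to \<open>T (r p)\<close> would
  exist if these spanned different points, against \<open>r_T_perp\<close>.\<close>

lemma r_T_nonfixed:
  assumes p: "isotropic p" "\<not> fixed p"
  shows "r p \<in> span {T p}"
proof -
  let ?g = "T (r p)"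
  have "?g \<in> span {p}"
  proof (rule ccontr)
    assume g: "?g \<notin> span {p}"
    have rp: "r p \<notin> span {p}"
      using p by (simp add: fixed_def)
    have ep: "e \<notin> span {p}"
      using fixed_span_iff[OF p(1) e_isotropic] p e_fixed by blast
    obtain s where s: "isotropic s" "h s p = 0" "h s (r p) \<noteq> 0" "h s e \<noteq> 0" "h s ?g \<noteq> 0"
      by (rule point_perp_avoid[OF p(1) rp ep g])
    then have "s \<in> nonfixed" "h s p = 0"
      using nonfixedI[of s p] p by (simp_all add: nonfixed_def affine_def)
    then show False
      using r_T_perp p s by blast
  qed
  then obtain c where c: "T (r p) = scale c p"
    by (auto simp: mem_span_single)
  have "r p = T (T (r p))"
    by (simp add: T_T)
  also have "\<dots> = scale (\<sigma> c) (T p)"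
    by (simp add: c T_scale)
  finally show ?thesis
    by (auto simp: mem_span_single)
qed

text \<open>For fixed \<open>p\<close>, orthogonality to \<open>p\<close> and \<open>r p\<close>
  cannot show that an auxiliary \<open>s\<close> is nonfixed. A nonfixed \<open>z\<close> not
  orthogonal to \<open>p\<close> takes over: \<open>s\<close> is orthogonal to \<open>z\<close> but
  not to \<open>r z\<close>.\<close>

lemma r_T:
  assumes p: "isotropic p"
  shows "r p \<in> span {T p}"
proof (cases "fixed p")
  case False
  then show ?thesis
    using r_T_nonfixed p by blast
next
  case True
  obtain d where d: "r p = scale d p"
    using True by (auto simp: fixed_def mem_span_single)
  have "d \<noteq> 0"
    using d r_isotropic[OF p] isotropic_nonzero by fastforce
  have "T p \<in> span {p}"
  proof (rule ccontr)
    assume Tp: "T p \<notin> span {p}"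
    obtain z where z: "isotropic z" "\<not> fixed z" "h z p \<noteq> 0"
      using exists_nonfixed_nonperp p True by blast
    have Tpz: "T p \<notin> span {p, z}"
    proof
      assume "T p \<in> span {p, z}"
      then obtain a b where ab: "T p = scale a p + scale b z"
        by (auto simp: mem_span_pair)
      have "h (T p) p = 0"
        using T_alternating form_eq_0_sym by blast
      then have "b = 0"
        using z p isotropic_form unfolding ab by (simp add: form_simps)
      then show False
        using ab Tp by (auto simp: mem_span_single)
    qed
    have pz: "h p z \<noteq> 0"
      using z form_eq_0_sym by blast
    obtain s where s: "isotropic s" "h s p = 0" "h s z = 0" "h s (r z) \<noteq> 0" "h s (T p) \<noteq> 0"
      by (rule hyperbolic_perp_avoid[OF p z(1) pz nonfixed_notin_hyperbolic[OF p z] Tpz Tpz])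
    then have "\<not> fixed s"
      using nonfixedI z by blast
    then have "T s \<in> span {r s}"
      using r_T_nonfixed s span_single_sym r_isotropic isotropic_nonzero by blast
    moreover have "h (r s) (r p) = 0"
      using r_perp s p by blast
    ultimately have "h (T s) p = 0"
      using d \<open>d \<noteq> 0\<close> by (auto simp: mem_span_single form_simps)
    then have "h (T (T s)) (T p) = 0"
      by (simp add: T_form)
    then show False
      using s by (simp add: T_T)
  qed
  then have "p \<in> span {T p}"
    using span_single_sym T_isotropic p isotropic_nonzero by blast
  then show ?thesis
    using True span_single_trans unfolding fixed_def by blast
qed

end

section \<open>The fixed structure of the semilinear involution\<close>

text \<open>The form \<open>h x (T y)\<close> is bilinear and alternating. On fixed vectors it
  agrees with \<open>h\<close> and has skew values, so up to a skew scalar it is a symplectic form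
  over the fixed field of \<open>\<sigma>\<close>.\<close>

locale symplectic_conjugation = hermitian_form scale \<sigma> h
  for scale :: "'k::field \<Rightarrow> 'v::ab_group_add \<Rightarrow> 'v" and \<sigma> h +
  fixes T :: "'v \<Rightarrow> 'v"
  assumes T_add: "T (x + y) = T x + T y"
    and T_scale: "T (scale a x) = scale (\<sigma> a) (T x)"
    and T_T [simp]: "T (T x) = x"
    and T_form: "h (T x) (T y) = - \<sigma> (h x y)"
    and T_alternating: "h x (T x) = 0"
begin

section \<open>Descent to fixed vectors\<close>

lemma T_0 [simp]: "T 0 = 0"
  using T_scale[of 0 0] by simp

lemma T_eq_0_iff [simp]: "T x = 0 \<longleftrightarrow> x = 0"
  by (metis T_0 T_T)

lemma T_minus: "T (- x) = - T x"
  using T_add[of x "- x"] by (simp add: eq_neg_iff_add_eq_0 add.commute)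

lemma T_diff: "T (x - y) = T x - T y"
  using T_add[of x "- y"] by (simp add: T_minus)

lemma T_sum: "T (sum f A) = (\<Sum>x\<in>A. T (f x))"
  by (induction A rule: infinite_finite_induct) (simp_all add: T_add)

lemmas T_simps = T_add T_scale T_minus T_diff

lemma T_swap: "h (T x) y = - \<sigma> (h x (T y))"
  using T_form[of x "T y"] by simp

lemma T_skew: "h y (T x) = - h x (T y)"
  using T_swap[of x y] form_hermitian[of y "T x"] by (simp add: sigma_simps)

lemma fixed_form: "T x = x \<Longrightarrow> T y = y \<Longrightarrow> \<sigma> (h x y) = - h x y"
  by (metis T_form minus_minus)

lemma fixed_isotropic: "T x = x \<Longrightarrow> h x x = 0"
  using T_alternating[of x] by simp

lemma isotropic_T: "isotropic x \<Longrightarrow> isotropic (T x)"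
  by (simp add: isotropic_def T_form)

lemma fixed_trace: "T (scale a x + T (scale a x)) = scale a x + T (scale a x)"
  by (simp add: T_add)

lemma skew_generator: obtains \<kappa> where "\<sigma> \<kappa> \<noteq> \<kappa>"
  using sigma_nontrivial by blast

text \<open>If \<open>T v = c v\<close>, then \<open>b v + T (b v)\<close> is fixed and equals
  \<open>(b + \<sigma> b c) v\<close>. The choice \<open>b = 1\<close> gives a nonzero vector unless
  \<open>c = -1\<close>, when any \<open>b\<close> moved by \<open>\<sigma>\<close> does.\<close>

lemma hilbert_90:
  assumes v: "v \<noteq> 0" and Tv: "T v \<in> span {v}"
  obtains w where "w \<noteq> 0" "T w = w" "span {w} = span {v}"
proof -
  obtain c where c: "T v = scale c v"
    using Tv by (auto simp: mem_span_single)
  have tr: "scale b v + T (scale b v) = scale (b + \<sigma> b * c) v" for b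
    by (simp add: T_scale c scale_left_distrib)
  obtain b where b: "b + \<sigma> b * c \<noteq> 0"
  proof (cases "c = - 1")
    case True
    obtain b where "\<sigma> b \<noteq> b"
      by (rule skew_generator)
    then show thesis
      using that[of b] True by simp
  next
    case False
    then show thesis
      using that[of 1] by (simp add: add_eq_0_iff)
  qed
  let ?w = "scale b v + T (scale b v)"
  have "?w \<noteq> 0"
    using b v by (simp add: tr)
  moreover have "?w \<in> span {v}"
    by (auto simp: tr mem_span_single)
  ultimately show thesis
    using that[of ?w] fixed_trace span_single_eq by blast
qed

text \<open>The fixed vectors \<open>x + T x\<close> and \<open>k x + T (k x)\<close> give a linear
  system for \<open>x\<close> and \<open>T x\<close>, invertible because
  \<open>\<sigma> k \<noteq> k\<close>. Its solution has coefficients independent of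
  \<open>x\<close>.\<close>

lemma fixed_decompose:
  obtains \<alpha> a \<beta> b
    where "\<forall>x. x = scale \<alpha> (scale a x + T (scale a x)) + scale \<beta> (scale b x + T (scale b x))"
proof -
  obtain k where k: "\<sigma> k \<noteq> k"
    by (rule skew_generator)
  let ?d = "k - \<sigma> k"
  have "x = scale (- \<sigma> k / ?d) (scale 1 x + T (scale 1 x)) + scale (1 / ?d) (scale k x + T (scale k x))" for x
  proof -
    have "scale (- \<sigma> k / ?d) (scale 1 x + T (scale 1 x)) + scale (1 / ?d) (scale k x + T (scale k x))
      = scale (- \<sigma> k / ?d + k / ?d) x + scale (- \<sigma> k / ?d + \<sigma> k / ?d) (T x)"
      by (simp add: T_scale scale_right_distrib scale_left_distrib algebra_simps)
    also have "- \<sigma> k / ?d + k / ?d = 1"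
      using k by (simp flip: diff_divide_distrib)
    finally show ?thesis
      by simp
  qed
  then show thesis
    using that by blast
qed

text \<open>Galois descent for a quadratic extension, phrased as an inclusion test: a stable
  subspace is spanned by its fixed vectors, so only these have to be tested.\<close>

lemma stable_span_fixed:
  assumes U: "subspace U" and TU: "\<And>x. x \<in> U \<Longrightarrow> T x \<in> U"
    and W: "subspace W" "\<And>x. x \<in> U \<Longrightarrow> T x = x \<Longrightarrow> x \<in> W"
  shows "U \<subseteq> W"
proof
  fix x assume x: "x \<in> U"
  obtain \<alpha> a \<beta> b where dec:
    "\<forall>x. x = scale \<alpha> (scale a x + T (scale a x)) + scale \<beta> (scale b x + T (scale b x))"
    by (rule fixed_decompose)
  have "scale c x + T (scale c x) \<in> W" for c
    using x U TU by (intro W(2) fixed_trace) (simp add: subspace_add subspace_scale)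
  then have "scale \<alpha> (scale a x + T (scale a x)) + scale \<beta> (scale b x + T (scale b x)) \<in> W"
    using subspace_add[OF W(1) subspace_scale[OF W(1)] subspace_scale[OF W(1)]] by blast
  then show "x \<in> W"
    by (metis dec)
qed

lemma stable_perp:
  assumes "\<And>x. x \<in> U \<Longrightarrow> T x \<in> U" "x \<in> perp U"
  shows "T x \<in> perp U"
  using assms by (auto simp: perp_def T_swap)

section \<open>The geometry of fixed points\<close>

definition Q :: "'v set set" where
  "Q = {span {v} | v. v \<noteq> 0 \<and> T v = v}"

definition trace :: "'v set \<Rightarrow> 'v set set" where
  "trace U = {p \<in> Q. p \<subseteq> U}"

definition \<Delta> :: "'v set geometry" where
  "\<Delta> = induced \<Gamma> Q"

lemma mem_Q: "p \<in> Q \<longleftrightarrow> (\<exists>v. v \<noteq> 0 \<and> T v = v \<and> p = span {v})"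
  by (auto simp: Q_def)

lemma fixed_is_isotropic: "v \<noteq> 0 \<Longrightarrow> T v = v \<Longrightarrow> isotropic v"
  using fixed_isotropic by (simp add: isotropic_def)

lemma Q_points: "Q \<subseteq> points \<Gamma>"
  unfolding subset_iff mem_Q mem_points using fixed_is_isotropic by blast

lemma trace_eq: "trace U = proj_points U \<inter> Q"
  using point_iff by (auto simp: trace_def proj_points_def mem_Q)

lemma points_Delta [simp]: "points \<Delta> = Q"
  by (simp add: \<Delta>_def induced_def)

lemma mem_trace:
  assumes "subspace U"
  shows "p \<in> trace U \<longleftrightarrow> (\<exists>v. v \<noteq> 0 \<and> T v = v \<and> v \<in> U \<and> p = span {v})"
  using span_singleton_subset_iff[OF assms] by (auto simp: trace_def mem_Q)

lemma lines_Delta: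
  "l \<in> lines \<Delta> \<longleftrightarrow> (\<exists>v w. v \<noteq> 0 \<and> w \<noteq> 0 \<and> T v = v \<and> T w = w \<and> h v w = 0 \<and> w \<notin> span {v} \<and>
    l = trace (span {v, w}))"
proof
  assume "l \<in> lines \<Delta>"
  then obtain m x y where m: "m \<in> lines \<Gamma>" "l = m \<inter> Q" "x \<in> m" "x \<in> Q" "y \<in> m" "y \<in> Q" "x \<noteq> y"
    by (auto simp: \<Delta>_def induced_def)
  then obtain v w where vw: "v \<noteq> 0" "T v = v" "x = span {v}" "w \<noteq> 0" "T w = w" "y = span {w}"
    using mem_Q by metis
  then have ind: "w \<notin> span {v}"
    using m span_single_eq by blast
  then have "m = proj_points (span {v, w})"
    using line_eq[of m v w] m vw by blast
  then have "l = trace (span {v, w})"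
    using m(2) by (simp add: trace_eq)
  moreover have "coll \<Gamma> x y"
    using m Q_points unfolding coll_def by blast
  then have "h v w = 0"
    using coll_iff fixed_is_isotropic vw by blast
  ultimately show "\<exists>v w. v \<noteq> 0 \<and> w \<noteq> 0 \<and> T v = v \<and> T w = w \<and> h v w = 0 \<and> w \<notin> span {v} \<and>
    l = trace (span {v, w})"
    using vw ind by blast
next
  assume "\<exists>v w. v \<noteq> 0 \<and> w \<noteq> 0 \<and> T v = v \<and> T w = w \<and> h v w = 0 \<and> w \<notin> span {v} \<and>
    l = trace (span {v, w})"
  then obtain v w where vw: "v \<noteq> 0" "w \<noteq> 0" "T v = v" "T w = w" "h v w = 0" "w \<notin> span {v}"
    "l = trace (span {v, w})"
    by blast
  let ?m = "proj_points (span {v, w})"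
  have "?m \<in> lines \<Gamma>"
    using vw fixed_is_isotropic mem_lines by blast
  moreover have "l = ?m \<inter> Q"
    using vw(7) by (simp add: trace_eq)
  moreover have "span {v} \<in> ?m \<inter> Q" "span {w} \<in> ?m \<inter> Q"
    using vw by (auto simp: mem_Q span_in_proj_points span_base)
  moreover have "span {v} \<noteq> span {w}"
    using vw span_base[of w "{w}"] by auto
  ultimately show "l \<in> lines \<Delta>"
    by (auto simp: \<Delta>_def induced_def)
qed

lemma coll_Delta_iff:
  assumes v: "v \<noteq> 0" "T v = v" and w: "w \<noteq> 0" "T w = w"
  shows "coll \<Delta> (span {v}) (span {w}) \<longleftrightarrow> h v w = 0"
proof
  assume "coll \<Delta> (span {v}) (span {w})"
  then have "coll \<Gamma> (span {v}) (span {w})"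
    using Q_points unfolding coll_def \<Delta>_def induced_def by auto
  then show "h v w = 0"
    using coll_iff fixed_is_isotropic assms by blast
next
  assume vw: "h v w = 0"
  have Q: "span {v} \<in> Q" "span {w} \<in> Q"
    using assms mem_Q by blast+
  show "coll \<Delta> (span {v}) (span {w})"
  proof (cases "w \<in> span {v}")
    case True
    then show ?thesis
      using Q span_single_eq[OF True w(1)] by (simp add: coll_def)
  next
    case False
    then have "trace (span {v, w}) \<in> lines \<Delta>"
      using assms vw lines_Delta by blast
    moreover have "span {v} \<in> trace (span {v, w})" "span {w} \<in> trace (span {v, w})"
      using Q by (auto simp: trace_def span_singleton_subset_iff[OF subspace_span] span_base)
    ultimately show ?thesis
      using Q unfolding coll_def by auto
  qed
qed

lemma geom_subspace_Delta_line:
  assumes C: "geom_subspace \<Delta> C" and v: "v \<noteq> 0" "T v = v" "span {v} \<in> C"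
    and w: "w \<noteq> 0" "T w = w" "span {w} \<in> C" and vw: "h v w = 0"
    and u: "u \<in> span {v, w}" "T u = u" "u \<noteq> 0"
  shows "span {u} \<in> C"
proof (cases "w \<in> span {v}")
  case True
  then have "span {v, w} = span {v}"
    using span_redundant[of w "{v}"] by (simp add: insert_commute)
  then show ?thesis
    using u v span_single_eq by metis
next
  case False
  let ?l = "trace (span {v, w})"
  have l: "?l \<in> lines \<Delta>"
    using False v w vw lines_Delta by blast
  have mem: "span {x} \<in> ?l" if "x \<in> span {v, w}" "T x = x" "x \<noteq> 0" for x
    using that mem_trace[OF subspace_span] by blast
  have "span {v} \<in> ?l \<inter> C" "span {w} \<in> ?l \<inter> C" "span {v} \<noteq> span {w}"
    using v w False mem span_base[of w "{w}"] by (auto simp: span_base)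
  then have "?l \<subseteq> C"
    using C l unfolding geom_subspace_def by blast
  then show ?thesis
    using mem u by blast
qed

text \<open>A fixed vector in the span over the big field is already reached from \<open>C\<close>
  along lines of the fixed geometry. The partial sums need not be fixed, so the induction is run on
  all their traces \<open>a y + T (a y)\<close>.\<close>

lemma geom_subspace_Delta_span:
  assumes C: "geom_subspace \<Delta> C"
    and perp: "\<And>x y. x \<in> \<Union>C \<Longrightarrow> y \<in> \<Union>C \<Longrightarrow> h x y = 0"
    and y: "y \<in> span (\<Union>C)" "T y = y" "y \<noteq> 0"
  shows "span {y} \<in> C"
proof -
  define V where "V = {v. T v = v \<and> (v = 0 \<or> span {v} \<in> C)}"
  have V_mem: "x \<in> \<Union>C \<union> {0}" if "x \<in> V" for x
    using that span_base[of x "{x}"] by (auto simp: V_def)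
  have V_add: "x + y \<in> V" if "x \<in> V" "y \<in> V" for x y
  proof (cases "x = 0 \<or> y = 0 \<or> x + y = 0")
    case True
    then show ?thesis
      using that by (auto simp: V_def)
  next
    case False
    have "x + y \<in> span {x, y}" "T (x + y) = x + y"
      using that by (simp_all add: V_def T_add span_add span_base)
    then have "span {x + y} \<in> C"
      using that False V_mem[of x] V_mem[of y] perp geom_subspace_Delta_line[OF C, of x y "x + y"]
      by (auto simp: V_def)
    then show ?thesis
      using \<open>T (x + y) = x + y\<close> by (simp add: V_def)
  qed
  have "\<forall>a. scale a y + T (scale a y) \<in> V" if "y \<in> span (\<Union>C)" for y
    using that
  proof (induction rule: span_induct_alt)
    case base
    then show ?case
      by (simp add: V_def)
  next
    case (step c x y)
    obtain p where p: "p \<in> C" "x \<in> p"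
      using step by blast
    then have "p \<in> Q"
      using C by (auto simp: geom_subspace_def)
    then obtain v where v: "v \<noteq> 0" "T v = v" "p = span {v}"
      by (auto simp: mem_Q)
    then obtain d where d: "x = scale d v"
      using p by (auto simp: mem_span_single)
    show ?case
    proof
      fix a
      let ?x = "scale (a * c * d + \<sigma> (a * c * d)) v"
      have "T ?x = ?x"
        using v by (simp add: T_scale sigma_simps add.commute)
      moreover have "?x = 0 \<or> span {?x} = span {v}"
        using v by (cases "a * c * d + \<sigma> (a * c * d) = 0") (auto intro!: span_single_eq simp: mem_span_single)
      ultimately have "?x \<in> V"
        using p v by (auto simp: V_def)
      then have "?x + (scale a y + T (scale a y)) \<in> V"
        using V_add step by blast
      moreover have "?x + (scale a y + T (scale a y)) =
          scale a (scale c x + y) + T (scale a (scale c x + y))"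
        using v by (simp add: d T_simps scale_right_distrib scale_left_distrib sigma_simps algebra_simps)
      ultimately show "scale a (scale c x + y) + T (scale a (scale c x + y)) \<in> V"
        by simp
    qed
  qed
  \<comment> \<open>For fixed \<open>y\<close> and \<open>a\<close> of trace 1, the trace of
    \<open>a y\<close> is \<open>y\<close> itself.\<close>
  moreover obtain a where a: "a + \<sigma> a = 1"
    using trace_surj[of 1] by auto
  ultimately have "scale a y + T (scale a y) \<in> V"
    using y by blast
  moreover have "scale a y + T (scale a y) = y"
    using a y by (simp add: T_scale flip: scale_left_distrib)
  ultimately show ?thesis
    using y by (simp add: V_def)
qed

lemma geom_subspace_trace:
  assumes U: "subspace U"
  shows "geom_subspace \<Delta> (trace U)"
  unfolding geom_subspace_def
proof (intro conjI ballI impI)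
  show "trace U \<subseteq> points \<Delta>"
    by (auto simp: trace_def)
  fix l assume l: "l \<in> lines \<Delta>" "\<exists>x\<in>l \<inter> trace U. \<exists>y\<in>l \<inter> trace U. x \<noteq> y"
  obtain v w where vw: "l = trace (span {v, w})"
    using l lines_Delta by blast
  obtain x y where xy: "x \<in> l" "y \<in> l" "x \<in> trace U" "y \<in> trace U" "x \<noteq> y"
    using l by blast
  obtain v' where v': "v' \<noteq> 0" "x = span {v'}" "v' \<in> U"
    using xy(3) mem_trace[OF U] by blast
  obtain w' where w': "w' \<noteq> 0" "y = span {w'}" "w' \<in> U"
    using xy(4) mem_trace[OF U] by blast
  have "v' \<in> span {v, w}" "w' \<in> span {v, w}"
    using xy(1,2) vw v' w' by (auto simp: trace_def span_singleton_subset_iff[OF subspace_span])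
  moreover have "w' \<notin> span {v'}"
    using xy(5) v' w' span_single_eq by blast
  ultimately have "span {v', w'} = span {v, w}"
    using span_pair_eq v' by blast
  moreover have "span {v', w'} \<subseteq> U"
    using v' w' U by (intro span_minimal) auto
  ultimately show "l \<subseteq> trace U"
    using vw by (auto simp: trace_def)
qed

definition stable :: "'v set \<Rightarrow> bool" where
  "stable U \<longleftrightarrow> totally_isotropic U \<and> (\<forall>x\<in>U. T x \<in> U)"

lemma stable_subspace: "stable U \<Longrightarrow> subspace U"
  by (simp add: stable_def totally_isotropic_def)

lemma span_Union_trace:
  assumes "stable U"
  shows "span (\<Union>(trace U)) = U"
proof
  show "span (\<Union>(trace U)) \<subseteq> U"
    using stable_subspace[OF assms] by (intro span_minimal) (auto simp: trace_def)
  show "U \<subseteq> span (\<Union>(trace U))"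
  proof (rule stable_span_fixed)
    fix x assume x: "x \<in> U" "T x = x"
    show "x \<in> span (\<Union>(trace U))"
    proof (cases "x = 0")
      case False
      then have "span {x} \<in> trace U"
        using x mem_trace[OF stable_subspace[OF assms]] by blast
      then show ?thesis
        using span_base[of x "{x}"] by (intro span_base) auto
    qed (simp add: span_zero)
  qed (use assms stable_subspace in \<open>auto simp: stable_def\<close>)
qed

lemma singular_trace:
  assumes "stable U"
  shows "singular \<Delta> (trace U)"
  unfolding singular_def
proof (intro conjI ballI)
  show "geom_subspace \<Delta> (trace U)"
    using geom_subspace_trace stable_subspace assms by blast
  fix x y assume "x \<in> trace U" "y \<in> trace U"
  then obtain v w where vw: "v \<noteq> 0" "T v = v" "v \<in> U" "x = span {v}"
    "w \<noteq> 0" "T w = w" "w \<in> U" "y = span {w}"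
    using mem_trace[OF stable_subspace[OF assms]] by metis
  then have "h v w = 0"
    using assms by (simp add: stable_def totally_isotropic_def)
  then show "coll \<Delta> x y"
    using coll_Delta_iff vw by blast
qed

lemma singular_Delta_perp:
  assumes Y: "singular \<Delta> Y" and xy: "x \<in> \<Union>Y" "y \<in> \<Union>Y"
  shows "h x y = 0"
proof -
  obtain p q where pq: "p \<in> Y" "x \<in> p" "q \<in> Y" "y \<in> q"
    using xy by blast
  have "Y \<subseteq> Q"
    using Y by (auto simp: singular_def geom_subspace_def)
  then obtain v w where vw: "v \<noteq> 0" "T v = v" "p = span {v}" "w \<noteq> 0" "T w = w" "q = span {w}"
    using pq mem_Q by (metis subsetD)
  moreover have "coll \<Delta> p q"
    using Y pq by (simp add: singular_def)
  ultimately have "h v w = 0"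
    using coll_Delta_iff by blast
  then show ?thesis
    using pq vw by (auto simp: mem_span_single form_simps)
qed

text \<open>With \<open>singular_trace\<close> this identifies singular subspaces of the fixed
  geometry with stable totally isotropic subspaces over the big field, where dimension and
  maximality are then computed.\<close>

lemma singular_Delta_imp:
  assumes Y: "singular \<Delta> Y"
  shows "stable (span (\<Union>Y))" "Y = trace (span (\<Union>Y))"
proof -
  have Q: "Y \<subseteq> Q"
    using Y by (auto simp: singular_def geom_subspace_def)
  have "T x \<in> span (\<Union>Y)" if "x \<in> span (\<Union>Y)" for x
    using that
  proof (induction rule: span_induct_alt)
    case base
    then show ?case
      by (simp add: span_zero)
  next
    case (step c x y)
    then obtain p where p: "p \<in> Y" "x \<in> p"
      by blast
    then obtain v where "T v = v" "p = span {v}"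
      using Q mem_Q by blast
    then have "T x \<in> p"
      using p by (auto simp: mem_span_single T_scale)
    then have "T x \<in> span (\<Union>Y)"
      using p by (intro span_base) auto
    then show ?case
      using step by (simp add: T_simps span_add span_scale)
  qed
  then show "stable (span (\<Union>Y))"
    using totally_isotropic_span[of "\<Union>Y"] singular_Delta_perp[OF Y] by (simp add: stable_def)
  show "Y = trace (span (\<Union>Y))"
  proof
    show "Y \<subseteq> trace (span (\<Union>Y))"
      using Q span_superset[of "\<Union>Y"] by (auto simp: trace_def)
    show "trace (span (\<Union>Y)) \<subseteq> Y"
      using geom_subspace_Delta_span[of Y] singular_Delta_perp[OF Y] Y
      by (auto simp: mem_trace[OF subspace_span] singular_def)
  qed
qed

lemma has_pdim_trace:
  assumes U: "stable U"
  shows "has_pdim \<Delta> (trace U) d \<longleftrightarrow> fdim U (Suc d)"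
proof -
  have "has_pdim \<Delta> (trace U) d \<longleftrightarrow> fdim (span (\<Union>(trace U))) (Suc d)"
  proof (rule has_pdim_iff)
    fix C assume C: "geom_subspace \<Delta> C" "C \<subseteq> trace U"
    have "h x y = 0" if "x \<in> \<Union>C" "y \<in> \<Union>C" for x y
      using that C(2) singular_Delta_perp[OF singular_trace[OF U], of x y] by blast
    then show "{x \<in> trace U. x \<subseteq> span (\<Union>C)} \<subseteq> C"
      using geom_subspace_Delta_span[OF C(1)]
      by (auto simp: mem_trace[OF stable_subspace[OF U]] span_singleton_subset_iff[OF subspace_span])
  next
    fix W :: "'v set" assume W: "subspace W"
    have "{x \<in> trace U. x \<subseteq> W} = trace (U \<inter> W)"
      by (auto simp: trace_def)
    then show "geom_subspace \<Delta> {x \<in> trace U. x \<subseteq> W}"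
      using geom_subspace_trace stable_subspace[OF U] W subspace_inter by metis
  next
    fix x assume "x \<in> trace U"
    then show "\<exists>v. v \<noteq> 0 \<and> x = span {v}"
      using mem_trace[OF stable_subspace[OF U]] by blast
  qed
  then show ?thesis
    by (simp add: span_Union_trace U)
qed

lemma generated_trace:
  assumes "stable U"
  shows "generated \<Gamma> (trace U) = proj_points U"
proof -
  have "generated \<Gamma> (trace U) = proj_points (span (\<Union>(trace U)))"
    using Q_points singular_Delta_perp[OF singular_trace[OF assms]]
    by (intro generated_eq) (auto simp: trace_def)
  then show ?thesis
    by (simp add: span_Union_trace assms)
qed

lemma belongs_stable:
  assumes "stable U"
  shows "belongs_to \<Gamma> Q (proj_points U)"
  unfolding belongs_to_def
  using generated_trace[OF assms] singular_trace[OF assms] by (auto simp: \<Delta>_def)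

end

section \<open>The fixed geometry as an ideal Baer sub polar space\<close>

locale ranked_conjugation = symplectic_conjugation scale \<sigma> h T
  for scale :: "'k::field \<Rightarrow> 'v::ab_group_add \<Rightarrow> 'v" and \<sigma> h T +
  fixes n :: nat
  assumes rank: "has_rank \<Gamma> n"
begin

lemmas ti_extend = totally_isotropic_extend[OF rank]
lemmas ti_fdim = totally_isotropic_fdim[OF rank]

lemma n_positive: "1 \<le> n"
  using rank by (simp add: has_rank_def)

lemma ti_maximal:
  assumes "totally_isotropic U" "fdim U n" "totally_isotropic W" "U \<subseteq> W"
  shows "W = U"
proof -
  obtain j where j: "fdim W j" "j \<le> n"
    using ti_fdim assms(3) by blast
  obtain i where "fdim U i" "i \<le> j"
    using fdim_subset[OF j(1) fdim_subspace[OF assms(2)] assms(4)] by blast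
  then have "j = n"
    using fdim_unique[OF assms(2)] j(2) by fastforce
  then show ?thesis
    using fdim_eq assms j by blast
qed

text \<open>Maximality among fixed singular subspaces implies maximality in the whole space:
  \<open>perp U\<close> is stable, hence spanned by fixed vectors, and these are all isotropic, so
  each can be adjoined to \<open>U\<close> and already lies in it. The rank therefore does not
  drop.\<close>

lemma max_singular_trace_fdim:
  assumes Y: "max_singular \<Delta> Y"
  obtains U where "stable U" "fdim U n" "Y = trace U"
proof -
  define U where "U = span (\<Union>Y)"
  have U: "stable U" "Y = trace U"
    using Y singular_Delta_imp[of Y] by (auto simp: max_singular_def U_def)
  note sub = stable_subspace[OF U(1)]
  have ti: "totally_isotropic U"
    using U by (simp add: stable_def)
  have "perp U \<subseteq> U"
  proof (rule stable_span_fixed)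
    fix x assume x: "x \<in> perp U"
    show "T x \<in> perp U"
      using stable_perp x U(1) by (simp add: stable_def)
    assume Tx: "T x = x"
    let ?W = "span (insert x U)"
    have "h y z = 0" if "y \<in> insert x U" "z \<in> insert x U" for y z
      using that x fixed_isotropic[OF Tx] ti form_eq_0_sym
      unfolding perp_def totally_isotropic_def by blast
    then have "totally_isotropic ?W"
      by (rule totally_isotropic_span)
    moreover have "T y \<in> ?W" if y: "y \<in> ?W" for y
    proof -
      obtain c u where "u \<in> U" "y = u + scale c x"
        using y mem_span_insert[OF sub] by blast
      then have "T y = T u + scale (\<sigma> c) x" "T u \<in> U"
        using U(1) Tx by (simp_all add: T_simps stable_def)
      then show ?thesis
        using mem_span_insert[OF sub] by blast
    qed
    ultimately have W: "stable ?W"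
      by (simp add: stable_def)
    have UW: "U \<subseteq> ?W"
      using span_superset by blast
    then have "Y \<subseteq> trace ?W"
      using U(2) by (auto simp: trace_def)
    then have "trace ?W = trace U"
      using Y singular_trace[OF W] U(2) unfolding max_singular_def by blast
    then have "?W = U"
      using span_Union_trace[OF W] span_Union_trace[OF U(1)] by simp
    then show "x \<in> U"
      using span_base[of x "insert x U"] by simp
  qed (use sub subspace_perp in auto)
  obtain W where W: "totally_isotropic W" "U \<subseteq> W" "fdim W n"
    using ti_extend ti by blast
  then have "W \<subseteq> perp U"
    by (auto simp: perp_def totally_isotropic_def)
  then have "W = U"
    using W \<open>perp U \<subseteq> U\<close> by blast
  then show thesis
    using that U W by blast
qed

lemma max_singular_proj_points:
  assumes "totally_isotropic U" "fdim U n"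
  shows "max_singular \<Gamma> (proj_points U)"
  unfolding max_singular_def
proof (intro conjI allI impI)
  show "singular \<Gamma> (proj_points U)"
    using singular_proj_points assms by blast
  fix Y assume Y: "singular \<Gamma> Y \<and> proj_points U \<subseteq> Y"
  have "subspace U"
    using assms by (simp add: totally_isotropic_def)
  then have "U \<subseteq> span (\<Union>Y)"
    using span_Union_proj_points[of U] Y span_mono[of "\<Union>(proj_points U)" "\<Union>Y"] by auto
  then have "span (\<Union>Y) = U"
    using ti_maximal assms singular_imp Y by blast
  then show "Y = proj_points U"
    using singular_imp(2)[of Y] Y by simp
qed

lemma has_rank_Delta: "has_rank \<Delta> n"
  unfolding has_rank_def
proof (intro conjI allI impI)
  fix Y assume "max_singular \<Delta> Y"
  then obtain U where "stable U" "fdim U n" "Y = trace U"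
    by (rule max_singular_trace_fdim)
  then show "has_pdim \<Delta> Y (n - 1)"
    using has_pdim_trace[of U "n - 1"] n_positive by simp
qed (rule n_positive)

lemma polar_space_Delta: "polar_space_of_rank \<Delta> n"
  unfolding polar_space_of_rank_def
proof (intro conjI ballI)
  fix l assume "l \<in> lines \<Delta>"
  then obtain v w where vw: "v \<noteq> 0" "w \<noteq> 0" "T v = v" "T w = w" "h v w = 0" "w \<notin> span {v}"
    "l = trace (span {v, w})"
    using lines_Delta by blast
  show "l \<subseteq> points \<Delta>"
    using vw(7) by (auto simp: trace_def)
  have vw': "v + w \<notin> span {v}" "v + w \<notin> span {w}"
  proof -
    show "v + w \<notin> span {v}"
    proof
      assume "v + w \<in> span {v}"
      then have "(v + w) - v \<in> span {v}"
        by (rule span_diff) (simp add: span_base)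
      then show False
        using vw(6) by simp
    qed
    show "v + w \<notin> span {w}"
    proof
      assume "v + w \<in> span {w}"
      then have "(v + w) - w \<in> span {w}"
        by (rule span_diff) (simp add: span_base)
      then show False
        using vw(1,6) span_single_sym by simp
    qed
  qed
  then have "v + w \<noteq> 0"
    by (metis span_zero)
  have mem: "span {x} \<in> l" if "x \<in> span {v, w}" "T x = x" "x \<noteq> 0" for x
    using that vw(7) mem_trace[OF subspace_span] by blast
  have "span {v} \<in> l" "span {w} \<in> l" "span {v + w} \<in> l"
    using mem vw \<open>v + w \<noteq> 0\<close> by (simp_all add: span_base span_add T_add)
  moreover have "span {v} \<noteq> span {w}" "span {w} \<noteq> span {v + w}" "span {v} \<noteq> span {v + w}"
    using vw(6) vw' span_base[of w "{w}"] span_base[of "v + w" "{v + w}"] by auto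
  ultimately show "\<exists>x\<in>l. \<exists>y\<in>l. \<exists>z\<in>l. x \<noteq> y \<and> y \<noteq> z \<and> x \<noteq> z"
    by blast
next
  fix x assume "x \<in> points \<Delta>"
  then obtain v where v: "v \<noteq> 0" "T v = v" "x = span {v}"
    by (auto simp: mem_Q)
  \<comment> \<open>Fixed vectors span the space, so one of them lies outside this
    hyperplane.\<close>
  have "\<not> UNIV \<subseteq> perp {v}"
  proof
    assume "UNIV \<subseteq> perp {v}"
    then have "h v y = 0" for y
      using form_eq_0_sym[of v y] by (auto simp: perp_def)
    then show False
      using form_nondegenerate v by blast
  qed
  then obtain w where w: "T w = w" "w \<notin> perp {v}"
    using stable_span_fixed[OF subspace_UNIV _ subspace_perp, of "{v}"] by blast
  then have "h v w \<noteq> 0" "w \<noteq> 0"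
    using form_eq_0_sym[of w v] by (auto simp: perp_def)
  then show "\<exists>y\<in>points \<Delta>. \<not> coll \<Delta> x y"
    using coll_Delta_iff v w mem_Q by (intro bexI[of _ "span {w}"]) auto
next
  fix x l assume x: "x \<in> points \<Delta>" and l: "l \<in> lines \<Delta>"
  obtain u where u: "u \<noteq> 0" "T u = u" "x = span {u}"
    using x by (auto simp: mem_Q)
  obtain v w where vw: "v \<noteq> 0" "w \<noteq> 0" "T v = v" "T w = w" "h v w = 0" "w \<notin> span {v}"
    and lvw: "l = trace (span {v, w})"
    using l lines_Delta by blast
  have mem: "y \<in> l \<longleftrightarrow> (\<exists>z. z \<noteq> 0 \<and> T z = z \<and> z \<in> span {v, w} \<and> y = span {z})" for y
    using lvw mem_trace[OF subspace_span] by blast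
  show "(\<forall>y\<in>l. coll \<Delta> x y) \<or> (\<exists>!y. y \<in> l \<and> coll \<Delta> x y)"
  proof (cases "h u v = 0 \<and> h u w = 0")
    case True
    then have "u \<in> perp {v, w}"
      by (simp add: perp_def)
    then have "h u z = 0" if "z \<in> span {v, w}" for z
      using perp_span that by blast
    then have "coll \<Delta> x y" if "y \<in> l" for y
      using that mem u coll_Delta_iff by metis
    then show ?thesis
      by blast
  next
    case False
    \<comment> \<open>Spans the point of the line orthogonal to \<open>u\<close>. Products of fixed
      vectors are skew under \<open>\<sigma>\<close>, so \<open>T z = - z\<close>: the point is
      fixed even where the vector is not.\<close>
    define z where "z = scale (h u w) v - scale (h u v) w"
    have ind: "a = 0 \<and> b = 0" if "scale a v + scale b w = 0" for a b
    proof -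
      have "b = 0"
      proof (rule ccontr)
        assume "b \<noteq> 0"
        have "w = scale (inverse b) (scale a v + scale b w) - scale (inverse b * a) v"
          using \<open>b \<noteq> 0\<close> by (simp add: scale_right_distrib)
        then have "w = scale (- (inverse b * a)) v"
          using that by simp
        then show False
          using vw(6) mem_span_single by blast
      qed
      then show ?thesis
        using that vw by simp
    qed
    have uw: "\<sigma> (h u w) = - h u w" "\<sigma> (h u v) = - h u v"
      using fixed_form u vw by blast+
    have z0: "z \<noteq> 0"
      using ind[of "h u w" "- h u v"] False by (auto simp: z_def)
    have zs: "z \<in> span {v, w}"
      by (simp add: z_def span_diff span_scale span_base)
    have "T z = - z"
      using uw vw by (simp add: z_def T_simps)
    then have "T z \<in> span {z}"
      by (simp add: span_neg span_base)
    then obtain y where y: "y \<noteq> 0" "T y = y" "span {y} = span {z}"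
      using hilbert_90 z0 by blast
    then have yz: "y \<in> span {z}"
      using span_base[of y "{y}"] by auto
    have huz: "h u z = 0"
      using uw by (simp add: z_def form_simps)
    then have huy: "h u y = 0"
      using yz by (auto simp: mem_span_single form_simps)
    have ys: "y \<in> span {v, w}"
      using yz zs span_singleton_subset_iff[OF subspace_span] by blast
    show ?thesis
    proof (intro disjI2 ex1I conjI)
      show "span {y} \<in> l"
        using mem y ys by blast
      show "coll \<Delta> x (span {y})"
        using coll_Delta_iff u y huy by blast
      fix y' assume y': "y' \<in> l \<and> coll \<Delta> x y'"
      then obtain q where q: "q \<noteq> 0" "T q = q" "q \<in> span {v, w}" "y' = span {q}"
        using mem by blast
      then have huq: "h u q = 0"
        using y' u coll_Delta_iff by blast
      obtain a b where ab: "q = scale a v + scale b w"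
        using q(3) mem_span_pair by blast
      have eq: "\<sigma> a * h u v + \<sigma> b * h u w = 0"
        using huq by (simp add: ab form_simps)
      moreover have "\<sigma> (\<sigma> a * h u v + \<sigma> b * h u w) = - (a * h u v + b * h u w)"
        using uw by (simp add: sigma_simps algebra_simps)
      ultimately have eq': "a * h u v + b * h u w = 0"
        by (metis neg_equal_0_iff_equal sigma_0)
      have "q \<in> span {z}"
      proof (cases "h u w = 0")
        case True
        then have "a = 0"
          using False eq' by simp
        then have "q = scale (- b / h u v) z"
          using True False by (simp add: ab z_def)
        then show ?thesis
          using mem_span_single by blast
      next
        case nz: False
        then have "b = - (a / h u w) * h u v"
          using eq' by (simp add: field_simps add_eq_0_iff2)
        then have "q = scale (a / h u w) z"
          using nz by (simp add: ab z_def scale_right_diff_distrib)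
        then show ?thesis
          using mem_span_single by blast
      qed
      then show "y' = span {y}"
        using span_single_eq q y by metis
    qed
  qed
qed (rule has_rank_Delta)

lemma sub_polar_space_Q: "sub_polar_space \<Gamma> n Q"
  using Q_points polar_space_Delta by (simp add: sub_polar_space_def \<Delta>_def)

text \<open>Any \<open>k\<close> moved by \<open>\<sigma>\<close> forms a basis together with
  \<open>1\<close>: applying \<open>\<sigma>\<close> to \<open>x = a + b k\<close> forces
  \<open>b = (x - \<sigma> x) / (k - \<sigma> k)\<close>.\<close>

lemma subfield_fixed: "subfield_index_two {a. \<sigma> a = a}"
proof -
  obtain k where k: "\<sigma> k \<noteq> k"
    by (rule skew_generator)
  have "\<exists>!p. p \<in> {a. \<sigma> a = a} \<times> {a. \<sigma> a = a} \<and> x = fst p * 1 + snd p * k" for x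
  proof (rule ex1I)
    define b where "b = (x - \<sigma> x) / (k - \<sigma> k)"
    have b: "\<sigma> b = b"
      using k by (simp add: b_def sigma_simps field_simps)
    have "b * (k - \<sigma> k) = x - \<sigma> x"
      using k by (simp add: b_def)
    then have "\<sigma> x - b * \<sigma> k = x - b * k"
      by (simp add: algebra_simps)
    then have "\<sigma> (x - b * k) = x - b * k"
      using b by (simp add: sigma_diff sigma_mult)
    then show "(x - b * k, b) \<in> {a. \<sigma> a = a} \<times> {a. \<sigma> a = a} \<and>
        x = fst (x - b * k, b) * 1 + snd (x - b * k, b) * k"
      using b by simp
    fix p assume p: "p \<in> {a. \<sigma> a = a} \<times> {a. \<sigma> a = a} \<and> x = fst p * 1 + snd p * k"
    then have "x - \<sigma> x = snd p * (k - \<sigma> k)"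
      by (auto simp: sigma_simps algebra_simps)
    then have "snd p = b"
      using k by (simp add: b_def)
    then show "p = (x - b * k, b)"
      using p by (cases p) simp
  qed
  then have "\<exists>e f. \<forall>x. \<exists>!p. p \<in> {a. \<sigma> a = a} \<times> {a. \<sigma> a = a} \<and> x = fst p * e + snd p * f"
    by blast
  then show ?thesis
    unfolding subfield_index_two_def by (simp add: sigma_simps)
qed

text \<open>By descent, a maximal independent set of fixed vectors of \<open>U\<close> is a basis of
  \<open>U\<close>. In its coordinates \<open>T\<close> acts as \<open>\<sigma>\<close>, so fixed
  vectors are exactly those with coordinates in the fixed field.\<close>

lemma baer_trace:
  assumes U: "stable U" "fdim U n"
  shows "baer_subspace (trace U) (proj_points U)"
proof -
  let ?F = "{a. \<sigma> a = a}"
  note sub = stable_subspace[OF U(1)]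
  let ?V = "{x \<in> U. T x = x}"
  obtain B where B: "B \<subseteq> ?V" "independent B" "?V \<subseteq> span B"
    using maximal_independent_subset[of ?V] by blast
  have BU: "B \<subseteq> U"
    using B by blast
  have fin: "finite B"
    using fdim_bound[OF U(2) B(2) BU] by blast
  have "U \<subseteq> span B"
  proof (rule stable_span_fixed)
    show "T x \<in> U" if "x \<in> U" for x
      using U(1) that by (simp add: stable_def)
    show "x \<in> span B" if "x \<in> U" "T x = x" for x
      using that B by blast
  qed (use sub in auto)
  then have span: "span B = U"
    using span_minimal[OF BU sub] by blast
  have TB: "T b = b" if "b \<in> B" for b
    using that B by blast
  have T_comb: "T (\<Sum>b\<in>B. scale (c b) b) = (\<Sum>b\<in>B. scale (\<sigma> (c b)) b)" for c
    by (simp add: T_sum T_scale TB)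
  have "trace U = {span {v} | v. v \<noteq> 0 \<and> (\<exists>c. (\<forall>b\<in>B. c b \<in> ?F) \<and> v = (\<Sum>b\<in>B. scale (c b) b))}"
  proof (intro set_eqI iffI)
    fix p assume "p \<in> trace U"
    then obtain v where v: "v \<noteq> 0" "T v = v" "v \<in> U" "p = span {v}"
      using mem_trace[OF sub] by blast
    then obtain c where c: "v = (\<Sum>b\<in>B. scale (c b) b)"
      using span span_finite[OF fin] by auto
    have "(\<Sum>b\<in>B. scale (\<sigma> (c b) - c b) b) = T v - v"
      unfolding c T_comb by (simp add: scale_left_diff_distrib sum_subtractf)
    then have "(\<Sum>b\<in>B. scale (\<sigma> (c b) - c b) b) = 0"
      using v by simp
    then have "\<sigma> (c b) - c b = 0" if "b \<in> B" for b
      by (rule independentD[OF B(2) fin subset_refl _ that, of "\<lambda>b. \<sigma> (c b) - c b"])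
    then have "\<forall>b\<in>B. c b \<in> ?F"
      by simp
    then show "p \<in> {span {v} | v. v \<noteq> 0 \<and> (\<exists>c. (\<forall>b\<in>B. c b \<in> ?F) \<and> v = (\<Sum>b\<in>B. scale (c b) b))}"
      using v c by blast
  next
    fix p assume "p \<in> {span {v} | v. v \<noteq> 0 \<and> (\<exists>c. (\<forall>b\<in>B. c b \<in> ?F) \<and> v = (\<Sum>b\<in>B. scale (c b) b))}"
    then obtain v c where v: "p = span {v}" "v \<noteq> 0" "\<forall>b\<in>B. \<sigma> (c b) = c b"
      "v = (\<Sum>b\<in>B. scale (c b) b)"
      by auto
    then have "T v = v"
      by (simp add: T_comb)
    moreover have "v \<in> U"
      using v(4) BU sub by (auto intro!: subspace_sum subspace_scale)
    ultimately show "p \<in> trace U"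
      using v mem_trace[OF sub] by blast
  qed
  then show ?thesis
    unfolding baer_subspace_def using subfield_fixed fin B(2) span by blast
qed

text \<open>The alternating form is what makes the sub polar space ideal. If \<open>W\<close> is
  spanned by \<open>U\<close> and \<open>v\<close>, then \<open>T v\<close> is isotropic and
  orthogonal to \<open>v\<close> and \<open>U\<close>, so it lies in \<open>W\<close> by
  maximality.\<close>

lemma ideal_extension:
  assumes U: "stable U" "fdim U (n - 1)" and W: "totally_isotropic W" "fdim W n" "U \<subseteq> W"
  shows "stable W"
  unfolding stable_def
proof (intro conjI ballI)
  note sub = stable_subspace[OF U(1)]
  have subW: "subspace W"
    using W by (simp add: totally_isotropic_def)
  fix v assume v: "v \<in> W"
  show "T v \<in> W"
  proof (cases "v \<in> U")
    case True
    then show ?thesis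
      using U W by (auto simp: stable_def)
  next
    case False
    let ?S = "span (insert v U)"
    have "fdim ?S n"
      using fdim_insert[OF U(2) False] n_positive by simp
    moreover have "?S \<subseteq> W"
      using v W subW by (intro span_minimal) auto
    ultimately have S: "?S = W"
      using fdim_eq W by blast
    let ?A = "insert (T v) (insert v U)"
    have TvU: "h (T v) u = 0" if "u \<in> U" for u
    proof -
      have "h v (T u) = 0"
        using that U(1) W v by (auto simp: stable_def totally_isotropic_def)
      then show ?thesis
        by (simp add: T_swap)
    qed
    have "h x y = 0" if "x \<in> insert v U" "y \<in> insert v U" for x y
      using that v W unfolding totally_isotropic_def by blast
    moreover have "h (T v) y = 0" if "y \<in> insert v U" for y
      using that TvU T_alternating[of v] form_eq_0_sym[of v "T v"] by auto
    moreover have "h (T v) (T v) = 0"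
      using v W by (simp add: T_form totally_isotropic_def)
    ultimately have "h x y = 0" if "x \<in> ?A" "y \<in> ?A" for x y
      using that form_eq_0_sym by (metis insertE)
    then have "totally_isotropic (span ?A)"
      by (rule totally_isotropic_span)
    moreover have "W \<subseteq> span ?A"
      using span_mono[of "insert v U" ?A] S by auto
    ultimately have "span ?A = W"
      using ti_maximal W by blast
    then show ?thesis
      using span_base[of "T v" ?A] by auto
  qed
qed (rule W(1))

lemma ideal_baer:
  assumes "2 \<le> n"
  shows "ideal_baer_sub_polar_space \<Gamma> n Q"
  unfolding ideal_baer_sub_polar_space_def
proof (intro conjI allI impI)
  fix Y assume "max_singular (induced \<Gamma> Q) Y"
  then obtain U where U: "stable U" "fdim U n" "Y = trace U"
    using max_singular_trace_fdim[of Y] by (auto simp: \<Delta>_def)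
  then have "max_singular \<Gamma> (proj_points U)"
    by (intro max_singular_proj_points) (auto simp: stable_def)
  then show "\<exists>X. max_singular \<Gamma> X \<and> baer_subspace Y X"
    using baer_trace U by blast
next
  fix S M
  assume "singular (induced \<Gamma> Q) S \<and> has_pdim (induced \<Gamma> Q) S (n - 2) \<and>
    max_singular \<Gamma> M \<and> S \<subseteq> M"
  then have S: "singular \<Delta> S" "has_pdim \<Delta> S (n - 2)" and M: "max_singular \<Gamma> M" "S \<subseteq> M"
    by (auto simp: \<Delta>_def)
  define U where "U = span (\<Union>S)"
  have U: "stable U" "S = trace U"
    using singular_Delta_imp S by (auto simp: U_def)
  then have dim: "fdim U (n - 1)"
  proof -
    \<comment> \<open>Projective dimension \<open>n - 2\<close> is linear dimension
      \<open>n - 1\<close>; the truncated subtraction is exact because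
      \<open>2 \<le> n\<close>.\<close>
    have "Suc (n - 2) = n - 1"
      using assms by simp
    then show ?thesis
      using S(2) has_pdim_trace[OF U(1), of "n - 2"] U(2) by simp
  qed
  obtain W where W: "totally_isotropic W" "M = proj_points W" "fdim W n"
    using max_singular_fdim[OF rank M(1)] by blast
  have "subspace W"
    using W by (simp add: totally_isotropic_def)
  then have "U \<subseteq> W"
    using M(2) unfolding W(2) U_def by (intro span_minimal) (auto simp: proj_points_def)
  then show "belongs_to \<Gamma> Q M"
    using belongs_stable ideal_extension U dim W by blast
qed (use rank sub_polar_space_Q in auto)

end

section \<open>The opposition diagram\<close>

context ranked_conjugation
begin

text \<open>Concerns the alternating form \<open>h u (T w)\<close>, not \<open>h\<close>, which
  vanishes on the totally isotropic subspaces to which this is applied.\<close>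

definition nondegenerate :: "'v set \<Rightarrow> bool" where
  "nondegenerate W \<longleftrightarrow> (\<forall>u\<in>W. u \<noteq> 0 \<longrightarrow> (\<exists>w\<in>W. h u (T w) \<noteq> 0))"

lemma fdim_nonzero:
  assumes "fdim U k" "0 < k"
  obtains u where "u \<in> U" "u \<noteq> 0"
proof (rule ccontr)
  assume "\<not> thesis"
  then have "U \<subseteq> {0}"
    using that by blast
  then have "U = {0}"
    using fdim_subspace[OF assms(1)] subspace_0 by blast
  then show False
    using fdim_unique[OF assms(1)] fdim_0 assms(2) by simp
qed

text \<open>Symplectic splitting: \<open>u\<close>, \<open>w\<close> with nonzero product span a
  hyperbolic plane of the alternating form, and the form stays nondegenerate on the complement
  \<open>U'\<close>, whose dimension is smaller by two.\<close>

lemma nondegenerate_even: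
  assumes "fdim U k" "nondegenerate U"
  shows "even k"
  using assms
proof (induction k arbitrary: U rule: less_induct)
  case (less k)
  show ?case
  proof (cases "k = 0")
    case False
    then obtain u where u: "u \<in> U" "u \<noteq> 0"
      using fdim_nonzero less.prems by blast
    then obtain w where w: "w \<in> U" "h u (T w) \<noteq> 0"
      using less.prems(2) by (auto simp: nondegenerate_def)
    then have wu: "h w (T u) \<noteq> 0"
      using T_skew[of w u] by simp
    note sub = fdim_subspace[OF less.prems(1)]
    define U' where "U' = U \<inter> perp {T u, T w}"
    have sub': "subspace U'"
      unfolding U'_def using sub subspace_perp by (rule subspace_inter)
    obtain j where j: "fdim U' j"
      using fdim_subset[OF less.prems(1) sub'] by (auto simp: U'_def)
    have w': "w \<notin> U'"
      using wu by (auto simp: U'_def perp_def)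
    have u': "u \<notin> span (insert w U')"
    proof
      assume "u \<in> span (insert w U')"
      then obtain c x where "x \<in> U'" "u = x + scale c w"
        using mem_span_insert[OF sub'] by blast
      then have "h u (T w) = 0"
        using T_alternating by (simp add: form_simps U'_def perp_def)
      then show False
        using w by simp
    qed
    let ?W = "span (insert u (span (insert w U')))"
    have W: "fdim ?W (Suc (Suc j))"
      using j w' u' fdim_insert by blast
    have decomp: "\<exists>x'\<in>U'. \<exists>a b. x = x' + scale b w + scale a u" if x: "x \<in> U" for x
    proof -
      let ?a = "h x (T w) / h u (T w)" and ?b = "h x (T u) / h w (T u)"
      let ?x = "x - scale ?b w - scale ?a u"
      have "?x \<in> U'"
        using x u w wu sub T_alternating
        by (simp add: U'_def perp_def form_simps subspace_diff subspace_scale)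
      moreover have "x = ?x + scale ?b w + scale ?a u"
        by simp
      ultimately show ?thesis
        by blast
    qed
    have "U \<subseteq> ?W"
    proof
      fix x assume "x \<in> U"
      then obtain x' a b where x': "x' \<in> U'" "x = x' + scale b w + scale a u"
        using decomp by blast
      then have "x' + scale b w \<in> span (insert w U')"
        using mem_span_insert[OF sub'] by blast
      then show "x \<in> ?W"
        using x'(2) mem_span_insert[OF subspace_span] by blast
    qed
    moreover have "?W \<subseteq> U"
      using u w sub by (intro span_minimal insert_subsetI) (auto simp: U'_def)
    ultimately have "k = Suc (Suc j)"
      using W less.prems(1) fdim_unique by (metis subset_antisym)
    moreover have "nondegenerate U'"
      unfolding nondegenerate_def
    proof (intro ballI impI)
      fix x assume x: "x \<in> U'" "x \<noteq> 0"
      then obtain y where y: "y \<in> U" "h x (T y) \<noteq> 0"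
        using less.prems(2) by (auto simp: nondegenerate_def U'_def)
      then obtain y' a b where y': "y' \<in> U'" "y = y' + scale b w + scale a u"
        using decomp by blast
      have "h x (T w) = 0" "h x (T u) = 0"
        using x by (simp_all add: U'_def perp_def)
      then have "h x (T y) = h x (T y')"
        by (simp add: y'(2) T_simps form_simps)
      then show "\<exists>w\<in>U'. h x (T w) \<noteq> 0"
        using y y' by auto
    qed
    ultimately show ?thesis
      using less.IH[of j U'] j by simp
  qed simp
qed

text \<open>If \<open>T\<close> stabilised every point of \<open>U\<close>, two distinct ones would
  be spanned by fixed \<open>f\<close>, \<open>g\<close>; but \<open>T\<close> moves the point of
  \<open>f + k g\<close> whenever \<open>\<sigma> k \<noteq> k\<close>.\<close>

lemma nonfixed_in_subspace:
  assumes U: "fdim U i" "2 \<le> i"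
  obtains a where "a \<in> U" "T a \<notin> span {a}"
proof (rule ccontr)
  assume "\<not> thesis"
  then have all: "T a \<in> span {a}" if "a \<in> U" for a
    using that \<open>\<And>a. \<lbrakk>a \<in> U; T a \<notin> span {a}\<rbrakk> \<Longrightarrow> thesis\<close> by blast
  note sub = fdim_subspace[OF U(1)]
  obtain v where v: "v \<in> U" "v \<noteq> 0"
    using fdim_nonzero[OF U(1)] U(2) by auto
  have one: "fdim (span {v}) 1"
    using fdim_insert[OF fdim_0, of v] v(2) by (simp add: insert_commute)
  have "span {v} \<subseteq> U"
    using v sub span_singleton_subset_iff by blast
  moreover have "U \<noteq> span {v}"
    using fdim_unique[OF U(1), of 1] one U(2) by auto
  ultimately obtain w where w: "w \<in> U" "w \<notin> span {v}"
    by blast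
  then have "w \<noteq> 0"
    using span_zero by metis
  obtain f where f: "f \<noteq> 0" "T f = f" "span {f} = span {v}"
    using hilbert_90[OF v(2) all[OF v(1)]] by blast
  obtain g where g: "g \<noteq> 0" "T g = g" "span {g} = span {w}"
    using hilbert_90[OF \<open>w \<noteq> 0\<close> all[OF w(1)]] by blast
  have fg: "f \<in> U" "g \<in> U"
    using f g v w sub span_singleton_subset_iff by blast+
  have ind: "f \<notin> span {g}"
  proof
    assume "f \<in> span {g}"
    then have "span {f} = span {g}"
      using f span_single_eq by blast
    then show False
      using f g w(2) span_base[of w "{w}"] by auto
  qed
  obtain k where k: "\<sigma> k \<noteq> k"
    by (rule skew_generator)
  have "f + scale k g \<in> U"
    using fg sub by (simp add: subspace_add subspace_scale)
  then obtain c where "T (f + scale k g) = scale c (f + scale k g)"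
    using all mem_span_single by blast
  then have "f + scale (\<sigma> k) g = scale c f + scale (c * k) g"
    using f g by (simp add: T_simps scale_right_distrib)
  then have eq: "scale (1 - c) f = scale (c * k - \<sigma> k) g"
    by (simp add: scale_left_diff_distrib algebra_simps)
  have "c = 1"
  proof (rule ccontr)
    assume c: "c \<noteq> 1"
    have "f = scale (inverse (1 - c)) (scale (1 - c) f)"
      using c by simp
    also have "\<dots> \<in> span {g}"
      unfolding eq by (intro span_scale span_base) simp
    finally show False
      using ind by blast
  qed
  then show False
    using eq k g by simp
qed

text \<open>Adds a hyperbolic plane of the alternating form. One generator \<open>a\<close> is taken
  in a maximal totally isotropic \<open>M\<close> containing \<open>W\<close>; the other,
  \<open>y\<close>, is constructed in the whole space. The projection property \<open>proj\<close>
  is carried through the induction as the means of splitting \<open>M\<close> and of correcting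
  vectors.\<close>

lemma nondegenerate_extend:
  assumes W: "totally_isotropic W" "fdim W m" "nondegenerate W"
    and proj: "\<And>x. \<exists>w\<in>W. \<forall>z\<in>W. h (x - w) (T z) = 0" and m: "m + 2 \<le> n"
  obtains V where "totally_isotropic V" "fdim V (Suc (Suc m))" "nondegenerate V"
    "\<And>x. \<exists>w\<in>V. \<forall>z\<in>V. h (x - w) (T z) = 0"
proof -
  obtain M where M: "totally_isotropic M" "W \<subseteq> M" "fdim M n"
    using ti_extend W(1) by blast
  define M' where "M' = M \<inter> perp (T ` W)"
  have subM: "subspace M" and subW: "subspace W"
    using M W by (simp_all add: totally_isotropic_def)
  have sub': "subspace M'"
    unfolding M'_def using subM subspace_perp by (rule subspace_inter)
  obtain i where i: "fdim M' i"
    using fdim_subset[OF M(3) sub'] by (auto simp: M'_def)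
  \<comment> \<open>Projection along \<open>W\<close> gives \<open>M = W + M'\<close>, so
    \<open>M'\<close> has dimension at least \<open>n - m\<close>.\<close>
  have "2 \<le> i"
  proof -
    obtain B where B: "finite B" "independent B" "span B = W" "card B = m"
      using W(2) by (auto simp: fdim_def)
    obtain C where C: "finite C" "independent C" "span C = M'" "card C = i"
      using i by (auto simp: fdim_def)
    obtain D where D: "finite D" "independent D" "span D = M" "card D = n"
      using M(3) by (auto simp: fdim_def)
    have "M \<subseteq> span (B \<union> C)"
    proof
      fix x assume x: "x \<in> M"
      obtain w where w: "w \<in> W" "\<forall>z\<in>W. h (x - w) (T z) = 0"
        using proj by blast
      then have "x - w \<in> M'"
        using x M(2) subM by (auto simp: M'_def perp_def subspace_diff)
      then have "w \<in> span (B \<union> C)" "x - w \<in> span (B \<union> C)"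
        using w B C span_mono[of B "B \<union> C"] span_mono[of C "B \<union> C"] by auto
      then have "w + (x - w) \<in> span (B \<union> C)"
        by (rule span_add)
      then show "x \<in> span (B \<union> C)"
        by simp
    qed
    then have "D \<subseteq> span (B \<union> C)"
      using D(3) span_superset by blast
    then have "card D \<le> card (B \<union> C)"
      using independent_span_bound[of "B \<union> C" D] B C D by simp
    also have "\<dots> \<le> m + i"
      using card_Un_le[of B C] B C by simp
    finally show ?thesis
      using D m by simp
  qed
  then obtain a where a: "a \<in> M'" "T a \<notin> span {a}"
    using nonfixed_in_subspace i by blast
  have aW: "h a w = 0" "h w a = 0" "h a (T w) = 0" "h (T a) w = 0" "h w (T a) = 0" "h (T w) a = 0"
    "h (T a) (T w) = 0" "h (T w) (T a) = 0" if "w \<in> W" for w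
  proof -
    show 1: "h a w = 0" and 2: "h a (T w) = 0"
      using a that M by (auto simp: M'_def perp_def totally_isotropic_def)
    then show "h (T a) w = 0" "h (T a) (T w) = 0"
      by (simp_all add: T_swap T_form)
    then show "h w (T a) = 0" "h (T w) (T a) = 0" "h w a = 0" "h (T w) a = 0"
      using 1 2 form_eq_0_sym by blast+
  qed
  have aa: "h a a = 0" "h (T a) (T a) = 0" "h (T a) a = 0"
    using a M T_alternating[of a] form_eq_0_sym[of a "T a"]
    by (auto simp: M'_def totally_isotropic_def T_form)
  \<comment> \<open>Such a \<open>q\<close> exists because \<open>T a\<close> lies outside
    \<open>span {a}\<close>, which is the double perpendicular of \<open>{a}\<close>.\<close>
  obtain q where q: "h q a = 0" "h q (T a) \<noteq> 0"
    using perp_perp[of "{a}" "T a"] a(2) by (auto simp: perp_def)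
  obtain w1 where w1: "w1 \<in> W" "\<forall>z\<in>W. h (q - w1) (T z) = 0"
    using proj by blast
  obtain w2 where w2: "w2 \<in> W" "\<forall>z\<in>W. h (T q - w2) (T z) = 0"
    using proj by blast
  have WW: "h x z = 0" "h (T x) (T z) = 0" if "x \<in> W" "z \<in> W" for x z
    using W(1) that by (simp_all add: totally_isotropic_def T_form)
  \<comment> \<open>Subtracting \<open>w1\<close> makes \<open>q\<close> orthogonal to
    \<open>T W\<close>, and subtracting \<open>T w2\<close> makes it orthogonal to \<open>W\<close>.
    The corrections do not interfere, since \<open>h\<close> vanishes on \<open>W\<close> and on
    \<open>T W\<close>, and they leave the products with \<open>a\<close> and \<open>T a\<close>
    alone.\<close>
  define p where "p = q - w1 - T w2"
  have pW: "h p z = 0" "h p (T z) = 0" if z: "z \<in> W" for z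
  proof -
    have "h (T (T q - w2)) (T (T z)) = 0"
      using w2 z by (subst T_form) simp
    then have "h (q - T w2) z = 0"
      by (simp add: T_diff)
    then show "h p z = 0"
      using WW(1)[OF w1(1) z] by (simp add: p_def form_simps)
    show "h p (T z) = 0"
      using w1 z WW(2)[OF w2(1) z] by (simp add: p_def form_simps)
  qed
  have pa: "h p a = 0" "h p (T a) \<noteq> 0"
    using q aW[OF w1(1)] aW[OF w2(1)] by (simp_all add: p_def form_simps)
  \<comment> \<open>\<open>T a\<close> is isotropic and orthogonal to \<open>a\<close>,
    \<open>W\<close> and \<open>T W\<close>, so a shift along it repairs isotropy and disturbs none
    of the products arranged so far.\<close>
  obtain c where c: "h (p + scale c (T a)) (p + scale c (T a)) = 0"
    using isotropic_adjust[of "T a" p] aa pa by blast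
  define y where "y = p + scale c (T a)"
  have yW: "h y z = 0" "h y (T z) = 0" if "z \<in> W" for z
    using pW[OF that] aW[OF that] by (simp_all add: y_def form_simps)
  have ya: "h y a = 0" "h y (T a) \<noteq> 0" "h y y = 0"
    using pa aa c by (simp_all add: y_def form_simps)
  have ay: "h a (T y) \<noteq> 0"
    using T_skew[of a y] ya by simp
  have Wy: "h z (T y) = 0" "h z y = 0" if "z \<in> W" for z
    using T_skew[of z y] yW[OF that] form_eq_0_sym[of z y] by simp_all
  let ?S = "insert y (insert a W)"
  define V where "V = span ?S"
  have V_eq: "V = span (insert y (span (insert a W)))"
    by (simp add: V_def span_insert_span)
  have mem_V: "x \<in> V \<longleftrightarrow> (\<exists>w\<in>W. \<exists>\<alpha> \<beta>. x = w + scale \<alpha> a + scale \<beta> y)" for x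
    unfolding V_eq mem_span_insert[OF subspace_span] Bex_def mem_span_insert[OF subW] by blast
  have aW': "a \<notin> W"
  proof
    assume "a \<in> W"
    moreover have "a \<noteq> 0"
      using a(2) span_zero by auto
    ultimately show False
      using W(3) aW(3) unfolding nondegenerate_def by blast
  qed
  have yaW: "y \<notin> span (insert a W)"
  proof
    assume "y \<in> span (insert a W)"
    then obtain \<alpha> w where "w \<in> W" "y = w + scale \<alpha> a"
      using mem_span_insert[OF subW] by blast
    then have "h y (T a) = 0"
      using aW T_alternating by (simp add: form_simps)
    then show False
      using ya by blast
  qed
  have "fdim V (Suc (Suc m))"
    unfolding V_eq using W(2) aW' yaW fdim_insert by blast
  moreover have "h x z = 0" if "x \<in> ?S" "z \<in> ?S" for x z
    using that aa ya WW aW yW Wy form_eq_0_sym[of a y] by auto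
  then have "totally_isotropic V"
    unfolding V_def by (rule totally_isotropic_span)
  moreover have "nondegenerate V"
    unfolding nondegenerate_def
  proof (intro ballI impI, rule ccontr)
    fix x assume x: "x \<in> V" "x \<noteq> 0" and nz: "\<not> (\<exists>z\<in>V. h x (T z) \<noteq> 0)"
    have 0: "h x (T z) = 0" if z: "z \<in> ?S" for z
    proof -
      have "z \<in> V"
        using z span_base[of z ?S] by (simp add: V_def)
      then show ?thesis
        using nz by blast
    qed
    obtain w \<alpha> \<beta> where x': "w \<in> W" "x = w + scale \<alpha> a + scale \<beta> y"
      using x(1) mem_V by blast
    have "\<beta> = 0"
      using 0[of a] aW[OF x'(1)] T_alternating[of a] ya by (simp add: x'(2) form_simps)
    moreover have "\<alpha> = 0"
      using 0[of y] Wy[OF x'(1)] T_alternating[of y] ay by (simp add: x'(2) form_simps)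
    ultimately have "x \<in> W"
      using x' by simp
    then obtain z where "z \<in> W" "h x (T z) \<noteq> 0"
      using W(3) x(2) unfolding nondegenerate_def by blast
    then show False
      using 0[of z] by simp
  qed
  moreover have "\<exists>w\<in>V. \<forall>z\<in>V. h (x - w) (T z) = 0" for x
  proof -
    obtain w where w: "w \<in> W" "\<forall>z\<in>W. h (x - w) (T z) = 0"
      using proj by blast
    \<comment> \<open>The projection to \<open>W\<close> is completed by the coordinates of
      \<open>x - w\<close> with respect to the hyperbolic pair \<open>a\<close>,
      \<open>y\<close>.\<close>
    let ?\<alpha> = "h (x - w) (T y) / h a (T y)" and ?\<beta> = "h (x - w) (T a) / h y (T a)"
    let ?v = "w + scale ?\<alpha> a + scale ?\<beta> y"
    have split: "x - ?v = (x - w) - scale ?\<alpha> a - scale ?\<beta> y"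
      by simp
    have "h (x - ?v) (T z) = 0" if "z \<in> W" for z
      unfolding split using w that aW[OF that] yW[OF that]
      by (simp only: form_diff_left form_scale) simp
    moreover have "h (x - ?v) (T a) = 0" "h (x - ?v) (T y) = 0"
      unfolding split using ya ay T_alternating
      by (simp_all only: form_diff_left[of _ "scale _ _"] form_scale) simp_all
    moreover have "?v \<in> V"
      using mem_V w by blast
    moreover have "h (x - ?v) (T z) = 0" if z: "z \<in> V"
      and "\<And>u. u \<in> W \<Longrightarrow> h (x - ?v) (T u) = 0" "h (x - ?v) (T a) = 0" "h (x - ?v) (T y) = 0" for z
    proof -
      obtain u \<alpha> \<beta> where "u \<in> W" "z = u + scale \<alpha> a + scale \<beta> y"
        using z mem_V by blast
      then show ?thesis
        using that(2-4) by (simp only: T_add T_scale form_add_right form_scale_right) simp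
    qed
    ultimately show ?thesis
      by blast
  qed
  ultimately show thesis
    using that by blast
qed

lemma nondegenerate_exists:
  assumes "2 * j \<le> n"
  shows "\<exists>W. totally_isotropic W \<and> fdim W (2 * j) \<and> nondegenerate W \<and>
    (\<forall>x. \<exists>w\<in>W. \<forall>z\<in>W. h (x - w) (T z) = 0)"
  using assms
proof (induction j)
  case 0
  have "totally_isotropic {0}"
    by (simp add: totally_isotropic_def subspace_single_0)
  then show ?case
    using fdim_0 by (intro exI[of _ "{0}"]) (simp add: nondegenerate_def)
next
  case (Suc j)
  then obtain W where W: "totally_isotropic W" "fdim W (2 * j)" "nondegenerate W"
    "\<And>x. \<exists>w\<in>W. \<forall>z\<in>W. h (x - w) (T z) = 0"
    by auto
  obtain V where "totally_isotropic V" "fdim V (Suc (Suc (2 * j)))" "nondegenerate V"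
    "\<And>x. \<exists>w\<in>V. \<forall>z\<in>V. h (x - w) (T z) = 0"
    using nondegenerate_extend[OF W] Suc.prems by auto
  then show ?case
    by (intro exI[of _ V]) simp
qed

section \<open>From the alternating form to opposition\<close>

lemma T_image:
  assumes "totally_isotropic U" "fdim U k"
  shows "totally_isotropic (T ` U)" "fdim (T ` U) k"
proof -
  have span_T: "span (T ` B) = T ` span B" for B
  proof
    have "subspace (T ` span B)"
      unfolding subspace_def
    proof (intro conjI ballI allI)
      show "0 \<in> T ` span B"
        using span_zero by (force simp: image_iff)
      fix x y c assume x: "x \<in> T ` span B"
      then obtain x' where x': "x' \<in> span B" "x = T x'"
        by blast
      then have "scale c x = T (scale (\<sigma> c) x')"
        by (simp add: T_scale sigma_invol)
      then show "scale c x \<in> T ` span B"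
        using x' span_scale by blast
      assume "y \<in> T ` span B"
      then obtain y' where y': "y' \<in> span B" "y = T y'"
        by blast
      then have "x + y = T (x' + y')"
        using x' by (simp add: T_add)
      then show "x + y \<in> T ` span B"
        using x' y' span_add by blast
    qed
    then show "span (T ` B) \<subseteq> T ` span B"
      using span_superset by (intro span_minimal) auto
    show "T ` span B \<subseteq> span (T ` B)"
    proof
      fix z assume "z \<in> T ` span B"
      then obtain x where x: "x \<in> span B" "z = T x"
        by blast
      from x(1) have "T x \<in> span (T ` B)"
        by (induction rule: span_induct_alt)
          (auto simp: T_simps span_zero intro!: span_add span_scale intro: span_base)
      then show "z \<in> span (T ` B)"
        using x by simp
    qed
  qed
  have inj: "inj T"
    by (metis T_T injI)
  obtain B where B: "finite B" "independent B" "span B = U" "card B = k"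
    using assms(2) by (auto simp: fdim_def)
  have "independent (T ` B)"
    unfolding dependent_def
  proof
    assume "\<exists>a\<in>T ` B. a \<in> span (T ` B - {a})"
    then obtain b where b: "b \<in> B" "T b \<in> span (T ` B - {T b})"
      by blast
    have "T ` B - {T b} = T ` (B - {b})"
      using inj by (auto simp: inj_def)
    then have "T b \<in> T ` span (B - {b})"
      using b span_T by simp
    then have "b \<in> span (B - {b})"
      using inj by (auto simp: inj_def)
    then show False
      using B b unfolding dependent_def by blast
  qed
  moreover have "card (T ` B) = k"
    using inj B card_image inj_on_subset by (metis subset_UNIV)
  ultimately show dim: "fdim (T ` U) k"
    unfolding fdim_def using B span_T by (intro exI[of _ "T ` B"]) simp
  show "totally_isotropic (T ` U)"
    using assms(1) fdim_subspace[OF dim] by (auto simp: totally_isotropic_def T_form)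
qed

context
  fixes \<theta>
  assumes theta: "\<And>v. isotropic v \<Longrightarrow> \<theta> (span {v}) = span {T v}"
begin

lemma theta_image:
  assumes U: "totally_isotropic U" "fdim U k"
  shows "\<theta> ` proj_points U = proj_points (T ` U)"
proof (intro set_eqI iffI)
  note sub = fdim_subspace[OF U(2)] fdim_subspace[OF T_image(2)[OF U]]
  fix p
  show "p \<in> proj_points (T ` U)" if p: "p \<in> \<theta> ` proj_points U"
  proof -
    obtain v where v: "v \<in> U" "v \<noteq> 0" "p = \<theta> (span {v})"
      using p unfolding proj_points_iff[OF sub(1)] image_iff Bex_def by blast
    then have "p = span {T v}"
      using theta totally_isotropic_isotropic[OF U(1)] by blast
    moreover have "T v \<noteq> 0"
      using v by simp
    ultimately show ?thesis
      using v(1) unfolding proj_points_iff[OF sub(2)] by blast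
  qed
  show "p \<in> \<theta> ` proj_points U" if p: "p \<in> proj_points (T ` U)"
  proof -
    obtain v where v: "v \<in> U" "T v \<noteq> 0" "p = span {T v}"
      using p unfolding proj_points_iff[OF sub(2)] by blast
    then have v0: "v \<noteq> 0"
      by auto
    then have "p = \<theta> (span {v})"
      using v theta totally_isotropic_isotropic[OF U(1)] by simp
    moreover have "span {v} \<in> proj_points U"
      using v v0 by (simp add: span_in_proj_points sub)
    ultimately show ?thesis
      by blast
  qed
qed

text \<open>The points of \<open>v\<close> and \<open>T w\<close> are opposite exactly if
  \<open>h v (T w) \<noteq> 0\<close>, and the dimensions agree because \<open>T\<close> preserves
  them; what remains is nondegeneracy of the alternating form on \<open>U\<close>.\<close>

lemma opposite_iff:
  assumes U: "totally_isotropic U" "fdim U (Suc d)"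
  shows "opposite_subspaces \<Gamma> (proj_points U) (\<theta> ` proj_points U) \<longleftrightarrow> nondegenerate U"
proof -
  note TU = T_image[OF U]
  note sub = fdim_subspace[OF U(2)] fdim_subspace[OF TU(2)]
  have iso: "isotropic v" "isotropic (T v)" if "v \<in> U" "v \<noteq> 0" for v
    using totally_isotropic_isotropic[OF U(1)] that isotropic_T by blast+
  have opp: "opposite_points \<Gamma> (span {v}) (span {T w}) \<longleftrightarrow> h v (T w) \<noteq> 0"
    if "v \<in> U" "v \<noteq> 0" "w \<in> U" "w \<noteq> 0" for v w
    using that iso coll_iff mem_points unfolding opposite_points_def by blast
  have "opposite_subspaces \<Gamma> (proj_points U) (proj_points (T ` U)) \<longleftrightarrow>
    (\<forall>x\<in>proj_points U. \<exists>y\<in>proj_points (T ` U). opposite_points \<Gamma> x y)"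
    using singular_proj_points[OF U(1)] singular_proj_points[OF TU(1)]
      has_pdim_proj_points[OF U(1), of d] has_pdim_proj_points[OF TU(1), of d] U TU
    by (auto simp: opposite_subspaces_def)
  also have "\<dots> \<longleftrightarrow> nondegenerate U"
  proof
    assume *: "\<forall>x\<in>proj_points U. \<exists>y\<in>proj_points (T ` U). opposite_points \<Gamma> x y"
    show "nondegenerate U"
      unfolding nondegenerate_def
    proof (intro ballI impI)
      fix u assume u: "u \<in> U" "u \<noteq> 0"
      then have "span {u} \<in> proj_points U"
        by (simp add: span_in_proj_points sub)
      then obtain y where y: "y \<in> proj_points (T ` U)" "opposite_points \<Gamma> (span {u}) y"
        using * by blast
      then obtain w where w: "w \<in> U" "T w \<noteq> 0" "y = span {T w}"
        unfolding proj_points_iff[OF sub(2)] by blast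
      then have "w \<noteq> 0"
        by auto
      then show "\<exists>w\<in>U. h u (T w) \<noteq> 0"
        using opp[OF u w(1)] w y by blast
    qed
  next
    assume nd: "nondegenerate U"
    show "\<forall>x\<in>proj_points U. \<exists>y\<in>proj_points (T ` U). opposite_points \<Gamma> x y"
    proof
      fix x assume "x \<in> proj_points U"
      then obtain v where v: "v \<in> U" "v \<noteq> 0" "x = span {v}"
        unfolding proj_points_iff[OF sub(1)] by blast
      then obtain w where w: "w \<in> U" "h v (T w) \<noteq> 0"
        using nd unfolding nondegenerate_def by blast
      then have "T w \<noteq> 0"
        by auto
      then have w0: "w \<noteq> 0" and "span {T w} \<in> proj_points (T ` U)"
        using w by (auto simp: span_in_proj_points sub)
      then show "\<exists>y\<in>proj_points (T ` U). opposite_points \<Gamma> x y"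
        using opp[OF v(1,2) w(1) w0] w v(3) by blast
    qed
  qed
  finally show ?thesis
    by (simp add: theta_image[OF U])
qed

text \<open>A nondegenerate alternating form forces even dimension, and hyperbolic planes can be
  added as long as the dimension stays at most \<open>n\<close>; hence the parameter
  \<open>n div 2\<close>.\<close>

lemma diagram: "diagram_B2 \<Gamma> n (n div 2) \<theta>"
  unfolding diagram_B2_def
proof
  fix k assume k: "k \<in> {1..n}"
  then have Suc: "Suc (k - 1) = k"
    by simp
  have "(\<exists>X. singular \<Gamma> X \<and> has_pdim \<Gamma> X (k - 1) \<and> opposite_subspaces \<Gamma> X (\<theta> ` X)) \<longleftrightarrow> even k"
  proof
    assume "\<exists>X. singular \<Gamma> X \<and> has_pdim \<Gamma> X (k - 1) \<and> opposite_subspaces \<Gamma> X (\<theta> ` X)"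
    then obtain X where X: "singular \<Gamma> X" "has_pdim \<Gamma> X (k - 1)" "opposite_subspaces \<Gamma> X (\<theta> ` X)"
      by blast
    define U where "U = span (\<Union>X)"
    have U: "totally_isotropic U" "X = proj_points U"
      using singular_imp[OF X(1)] by (auto simp: U_def)
    then have "fdim U (Suc (k - 1))"
      using X(2) has_pdim_proj_points by blast
    then show "even k"
      using opposite_iff[OF U(1)] nondegenerate_even X(3) U(2) Suc by metis
  next
    assume "even k"
    then obtain j where j: "k = 2 * j"
      by blast
    then obtain W where W: "totally_isotropic W" "fdim W k" "nondegenerate W"
      using nondegenerate_exists[of j] k by auto
    then have dim: "fdim W (Suc (k - 1))"
      using Suc by simp
    then show "\<exists>X. singular \<Gamma> X \<and> has_pdim \<Gamma> X (k - 1) \<and> opposite_subspaces \<Gamma> X (\<theta> ` X)"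
      using singular_proj_points[OF W(1)] has_pdim_proj_points[OF W(1)] opposite_iff[OF W(1) dim] W(3)
      by blast
  qed
  moreover have "k \<in> {2 * j | j. 1 \<le> j \<and> j \<le> n div 2} \<longleftrightarrow> even k"
    using k by (auto elim!: evenE)
  ultimately show "(\<exists>X. singular \<Gamma> X \<and> has_pdim \<Gamma> X (k - 1) \<and> opposite_subspaces \<Gamma> X (\<theta> ` X))
      \<longleftrightarrow> k \<in> {2 * j | j. 1 \<le> j \<and> j \<le> n div 2}"
    by blast
qed

lemma ideal_involution:
  assumes "collineation \<Gamma> \<theta>" "nontrivial \<Gamma> \<theta>" "2 \<le> n"
  shows "ideal_baer_involution \<Gamma> n \<theta>"
  unfolding ideal_baer_involution_def
proof (intro conjI exI[of _ Q] ballI allI impI)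
  show "\<theta> (\<theta> x) = x" if x: "x \<in> points \<Gamma>" for x
  proof -
    obtain v where "isotropic v" "x = span {v}"
      using x mem_points by blast
    then show ?thesis
      using theta isotropic_T by simp
  qed
  show "{x \<in> points \<Gamma>. \<theta> x = x} = Q"
  proof (intro set_eqI iffI)
    fix x assume "x \<in> {x \<in> points \<Gamma>. \<theta> x = x}"
    then obtain v where v: "isotropic v" "x = span {v}" "span {T v} = span {v}"
      using mem_points theta by auto
    then have "T v \<in> span {v}" "v \<noteq> 0"
      using span_base[of "T v" "{T v}"] by (auto simp: isotropic_def)
    \<comment> \<open>A fixed point only makes \<open>T v\<close> proportional to \<open>v\<close>;
      a fixed vector spanning it comes from \<open>hilbert_90\<close>.\<close>
    then show "x \<in> Q"
      using hilbert_90 v(2) mem_Q by metis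
  next
    fix x assume "x \<in> Q"
    then obtain v where "v \<noteq> 0" "T v = v" "x = span {v}"
      using mem_Q by blast
    moreover from this have "isotropic v"
      using fixed_is_isotropic by blast
    ultimately show "x \<in> {x \<in> points \<Gamma>. \<theta> x = x}"
      using theta[of v] mem_points by auto
  qed
  fix X assume X: "singular \<Gamma> X \<and> \<theta> ` X = X"
  define U where "U = span (\<Union>X)"
  have U: "totally_isotropic U" "X = proj_points U"
    using singular_imp X by (auto simp: U_def)
  have sub: "subspace U"
    using U by (simp add: totally_isotropic_def)
  have "T x \<in> U" if x: "x \<in> U" for x
  proof (cases "x = 0")
    case False
    then have "span {x} \<in> X"
      using x U(2) by (simp add: span_in_proj_points sub)
    then have "\<theta> (span {x}) \<in> X"
      using X by blast
    then have "span {T x} \<in> proj_points U"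
      using theta totally_isotropic_isotropic[OF U(1) x False] U(2) by simp
    then show ?thesis
      using False by (simp add: span_in_proj_points sub)
  qed (use x in simp)
  then show "belongs_to \<Gamma> Q X"
    using belongs_stable[of U] U by (simp add: stable_def)
qed (use assms ideal_baer in simp_all)

end

end

section \<open>Collineations as maps on vectors\<close>

context hermitian_form
begin

context
  fixes \<theta> :: "'v set \<Rightarrow> 'v set" and n :: nat
  assumes collin: "collineation \<Gamma> \<theta>"
begin

text \<open>The scalars are arbitrary at this stage; they are normalised later by
  \<open>lift\<close>, once a fixed point is available.\<close>

definition lift_point :: "'v \<Rightarrow> 'v" where
  "lift_point v = (SOME w. isotropic w \<and> \<theta> (span {v}) = span {w})"

lemma lift_point:
  assumes "isotropic v"
  shows "isotropic (lift_point v)" "\<theta> (span {v}) = span {lift_point v}"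
proof -
  have "span {v} \<in> points \<Gamma>"
    using assms mem_points by blast
  then have "\<theta> (span {v}) \<in> points \<Gamma>"
    using collin unfolding collineation_def by (blast dest: bij_betwE)
  then have "\<exists>w. isotropic w \<and> \<theta> (span {v}) = span {w}"
    using mem_points by blast
  then have "isotropic (lift_point v) \<and> \<theta> (span {v}) = span {lift_point v}"
    unfolding lift_point_def by (rule someI_ex)
  then show "isotropic (lift_point v)" "\<theta> (span {v}) = span {lift_point v}"
    by blast+
qed

text \<open>To reflect collinearity, a line through two image points is pulled back: its preimage is
  a point set mapped onto a line and therefore a line itself.\<close>

lemma collineation_coll:
  assumes x: "x \<in> points \<Gamma>" and y: "y \<in> points \<Gamma>"
  shows "coll \<Gamma> (\<theta> x) (\<theta> y) \<longleftrightarrow> coll \<Gamma> x y"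
proof -
  have bij: "bij_betw \<theta> (points \<Gamma>) (points \<Gamma>)"
    and lines: "\<And>l. l \<subseteq> points \<Gamma> \<Longrightarrow> \<theta> ` l \<in> lines \<Gamma> \<longleftrightarrow> l \<in> lines \<Gamma>"
    using collin by (auto simp: collineation_def)
  have sub: "l \<subseteq> points \<Gamma>" if l: "l \<in> lines \<Gamma>" for l
  proof -
    obtain U where "totally_isotropic U" "l = proj_points U"
      using l by (auto simp: hermitian_polar_space_def)
    then show ?thesis
      using geom_subspace_proj_points by (simp add: geom_subspace_def)
  qed
  have inj: "\<theta> a = \<theta> b \<longleftrightarrow> a = b" if "a \<in> points \<Gamma>" "b \<in> points \<Gamma>" for a b
    using bij that by (auto simp: bij_betw_def inj_on_def)
  have img: "\<theta> a \<in> points \<Gamma>" if "a \<in> points \<Gamma>" for a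
    using bij that by (auto simp: bij_betw_def)
  have "(\<exists>m\<in>lines \<Gamma>. \<theta> x \<in> m \<and> \<theta> y \<in> m) \<longleftrightarrow> (\<exists>l\<in>lines \<Gamma>. x \<in> l \<and> y \<in> l)"
  proof
    assume "\<exists>m\<in>lines \<Gamma>. \<theta> x \<in> m \<and> \<theta> y \<in> m"
    then obtain m where m: "m \<in> lines \<Gamma>" "\<theta> x \<in> m" "\<theta> y \<in> m"
      by blast
    define l where "l = {a \<in> points \<Gamma>. \<theta> a \<in> m}"
    have "m \<subseteq> \<theta> ` points \<Gamma>"
      using sub[OF m(1)] bij by (simp add: bij_betw_def)
    then have "\<theta> ` l = m"
      by (auto simp: l_def)
    then have "l \<in> lines \<Gamma>"
      using lines[of l] m(1) by (auto simp: l_def)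
    moreover have "x \<in> l" "y \<in> l"
      using x y m by (simp_all add: l_def)
    ultimately show "\<exists>l\<in>lines \<Gamma>. x \<in> l \<and> y \<in> l"
      by blast
  next
    assume "\<exists>l\<in>lines \<Gamma>. x \<in> l \<and> y \<in> l"
    then obtain l where l: "l \<in> lines \<Gamma>" "x \<in> l" "y \<in> l"
      by blast
    then have "\<theta> ` l \<in> lines \<Gamma>"
      using lines sub by blast
    then show "\<exists>m\<in>lines \<Gamma>. \<theta> x \<in> m \<and> \<theta> y \<in> m"
      using l by blast
  qed
  then show ?thesis
    using inj img x y by (simp add: coll_def)
qed

lemma domestic_map_lift_point:
  assumes dom: "point_domestic \<Gamma> \<theta>" and rank: "has_rank \<Gamma> n" and n: "3 \<le> n"
  shows "domestic_map scale \<sigma> h lift_point"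
proof unfold_locales
  note lp = lift_point
  fix v assume v: "isotropic v"
  show "isotropic (lift_point v)"
    using lp v by blast
  have "span {v} \<in> points \<Gamma>" "span {lift_point v} \<in> points \<Gamma>"
    using v lp mem_points by blast+
  then have "coll \<Gamma> (span {v}) (span {lift_point v})"
    using dom lp(2)[OF v] unfolding point_domestic_def opposite_points_def by auto
  then show "h v (lift_point v) = 0"
    using coll_iff v lp by blast
  fix w assume w: "isotropic w"
  show "h (lift_point v) (lift_point w) = 0 \<longleftrightarrow> h v w = 0"
  proof -
    have "span {v} \<in> points \<Gamma>" "span {w} \<in> points \<Gamma>"
      using v w mem_points by blast+
    then have "coll \<Gamma> (span {lift_point v}) (span {lift_point w}) \<longleftrightarrow> coll \<Gamma> (span {v}) (span {w})"
      using collineation_coll lp(2)[OF v] lp(2)[OF w] by metis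
    then show ?thesis
      using coll_iff[OF v w] coll_iff[OF lp(1)[OF v] lp(1)[OF w]] by blast
  qed
  \<comment> \<open>Quantified afresh because the line condition below needs it for the pair
    \<open>v\<close>, \<open>u\<close> as well.\<close>
  show span: "lift_point w \<in> span {lift_point v} \<longleftrightarrow> w \<in> span {v}" if v: "isotropic v" and w: "isotropic w" for v w
  proof -
    have eq: "a \<in> span {b} \<longleftrightarrow> span {a} = span {b}" if "isotropic a" for a b
    proof -
      have "a \<noteq> 0" "a \<in> span {a}"
        using that span_base[of a "{a}"] by (auto simp: isotropic_def)
      then show ?thesis
        using span_single_eq[of a b] by blast
    qed
    have "inj_on \<theta> (points \<Gamma>)"
      using collin by (auto simp: collineation_def bij_betw_def)
    moreover have "span {v} \<in> points \<Gamma>" "span {w} \<in> points \<Gamma>"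
      using v w mem_points by blast+
    ultimately have "\<theta> (span {w}) = \<theta> (span {v}) \<longleftrightarrow> span {w} = span {v}"
      by (auto simp: inj_on_eq_iff)
    then show ?thesis
      using eq[OF w] eq[OF lp(1)[OF w]] lp(2)[OF v] lp(2)[OF w] by simp
  qed
  show "\<exists>m. isotropic m \<and> m \<in> perp {v, w} \<and> m \<notin> span {v, w}" if vw: "h v w = 0"
  proof -
    have "h x y = 0" if "x \<in> {v, w}" "y \<in> {v, w}" for x y
      using that v w vw form_eq_0_sym[of v w] by (auto simp: isotropic_def)
    then have "totally_isotropic (span {v, w})"
      by (rule totally_isotropic_span)
    then obtain W where W: "totally_isotropic W" "span {v, w} \<subseteq> W" "fdim W n"
      using totally_isotropic_extend[OF rank] by blast
    obtain B where B: "independent B" "span B = W" "card B = n"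
      using W(3) by (auto simp: fdim_def)
    \<comment> \<open>Here the rank enters: \<open>W\<close> has dimension \<open>n \<ge> 3\<close>,
      while \<open>span {v, w}\<close> has dimension at most 2.\<close>
    have "\<not> W \<subseteq> span {v, w}"
    proof
      assume "W \<subseteq> span {v, w}"
      then have "B \<subseteq> span {v, w}"
        using B span_superset by blast
      then have "card B \<le> card {v, w}"
        using independent_span_bound[of "{v, w}" B] B by simp
      also have "\<dots> \<le> 2"
        by (simp add: card_insert_if)
      finally show False
        using B n by simp
    qed
    then obtain m where m: "m \<in> W" "m \<notin> span {v, w}"
      by blast
    then have "m \<noteq> 0"
      using span_zero by metis
    moreover have "v \<in> W" "w \<in> W"
      using W(2) span_superset by blast+
    ultimately have "isotropic m" "m \<in> perp {v, w}"
      using m W(1) totally_isotropic_isotropic[OF W(1)]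
      by (auto simp: perp_def totally_isotropic_def)
    then show ?thesis
      using m by blast
  qed
  fix u assume u: "isotropic u" and vw: "h v w = 0" and us: "u \<in> span {v, w}"
  show "lift_point u \<in> span {lift_point v, lift_point w}"
  proof (cases "w \<in> span {v}")
    case True
    then have "span {v, w} = span {v}"
      using span_redundant[of w "{v}"] by (simp add: insert_commute)
    then have "lift_point u \<in> span {lift_point v}"
      using us span[OF v u] by simp
    then show ?thesis
      using span_mono[of "{lift_point v}" "{lift_point v, lift_point w}"] by auto
  next
    case False
    let ?l = "proj_points (span {v, w})"
    have l: "?l \<in> lines \<Gamma>"
      using False v w vw mem_lines by blast
    then obtain U where "totally_isotropic U" "?l = proj_points U"
      by (auto simp: hermitian_polar_space_def)
    then have "?l \<subseteq> points \<Gamma>"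
      using geom_subspace_proj_points by (simp add: geom_subspace_def)
    then have "\<theta> ` ?l \<in> lines \<Gamma>"
      using collin l by (simp add: collineation_def)
    moreover have mem: "span {lift_point x} \<in> \<theta> ` ?l" if x: "isotropic x" "x \<in> span {v, w}" for x
    proof -
      have "span {x} \<in> ?l"
        using x by (simp add: span_in_proj_points isotropic_def)
      then show ?thesis
        using lp(2)[OF x(1)] by force
    qed
    moreover have "lift_point v \<noteq> 0"
      using lp(1)[OF v] by (simp add: isotropic_def)
    moreover have "lift_point w \<notin> span {lift_point v}"
      using span[OF v w] False by blast
    ultimately have "\<theta> ` ?l = proj_points (span {lift_point v, lift_point w})"
      using v w by (intro line_eq) (auto simp: span_base)
    then show ?thesis
      using mem[OF u us] lp(1)[OF u] by (simp add: span_in_proj_points isotropic_def)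
  qed
qed

lemma point_domestic_semilinear:
  assumes dom: "point_domestic \<Gamma> \<theta>" and rank: "has_rank \<Gamma> n" and n: "3 \<le> n"
    and fixpoint: "\<exists>x\<in>points \<Gamma>. \<theta> x = x" and nontriv: "nontrivial \<Gamma> \<theta>"
  obtains T where "symplectic_conjugation scale \<sigma> h T"
    "\<And>v. isotropic v \<Longrightarrow> \<theta> (span {v}) = span {T v}"
proof -
  interpret domestic_map scale \<sigma> h lift_point
    using domestic_map_lift_point[OF dom rank n] .
  have fixed: "fixed v \<longleftrightarrow> \<theta> (span {v}) = span {v}" if v: "isotropic v" for v
  proof -
    have "lift_point v \<noteq> 0" "lift_point v \<in> span {lift_point v}"
      using lift_point(1)[OF v] span_base by (auto simp: isotropic_def)
    then show ?thesis
      using lift_point(2)[OF v] span_single_eq[of "lift_point v" v] by (auto simp: fixed_def)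
  qed
  obtain e where e: "isotropic e" "\<theta> (span {e}) = span {e}"
    using fixpoint unfolding mem_points Bex_def by blast
  obtain z where z: "isotropic z" "\<theta> (span {z}) \<noteq> span {z}"
    using nontriv unfolding nontrivial_def mem_points Bex_def by blast
  have "fixed e" "\<exists>z. isotropic z \<and> \<not> fixed z"
    using e z fixed by auto
  then interpret domestic_map_fixed scale \<sigma> h lift_point e
    using e by unfold_locales
  have "symplectic_conjugation scale \<sigma> h T"
    using T_add T_scale T_T T_form T_alternating by unfold_locales
  moreover have "\<theta> (span {v}) = span {T v}" if v: "isotropic v" for v
    using span_single_eq[OF r_T[OF v]] lift_point[OF v] isotropic_nonzero by simp
  ultimately show thesis
    by (rule that)
qed

end

end

theorem proposition3p17:
  fixes scale :: "'k::field \<Rightarrow> 'v::ab_group_add \<Rightarrow> 'v"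
    and \<sigma> :: "'k \<Rightarrow> 'k" and h :: "'v \<Rightarrow> 'v \<Rightarrow> 'k"
    and \<Delta> :: "'v set geometry" and \<theta> :: "'v set \<Rightarrow> 'v set" and n :: nat
  assumes "hermitian_form scale \<sigma> h"
    and "\<Delta> = hermitian_form.hermitian_polar_space scale h"
    and "has_rank \<Delta> n" and "n \<ge> 3"
    and "collineation \<Delta> \<theta>" and "nontrivial \<Delta> \<theta>" and "point_domestic \<Delta> \<theta>"
    and "\<exists>x\<in>points \<Delta>. \<theta> x = x"
  shows "hermitian_form.ideal_baer_involution scale \<Delta> n \<theta> \<and>
    (\<exists>m. 2 * m \<in> {n - 1, n} \<and> diagram_B2 \<Delta> n m \<theta>)"
proof -
  interpret hermitian_form scale \<sigma> h
    by fact
  note facts = assms[unfolded assms(2)]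
  obtain T where T: "symplectic_conjugation scale \<sigma> h T"
    and theta: "\<And>v. isotropic v \<Longrightarrow> \<theta> (span {v}) = span {T v}"
    using point_domestic_semilinear[OF facts(5,7,3,4,8,6)] by blast
  interpret ranked_conjugation scale \<sigma> h T n
    using T facts(3) by (intro ranked_conjugation.intro ranked_conjugation_axioms.intro)
  have "ideal_baer_involution hermitian_polar_space n \<theta>"
    using assms(4) by (intro ideal_involution theta facts(5,6)) auto
  moreover have "diagram_B2 hermitian_polar_space n (n div 2) \<theta>"
    by (intro diagram theta)
  moreover have "2 * (n div 2) \<in> {n - 1, n}"
    by (cases "even n") (auto elim: oddE)
  ultimately show ?thesis
    unfolding assms(2) by blast
qed

end
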